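(* Fix an integer $k\ge 1$ (for $k=1$, either of the two models below). There exist constants $s_0>0$, $c_1>0$, $c_2>0$ such that for all $0<s<s_0$, \[ \exp\!\left(-2\lambda_k s^{-1}+c_1 s^{-1/2}\right)\;\le\;\mathbf{P}(\text{indefinite growth})\;\le\;\exp\!\left(-2\lambda_k s^{-1}+c_2 s^{-1/2}\left(\log s^{-1}\right)^{5/2}\right), \] where $\lambda_k=\frac{\pi^2}{3k(k+1)}$. For the $k=1$ Frobse model the upper bound holds with $\left(\log s^{-1}\right)^{5/2}$ replaced by $\log s^{-1}$.
   Context: Local $k$-percolation on $\mathbb{Z}^2$. Let $s>0$ and $q=e^{-s}$. The initial configuration is random: the origin is active with probability $1-q$ and empty with probability $q$; every other site is, independently, occupied with probability $1-q$ and empty with probability $q$. Active sites remain active forever, and the set of active sites is enlarged by repeatedly applying the growth rules below (the final set of active sites is the smallest set containing the initially active sites that is closed under the rules). For $k\ge2$, with $N_k(x)=\{x+(v,0),\,x+(0,v): v\in\mathbb{Z},\,1\le |v|\le k-1\}$: an occupied site becomes active if some active site lies within $\ell^1$-distance $k$ of it; an empty site $x$ becomes active if at least $k$ sites of $N_k(x)$ are active. For $k=1$ there are two models. Modified model: an occupied site becomes active if some active site lies within $\ell^\infty$-distance $1$; an empty site $x$ becomes active if at least one of $x\pm(0,1)$ and at least one of $x\pm(1,0)$ are active. Frobse model: an occupied site becomes active if some active site lies within $\ell^1$-distance $1$; an empty site $x$ becomes active if for some $\varepsilon,\delta\in\{\pm1\}$ the sites $x+(\varepsilon,0)$, $x+(0,\delta)$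 and the corner site $x+(\varepsilon,\delta)$ are all active. "Indefinite growth" is the event that every site of $\mathbb{Z}^2$ eventually becomes active; $\mathbf{P}$ is the probability measure of the initial configuration. *)

theory Defs
  imports "HOL-Probability.Probability"
begin

type_synonym site = "int \<times> int"

text \<open>Configuration: \<omega> x = True means "occupied" (for the origin: active),
  \<omega> x = False means "empty". Each site independently True with prob. 1 - q.\<close>
type_synonym config = "site \<Rightarrow> bool"

datatype perc_model = KPerc nat | Modified1 | Frobse1

definition valid_model :: "perc_model \<Rightarrow> bool" where
  "valid_model M = (case M of KPerc k \<Rightarrow> k \<ge> 2 | _ \<Rightarrow> True)"

definition model_k :: "perc_model \<Rightarrow> nat" where
  "model_k M = (case M of KPerc k \<Rightarrow> k | _ \<Rightarrow> 1)"

definition l1dist :: "site \<Rightarrow> site \<Rightarrow> int" where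
  "l1dist x y = \<bar>fst x - fst y\<bar> + \<bar>snd x - snd y\<bar>"

definition linfdist :: "site \<Rightarrow> site \<Rightarrow> int" where
  "linfdist x y = max \<bar>fst x - fst y\<bar> \<bar>snd x - snd y\<bar>"

definition Nk :: "nat \<Rightarrow> site \<Rightarrow> site set" where
  "Nk k x = {(fst x + v, snd x) | v. 1 \<le> \<bar>v\<bar> \<and> \<bar>v\<bar> \<le> int k - 1}
          \<union> {(fst x, snd x + v) | v. 1 \<le> \<bar>v\<bar> \<and> \<bar>v\<bar> \<le> int k - 1}"

definition occ_rule :: "perc_model \<Rightarrow> site set \<Rightarrow> site \<Rightarrow> bool" where
  "occ_rule M A x = (case M of
      KPerc k \<Rightarrow> (\<exists>y\<in>A. l1dist x y \<le> int k)
    | Modified1 \<Rightarrow> (\<exists>y\<in>A. linfdist x y \<le> 1)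
    | Frobse1 \<Rightarrow> (\<exists>y\<in>A. l1dist x y \<le> 1))"

definition empty_rule :: "perc_model \<Rightarrow> site set \<Rightarrow> site \<Rightarrow> bool" where
  "empty_rule M A x = (case M of
      KPerc k \<Rightarrow> k \<le> card (Nk k x \<inter> A)
    | Modified1 \<Rightarrow>
        (((fst x, snd x + 1) \<in> A \<or> (fst x, snd x - 1) \<in> A) \<and>
         ((fst x + 1, snd x) \<in> A \<or> (fst x - 1, snd x) \<in> A))
    | Frobse1 \<Rightarrow> (\<exists>e\<in>{1,-1}. \<exists>d\<in>{1,-1}.
         (fst x + e, snd x) \<in> A \<and> (fst x, snd x + d) \<in> A \<and> (fst x + e, snd x + d) \<in> A))"

definition init_active :: "config \<Rightarrow> site set" where
  "init_active \<omega> = (if \<omega> (0,0) then {(0,0)} else {})"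

definition closed_under :: "perc_model \<Rightarrow> config \<Rightarrow> site set \<Rightarrow> bool" where
  "closed_under M \<omega> S =
     (\<forall>x. (\<omega> x \<and> occ_rule M S x \<longrightarrow> x \<in> S) \<and>
          (\<not> \<omega> x \<and> empty_rule M S x \<longrightarrow> x \<in> S))"

definition final_active :: "perc_model \<Rightarrow> config \<Rightarrow> site set" where
  "final_active M \<omega> = \<Inter> {S. init_active \<omega> \<subseteq> S \<and> closed_under M \<omega> S}"

definition indefinite_growth :: "perc_model \<Rightarrow> config set" where
  "indefinite_growth M = {\<omega>. final_active M \<omega> = UNIV}"

definition config_measure :: "real \<Rightarrow> config measure" where
  "config_measure s = (\<Pi>\<^sub>M x\<in>UNIV. measure_pmf (bernoulli_pmf (1 - exp (- s))))"

definition P_growth :: "perc_model \<Rightarrow> real \<Rightarrow> real" where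
  "P_growth M s = measure (config_measure s) (indefinite_growth M)"

definition lambda_k :: "nat \<Rightarrow> real" where
  "lambda_k k = pi^2 / (3 * real k * (real k + 1))"

end

theory Submission
  imports Defs "HOL-Real_Asymp.Real_Asymp"
begin

text \<open>
  Write \<open>k\<close> for the range of the model. A sequence of independent cells, each empty with probability
  \<open>exp (- z)\<close>, has no \<open>k\<close> consecutive empty cells with probability decaying like \<open>exp (- g z)\<close> per
  cell, and \<open>g = gk k\<close> is convex and decreasing with integral \<open>\<lambda>\<^sub>k\<close>. Both facts come from the
  parametrisation \<open>z = ln (1 + 1 / (e\<^sup>-\<^sup>t + \<dots> + e\<^sup>-\<^sup>k\<^sup>t)) = zeta k t\<close>, \<open>g z = z - t = zeta k (- t)\<close>: the
  function \<open>zeta k\<close> is convex, and its integral over the negative half-line is a difference of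
  dilogarithms.

  Lower bound: an active square grows along the diagonal, at a cost of \<open>g\<close> per new column and per new
  row, for a total of \<open>2 \<lambda>\<^sub>k / s\<close>. At scales of order \<open>1/s\<close> one grows in blocks of length of order
  \<open>s\<^sup>-\<^sup>1\<^sup>/\<^sup>2\<close>. In every block the columns or the rows may come first; this gains a constant factor per
  block, hence \<open>exp (c s\<^sup>-\<^sup>1\<^sup>/\<^sup>2)\<close> altogether.

  Upper bound: if the active cluster is unbounded then every rectangle containing it is
  neighboured by an occupied site. One follows the growth of the bounding rectangle in steps of length
  about \<open>s\<^sup>-\<^sup>1\<^sup>/\<^sup>2 ln (1/s)\<close> and takes a union bound over the dimensions reached. The new columns and
  rows are independent except for the sites in the corners of the new rectangle; these are
  handled by a union bound over the corner sites that are really needed. The resulting recursive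
  inequality is solved by the potential \<open>W x y = \<bar>x - y\<bar> g (max x y) + 2 \<integral> g\<close> over \<open>[max x y, \<infinity>)\<close>,
  since by convexity of \<open>g\<close> diagonal growth is cheapest.
\<close>

section \<open>The decay rate of gap probabilities\<close>

text \<open>The number \<open>exp (- g z)\<close> is the Perron eigenvalue of the chain that counts
  the current run of empty cells. With \<open>y = exp (- t)\<close> the eigenvector at run
  \<open>j\<close> is \<open>1 + y + ... + y^(k-1-j)\<close>, and solving the eigenvalue equation
  for \<open>z\<close> gives \<open>z = zeta k t\<close>. The block length of the lower bound is
  forced: over \<open>l\<close> lines the costs of short and long lines differ by about
  \<open>l * (s * l) * |g'|\<close>, which reaches order one when \<open>l\<close> is of order
  \<open>s^(-1/2)\<close>. For shorter blocks the overlap of the two crossings eats the gain, longer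
  blocks are fewer. The cost of the blocks is a trapezoidal sum, whose error stays far below the
  gain. In the upper bound one corner site may serve a column and a row at once, which destroys
  independence of the strips. Paying for the corner sites used costs a factor
  \<open>exp (s * m * n * v)\<close> for \<open>m\<close> columns and \<open>n\<close> rows, where
  \<open>v\<close> blows up for small sides. Each round also costs \<open>O(ln (1/s))\<close> in the
  exponent for the choice of the new extents. Round lengths proportional to
  \<open>1 - exp (- (s * a))\<close> cancel the blow-up of \<open>v\<close>, and the number of
  rounds is still of order \<open>s^(-1/2)\<close>.\<close>

definition geo :: "nat \<Rightarrow> real \<Rightarrow> real" where
  "geo k t = (\<Sum>j=1..k. exp (- (real j * t)))"

definition zeta :: "nat \<Rightarrow> real \<Rightarrow> real" where
  "zeta k t = ln (1 + 1 / geo k t)"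

text \<open>The derivative of \<open>zeta k\<close> in a form that is regular at \<open>0\<close>,
  in contrast to \<open>dzeta_formula\<close>, which comes from the closed form for
  \<open>t > 0\<close>.\<close>

definition dzeta :: "nat \<Rightarrow> real \<Rightarrow> real" where
  "dzeta k t = (\<Sum>j=1..k. real j * exp (- (real j * t))) / (geo k t * (geo k t + 1))"

lemma geo_pos: "k \<ge> 1 \<Longrightarrow> geo k t > 0"
  unfolding geo_def by (intro sum_pos) auto

lemma geo_ge: assumes "k \<ge> 1" shows "geo k t \<ge> exp (- t)"
proof -
  have "(\<Sum>j\<in>{1}. exp (- (real j * t))) \<le> geo k t"
    unfolding geo_def using assms by (intro sum_mono2) auto
  thus ?thesis by simp
qed

lemma geo_shift: "geo k t + exp (- (real (k + 1) * t)) = exp (- t) * (geo k t + 1)"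
proof (induction k)
  case (Suc k)
  have "exp (- (real (Suc k + 1) * t)) = exp (- t) * exp (- (real (k + 1) * t))"
    by (simp add: exp_add[symmetric] algebra_simps)
  moreover have "geo (Suc k) t = geo k t + exp (- (real (k + 1) * t))" by (simp add: geo_def)
  moreover have "(X + E) + A * E = A * (X + E + 1)" if h: "X + E = A * (X + 1)" for X E A :: real
  proof -
    have "A * (X + E + 1) = A * (X + 1) + A * E" by (simp add: algebra_simps)
    thus ?thesis using h by linarith
  qed
  ultimately show ?case using Suc by metis
qed (simp add: geo_def)

lemma geo_minus: "geo k (- t) = exp (real (k + 1) * t) * geo k t"
proof -
  have "geo k (-t) = (\<Sum>j=1..k. exp (- (real (k + 1 - j) * (- t))))"
    unfolding geo_def using sum.atLeastAtMost_rev[of "\<lambda>j. exp (- (real j * (- t)))" 1 k] by simp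
  also have "\<dots> = (\<Sum>j=1..k. exp (real (k + 1) * t) * exp (- (real j * t)))"
    by (intro sum.cong) (auto simp: exp_add[symmetric] of_nat_diff algebra_simps)
  finally show ?thesis by (simp add: geo_def sum_distrib_left)
qed

lemma zeta_pos: "k \<ge> 1 \<Longrightarrow> zeta k t > 0"
  using geo_pos[of k t] by (simp add: zeta_def field_simps)

lemma exp_zeta: "k \<ge> 1 \<Longrightarrow> exp (zeta k t) = 1 + 1 / geo k t"
  using geo_pos[of k t] by (simp add: zeta_def add_pos_pos)

text \<open>Reversing the order of summation gives \<open>geo_minus\<close>, and
  \<open>geo_shift\<close> then absorbs the extra exponential. This symmetry is the reason why
  \<open>g\<close>, the difference of \<open>z\<close> and its parameter, is again a value of
  \<open>zeta k\<close>.\<close>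

lemma zeta_minus: assumes "k \<ge> 1" shows "zeta k (- t) = zeta k t - t"
proof -
  let ?E = "exp (- (real (k + 1) * t))"
  have p: "geo k t > 0" "geo k (- t) > 0" using geo_pos[OF assms] by auto
  have E: "exp (real (k + 1) * t) = 1 / ?E" by (simp only: exp_minus divide_inverse inverse_inverse_eq mult_1)
  have "1 / geo k (- t) = ?E / geo k t"
    unfolding geo_minus E using p by (simp add: field_simps)
  hence "exp (zeta k (- t)) = 1 + ?E / geo k t"
    using exp_zeta[OF assms, of "- t"] by simp
  also have "\<dots> = (geo k t + ?E) / geo k t" using p by (simp add: field_simps)
  also have "\<dots> = exp (- t) * (1 + 1 / geo k t)" unfolding geo_shift using p by (simp add: field_simps)
  also have "\<dots> = exp (- t) * exp (zeta k t)" using exp_zeta[OF assms, of t] by simp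
  also have "\<dots> = exp (zeta k t - t)" by (simp add: exp_add[symmetric])
  finally show ?thesis by simp
qed

lemma zeta_le_exp: assumes "k \<ge> 1" shows "zeta k t \<le> exp t"
proof -
  have "zeta k t \<le> 1 / geo k t"
    unfolding zeta_def using geo_pos[OF assms, of t] by (intro ln_add_one_self_le_self) auto
  also have "\<dots> \<le> 1 / exp (- t)" using geo_ge[OF assms, of t] by (intro divide_left_mono) (auto intro!: mult_pos_pos geo_pos assms)
  also have "1 / exp (- t) = exp t" by (simp add: exp_minus divide_inverse)
  finally show ?thesis .
qed

lemma zeta_ge: "k \<ge> 1 \<Longrightarrow> zeta k t \<ge> t"
  using zeta_minus[of k t] zeta_pos[of k "- t"] by simp

lemma geo_deriv: "(geo k has_real_derivative - (\<Sum>j=1..k. real j * exp (- (real j * t)))) (at t)"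
  unfolding geo_def[abs_def] sum_negf[symmetric]
  by (auto intro!: derivative_eq_intros sum.cong)

lemma zeta_deriv: assumes "k \<ge> 1" shows "(zeta k has_real_derivative dzeta k t) (at t)"
proof -
  have p: "geo k t > 0" using geo_pos[OF assms] .
  show ?thesis unfolding zeta_def[abs_def] dzeta_def
    by (rule derivative_eq_intros geo_deriv | use p in \<open>simp add: add_pos_pos; fail\<close>)+
      (use p in \<open>simp add: divide_simps power2_eq_square; simp add: algebra_simps\<close>)
qed

lemma dzeta_pos: assumes "k \<ge> 1" shows "dzeta k t > 0"
  unfolding dzeta_def using geo_pos[OF assms, of t] assms
  by (intro divide_pos_pos mult_pos_pos sum_pos) auto

lemma zeta_strict_mono: assumes "k \<ge> 1" "x < y" shows "zeta k x < zeta k y"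
  by (rule DERIV_pos_imp_increasing[OF assms(2)]) (use zeta_deriv dzeta_pos assms in blast)

lemma zeta_less_iff: "k \<ge> 1 \<Longrightarrow> zeta k x < zeta k y \<longleftrightarrow> x < y"
  using zeta_strict_mono[of k] by (metis linorder_neqE_linordered_idom order_less_asym)

lemma zeta_le_iff: "k \<ge> 1 \<Longrightarrow> zeta k x \<le> zeta k y \<longleftrightarrow> x \<le> y"
  using zeta_less_iff[of k y x] by linarith

lemma zeta_inj: "k \<ge> 1 \<Longrightarrow> zeta k x = zeta k y \<longleftrightarrow> x = y"
  using zeta_le_iff[of k x y] zeta_le_iff[of k y x] by auto

lemma geo_closed: assumes "t \<noteq> 0" shows "geo k t = (1 - exp (- (real k * t))) / (exp t - 1)"
proof (induction k)
  case (Suc k)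
  have [simp]: "exp t - 1 \<noteq> 0" using assms by simp
  have "geo k t + exp (- (real (Suc k) * t)) = (1 - exp (- (real (Suc k) * t))) / (exp t - 1)"
  proof -
    have "exp (- (real k * t)) = exp (- (real (Suc k) * t)) * exp t"
      by (simp add: exp_add[symmetric] algebra_simps)
    moreover have "(1 - E * X) / (X - 1) + E = (1 - E) / (X - 1)" if "X \<noteq> 1" for X E :: real
      using that by (simp add: divide_simps) (simp add: algebra_simps)
    ultimately show ?thesis unfolding Suc using assms by simp
  qed
  thus ?case by (simp add: geo_def)
qed (simp add: geo_def)

lemma zeta_closed: assumes "t > 0" "k \<ge> 1"
  shows "zeta k t = ln (1 - exp (- (real (k+1) * t))) - ln (1 - exp (- (real k * t))) + t"
proof -
  let ?a = "exp (- (real k * t))" and ?b = "exp (- (real (k+1) * t))"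
  have b: "?b = ?a * exp (- t)" by (simp add: exp_add[symmetric] algebra_simps)
  have et: "exp t > 1" "?a < 1" "?b < 1" using assms by auto
  have "1 + 1 / geo k t = (exp t - ?a) / (1 - ?a)"
  proof -
    have "t \<noteq> 0" "1 - ?a \<noteq> 0" "exp t - 1 \<noteq> 0" using et assms by auto
    moreover have "1 + 1 / (A / B) = (B + 1 - (1 - A)) / A" if "A \<noteq> 0" "B \<noteq> 0" for A B :: real
      using that by (simp add: divide_simps)
    ultimately show ?thesis unfolding geo_closed[OF \<open>t \<noteq> 0\<close>] by simp
  qed
  also have "exp t - ?a = exp t * (1 - ?b)" unfolding b by (simp add: algebra_simps exp_minus)
  finally have "zeta k t = ln (exp t * (1 - ?b) / (1 - ?a))" by (simp add: zeta_def)
  also have "\<dots> = t + ln (1 - ?b) - ln (1 - ?a)"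
  proof -
    have "ln (X * Y / Z) = ln X + ln Y - ln Z" if "X > 0" "Y > 0" "Z > 0" for X Y Z :: real
      using that by (simp add: ln_div ln_mult)
    from this[of "exp t" "1 - ?b" "1 - ?a"] show ?thesis using et by simp
  qed
  finally show ?thesis by simp
qed

lemma dzeta_minus: assumes "k \<ge> 1" shows "dzeta k (- t) = 1 - dzeta k t"
proof -
  have 1: "((\<lambda>t. zeta k (- t)) has_real_derivative - dzeta k (- t)) (at t)"
  proof -
    have "((\<lambda>t. - t) has_real_derivative - 1) (at t)" by (auto intro!: derivative_eq_intros)
    from DERIV_chain2[where f = "zeta k" and g = "\<lambda>t. - t", OF zeta_deriv[OF assms] this] show ?thesis by simp
  qed
  have 2: "((\<lambda>t. zeta k (- t)) has_real_derivative dzeta k t - 1) (at t)"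
    unfolding zeta_minus[OF assms] by (intro derivative_intros zeta_deriv assms)
  show ?thesis using DERIV_unique[OF 1 2] by simp
qed

definition dzeta_formula :: "nat \<Rightarrow> real \<Rightarrow> real" where
  "dzeta_formula k t = real (k+1) / (exp (real (k+1) * t) - 1) - real k / (exp (real k * t) - 1) + 1"

lemma dzeta_closed: assumes "t > 0" "k \<ge> 1" shows "dzeta k t = dzeta_formula k t"
proof -
  have "((\<lambda>t. ln (1 - exp (- (real (k+1) * t))) - ln (1 - exp (- (real k * t))) + t)
     has_real_derivative dzeta_formula k t) (at t)"
  proof -
    have d: "((\<lambda>t. ln (1 - exp (- (c * t)))) has_real_derivative c / (exp (c * t) - 1)) (at t)" if "c > 0" for c
    proof -
      have "1 - exp (- (c * t)) > 0" "exp (c * t) - 1 > 0" using that assms by auto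
      moreover have "exp (- (c * t)) = 1 / exp (c * t)" by (simp add: exp_minus field_simps)
      moreover have "X * c / (1 - X) = c / (Y - 1)" if "1 - X > 0" "Y - 1 > 0" "X = 1 / Y" for X Y :: real
      proof -
        have "X * (Y - 1) = 1 - X" using that by (simp add: field_simps)
        moreover have "X \<noteq> 0" using that by auto
        ultimately show ?thesis using mult_divide_mult_cancel_left[of X c "Y - 1"] by simp
      qed
      ultimately have "exp (- (c * t)) * c / (1 - exp (- (c * t))) = c / (exp (c * t) - 1)" by blast
      thus ?thesis using \<open>1 - exp (- (c * t)) > 0\<close>
        by (auto intro!: derivative_eq_intros)
    qed
    have "real (k + 1) > 0" "real k > 0" using assms by auto
    thus ?thesis unfolding dzeta_formula_def by (intro derivative_intros d)
  qed
  hence "(zeta k has_real_derivative dzeta_formula k t) (at t)"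
    by (rule has_field_derivative_transform_within_open[where S = "{0<..}"]) (use assms zeta_closed in auto)
  with zeta_deriv[OF assms(2), of t] show ?thesis by (rule DERIV_unique)
qed

text \<open>The difference of the two sides vanishes at \<open>0\<close> and has derivative
  \<open>a * b * (cosh (b * t) - cosh (a * t))\<close>. This is the inequality behind the convexity
  of \<open>zeta k\<close>.\<close>

lemma sinh_scale: fixes a b t :: real assumes "0 < a" "a \<le> b" "t \<ge> 0" shows "b * sinh (a * t) \<le> a * sinh (b * t)"
proof -
  have "(\<lambda>t. a * sinh (b * t) - b * sinh (a * t)) 0 \<le> (\<lambda>t. a * sinh (b * t) - b * sinh (a * t)) t"
  proof (rule DERIV_nonneg_imp_nondecreasing[OF assms(3)])
    fix x assume "0 \<le> x" "x \<le> t"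
    hence "cosh (a * x) \<le> cosh (b * x)" using assms
      by (subst cosh_real_nonneg_le_iff) (auto intro: mult_right_mono)
    hence "a * (cosh (b * x) * b) - b * (cosh (a * x) * a) \<ge> 0" using assms by (simp add: mult.assoc mult.left_commute mult_left_mono)
    thus "\<exists>y. ((\<lambda>t. a * sinh (b * t) - b * sinh (a * t)) has_real_derivative y) (at x) \<and> 0 \<le> y"
      by (intro exI[of _ "a * (cosh (b * x) * b) - b * (cosh (a * x) * a)"]) (auto intro!: derivative_eq_intros)
  qed
  thus ?thesis by simp
qed

lemma exp_minus_one_sinh: "exp (2 * x) - 1 = 2 * exp x * sinh (x::real)"
  by (simp add: sinh_def exp_minus field_simps exp_add[symmetric])

lemma exp_sinh_ratio: "exp (2 * x) / (exp (2 * x) - 1)\<^sup>2 = 1 / (2 * sinh (x::real))\<^sup>2" if "x > 0"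
proof -
  have "sinh x > 0" using that by simp
  moreover have "exp (2 * x) = exp x ^ 2" by (simp add: power2_eq_square exp_add[symmetric])
  ultimately show ?thesis unfolding exp_minus_one_sinh
    by (simp add: field_simps power2_eq_square)
qed

text \<open>In the second derivative of \<open>zeta k\<close> each exponential quotient equals
  \<open>c^2 / (2 * sinh (c * t / 2))^2\<close>; \<open>sinh_scale\<close> compares
  \<open>c = k\<close> with \<open>c = k + 1\<close>.\<close>

lemma dzeta_mono_pos: assumes "k \<ge> 1" "0 < x" "x \<le> y" shows "dzeta k x \<le> dzeta k y"
proof -
  have "dzeta_formula k x \<le> dzeta_formula k y"
  proof (rule DERIV_nonneg_imp_nondecreasing[OF assms(3)])
    fix t assume t: "x \<le> t" "t \<le> y"
    hence tp: "t > 0" using assms by simp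
    let ?b = "real (k+1)" and ?a = "real k"
    let ?D = "- (?b * (exp (?b * t) * ?b) / (exp (?b * t) - 1)^2) - - (?a * (exp (?a * t) * ?a) / (exp (?a * t) - 1)^2) + 0"
    have d: "(dzeta_formula k has_real_derivative ?D) (at t)"
    proof -
      have e: "((\<lambda>t. c / (exp (c * t) - 1)) has_real_derivative - (c * (exp (c * t) * c) / (exp (c * t) - 1)^2)) (at t)" if "c > 0" for c
        using that tp by (auto intro!: derivative_eq_intros simp: power2_eq_square)
      have "real (k + 1) > 0" "real k > 0" using assms by auto
      hence "((\<lambda>t. ?b / (exp (?b * t) - 1) - ?a / (exp (?a * t) - 1) + 1) has_real_derivative
        (- (?b * (exp (?b * t) * ?b) / (exp (?b * t) - 1)^2) - - (?a * (exp (?a * t) * ?a) / (exp (?a * t) - 1)^2) + 0)) (at t)"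
        by (intro derivative_intros e)
      thus ?thesis unfolding dzeta_formula_def[abs_def]
        .
    qed
    have e: "c * (exp (c * t) * c) / (exp (c * t) - 1)^2 = c^2 / (2 * sinh (c * t / 2))^2" if "c > 0" for c
    proof -
      have "exp (c * t) / (exp (c * t) - 1)^2 = 1 / (2 * sinh (c * t / 2))\<^sup>2"
        using exp_sinh_ratio[of "c * t / 2"] that tp by simp
      hence "c^2 * (exp (c * t) / (exp (c * t) - 1)^2) = c^2 * (1 / (2 * sinh (c * t / 2))\<^sup>2)" by simp
      thus ?thesis by (simp add: power2_eq_square mult.commute mult.left_commute)
    qed
    have s: "?b * sinh (?a * (t/2)) \<le> ?a * sinh (?b * (t/2))"
      by (rule sinh_scale) (use assms tp in auto)
    have sp: "sinh (?a * t/2) > 0" "sinh (?b * t / 2) > 0" using assms tp by auto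
    have "?b / (2 * sinh (?b * t / 2)) \<le> ?a / (2 * sinh (?a * t / 2))"
      using s sp by (simp add: field_simps)
    hence "(?b / (2 * sinh (?b * t / 2)))^2 \<le> (?a / (2 * sinh (?a * t / 2)))^2"
      using sp by (intro power_mono) auto
    hence "?D \<ge> 0" using e[of ?a] e[of ?b] assms by (simp add: power_divide)
    thus "\<exists>y. (dzeta_formula k has_real_derivative y) (at t) \<and> 0 \<le> y" using d by blast
  qed
  thus ?thesis using assms by (simp add: dzeta_closed)
qed

lemma dzeta_cont: assumes "k \<ge> 1" shows "isCont (dzeta k) t"
proof -
  have "isCont (geo k) t" using geo_deriv DERIV_isCont by blast
  thus ?thesis unfolding dzeta_def[abs_def] using geo_pos[OF assms, of t]
    by (intro continuous_intros) auto
qed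

text \<open>The closed form reaches positive arguments only. Continuity adds the point
  \<open>0\<close>, and the reflection \<open>dzeta_minus\<close> transfers monotonicity to the
  negative half-line.\<close>

lemma dzeta_mono: assumes "k \<ge> 1" "x \<le> y" shows "dzeta k x \<le> dzeta k y"
proof -
  have half: "dzeta k 0 \<le> dzeta k y" if "y \<ge> 0" for y
  proof (cases "y = 0")
    case False
    hence "y > 0" using that by simp
    have "((dzeta k) \<longlongrightarrow> dzeta k 0) (at_right 0)"
      using dzeta_cont[OF assms(1), of 0] by (simp add: isCont_def filterlim_at_split)
    moreover have "eventually (\<lambda>x. dzeta k x \<le> dzeta k y) (at_right 0)"
      using \<open>y > 0\<close> dzeta_mono_pos[OF assms(1)] by (auto simp: eventually_at_right_field intro!: exI[of _ y])
    ultimately show ?thesis by (intro tendsto_upperbound) auto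
  qed simp
  have pos: "dzeta k x \<le> dzeta k y" if "0 \<le> x" "x \<le> y" for x y
    using that half dzeta_mono_pos[OF assms(1)] by (cases "x = 0") auto
  show ?thesis
  proof (cases "x \<ge> 0")
    case True thus ?thesis using pos assms by auto
  next
    case False
    show ?thesis
    proof (cases "y \<ge> 0")
      case True
      have "dzeta k x = 1 - dzeta k (-x)" "dzeta k 0 = 1 - dzeta k 0"
        using dzeta_minus[OF assms(1), of "x"] dzeta_minus[OF assms(1), of 0] by auto
      thus ?thesis using half[of "-x"] half[of y] True False by linarith
    next
      case f: False
      have "dzeta k (- y) \<le> dzeta k (- x)" using pos[of "-y" "-x"] f assms by auto
      thus ?thesis using dzeta_minus[OF assms(1), of "x"] dzeta_minus[OF assms(1), of y] by linarith
    qed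
  qed
qed

lemma zeta_convex: "k \<ge> 1 \<Longrightarrow> convex_on UNIV (zeta k)"
  by (rule convex_on_realI[where f' = "dzeta k"]) (auto simp: zeta_deriv dzeta_mono)

section \<open>The inverse of \<open>zeta\<close> and the rate function \<open>g\<close>\<close>

definition zinv :: "nat \<Rightarrow> real \<Rightarrow> real" where
  "zinv k z = (THE t. zeta k t = z)"

definition gk :: "nat \<Rightarrow> real \<Rightarrow> real" where
  "gk k z = z - zinv k z"

lemma zinv_zeta: "k \<ge> 1 \<Longrightarrow> zinv k (zeta k t) = t"
  unfolding zinv_def by (rule the_equality) (auto simp: zeta_inj)

lemma zeta_zinv: assumes "k \<ge> 1" "z > 0" shows "zeta k (zinv k z) = z"
proof -
  have "zeta k (ln z) \<le> z" using zeta_le_exp[OF assms(1), of "ln z"] assms by simp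
  moreover have "z \<le> zeta k z" using zeta_ge[OF assms(1)] .
  moreover have "ln z \<le> z" using ln_le_minus_one[OF assms(2)] by simp
  moreover have "continuous_on {ln z..z} (zeta k)"
    using zeta_deriv[OF assms(1)] DERIV_continuous_on has_field_derivative_at_within by blast
  ultimately obtain t where "zeta k t = z" using IVT'[of "zeta k" "ln z" z z] by auto
  thus ?thesis using zinv_zeta[OF assms(1), of t] by simp
qed

lemma gk_zeta: "k \<ge> 1 \<Longrightarrow> gk k (zeta k t) = zeta k (- t)"
  by (simp add: gk_def zinv_zeta zeta_minus)

lemma gk_eq: "k \<ge> 1 \<Longrightarrow> z > 0 \<Longrightarrow> gk k z = zeta k (- zinv k z)"
  using gk_zeta[of k "zinv k z"] by (simp add: zeta_zinv)

lemma gk_pos: "k \<ge> 1 \<Longrightarrow> z > 0 \<Longrightarrow> gk k z > 0"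
  by (simp add: gk_eq zeta_pos)

lemma zinv_less_iff: "k \<ge> 1 \<Longrightarrow> 0 < x \<Longrightarrow> 0 < y \<Longrightarrow> zinv k x < zinv k y \<longleftrightarrow> x < y"
  by (subst zeta_less_iff[symmetric, of k]) (auto simp: zeta_zinv)

lemma gk_strict_anti: "k \<ge> 1 \<Longrightarrow> 0 < x \<Longrightarrow> x < y \<Longrightarrow> gk k y < gk k x"
  by (simp add: gk_eq zeta_less_iff zinv_less_iff)

lemma gk_anti: "k \<ge> 1 \<Longrightarrow> 0 < x \<Longrightarrow> x \<le> y \<Longrightarrow> gk k y \<le> gk k x"
  using gk_strict_anti[of k x y] by (cases "x = y") auto

text \<open>The inverse of an increasing convex function is concave, and \<open>gk k\<close> is the
  identity minus this inverse.\<close>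

lemma gk_convex: assumes "k \<ge> 1" shows "convex_on {0<..} (gk k)"
proof (intro convex_onI)
  fix t x y :: real assume t: "0 < t" "t < 1" and x: "x \<in> {0<..}" and y: "y \<in> {0<..}"
  let ?a = "zinv k x" and ?b = "zinv k y"
  let ?z = "(1 - t) * x + t * y"
  have z: "?z > 0" using t x y by (intro add_pos_pos mult_pos_pos) auto
  have "zeta k ((1 - t) * ?a + t * ?b) \<le> (1 - t) * zeta k ?a + t * zeta k ?b"
    using convex_onD[OF zeta_convex[OF assms], of t ?a ?b] t by simp
  also have "\<dots> = ?z" using x y zeta_zinv[OF assms] by simp
  also have "\<dots> = zeta k (zinv k ?z)" using zeta_zinv[OF assms z] by simp
  finally have "(1 - t) * ?a + t * ?b \<le> zinv k ?z" using zeta_le_iff[OF assms] by blast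
  thus "gk k ((1 - t) *\<^sub>R x + t *\<^sub>R y) \<le> (1 - t) * gk k x + t * gk k y"
    by (simp add: gk_def algebra_simps)
qed auto

lemma gk_cont: "k \<ge> 1 \<Longrightarrow> z > 0 \<Longrightarrow> isCont (gk k) z"
  using convex_on_continuous[OF _ gk_convex] by (auto simp: continuous_on_eq_continuous_at)

lemma zinv_cont: assumes "k \<ge> 1" "z > 0" shows "isCont (zinv k) z"
proof -
  have "isCont (\<lambda>z. z - gk k z) z" by (intro continuous_intros gk_cont assms)
  thus ?thesis by (simp add: gk_def)
qed

lemma zinv_deriv: assumes "k \<ge> 1" "z > 0"
  shows "(zinv k has_real_derivative inverse (dzeta k (zinv k z))) (at z)"
  by (rule DERIV_inverse_function[where f = "zeta k" and a = 0 and b = "z + 1"])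
     (use assms dzeta_pos[OF assms(1), of "zinv k z"] in \<open>auto simp: zeta_deriv zeta_zinv zinv_cont\<close>)

section \<open>Dilogarithms and the integral of \<open>zeta\<close>\<close>

definition dilog :: "real \<Rightarrow> real" where
  "dilog x = (\<Sum>n. 1 / (real n)\<^sup>2 * x ^ n)"

lemma summable_dilog: assumes "\<bar>x\<bar> \<le> 1" shows "summable (\<lambda>n. 1 / (real n)\<^sup>2 * x ^ n)"
proof (rule summable_comparison_test')
  show "summable (\<lambda>n. 1 / (real n)\<^sup>2)" using inverse_power_summable[of 2, where 'a = real]
    by (simp add: inverse_eq_divide)
  show "norm (1 / (real n)\<^sup>2 * x ^ n) \<le> 1 / (real n)\<^sup>2" for n
    using power_le_one[of "\<bar>x\<bar>" n] assms by (simp add: abs_mult power_abs divide_right_mono)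
qed

text \<open>Termwise differentiation lowers \<open>1/n^2\<close> to \<open>1/n\<close>, which is the
  logarithm series divided by \<open>x\<close>. The terms with \<open>n = 0\<close> vanish because
  division by zero gives zero, so both series really start at \<open>n = 1\<close>.\<close>

lemma dilog_deriv: assumes "0 < x" "x < 1" shows "(dilog has_real_derivative - ln (1 - x) / x) (at x)"
proof -
  have "(dilog has_real_derivative (\<Sum>n. diffs (\<lambda>n. 1 / (real n)\<^sup>2) n * x ^ n)) (at x)"
    unfolding dilog_def[abs_def]
    by (rule termdiffs_strong'[where K = 1]) (use summable_dilog assms in auto)
  moreover have "(\<lambda>n. diffs (\<lambda>n. 1 / (real n)\<^sup>2) n * x ^ n) sums (- ln (1 - x) / x)"
  proof -
    have "(\<lambda>n. - (x ^ n) / real n) sums ln (1 - x)" using ln_series'[of "-x"] assms by simp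
    hence "(\<lambda>n. - (x ^ Suc n) / real (Suc n)) sums ln (1 - x)"
      by (subst sums_Suc_iff) simp
    hence "(\<lambda>n. - (x ^ Suc n) / real (Suc n) * (- 1 / x)) sums (ln (1 - x) * (- 1 / x))"
      by (rule sums_mult2)
    moreover have "- (x ^ Suc n) / real (Suc n) * (- 1 / x) = diffs (\<lambda>n. 1 / (real n)\<^sup>2) n * x ^ n" for n
      using assms by (simp add: diffs_def power2_eq_square)
    ultimately show ?thesis by simp
  qed
  ultimately show ?thesis by (simp add: sums_iff)
qed

lemma dilog_cont0: "isCont dilog 0"
proof -
  have "(dilog has_real_derivative (\<Sum>n. diffs (\<lambda>n. 1 / (real n)\<^sup>2) n * 0 ^ n)) (at 0)"
    unfolding dilog_def[abs_def]
    by (rule termdiffs_strong'[where K = 1]) (use summable_dilog in auto)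
  thus ?thesis by (rule DERIV_isCont)
qed

lemma dilog_0: "dilog 0 = 0"
proof -
  have "(\<lambda>n. 1 / (real n)\<^sup>2 * 0 ^ n) = (\<lambda>n. 0 :: real)" by (auto simp: fun_eq_iff power_0_left)
  thus ?thesis unfolding dilog_def by (simp only: suminf_zero)
qed

lemma dilog_1: "dilog 1 = pi\<^sup>2 / 6"
proof -
  have "(\<lambda>n. 1 / (real (Suc n))\<^sup>2 * 1 ^ Suc n) sums (pi\<^sup>2 / 6)"
    using inverse_squares_sums by (simp add: add.commute)
  hence "(\<lambda>n. 1 / (real n)\<^sup>2 * 1 ^ n) sums (pi\<^sup>2 / 6)"
    by (subst (asm) sums_Suc_iff) simp
  thus ?thesis by (simp add: dilog_def sums_iff)
qed

text \<open>The derivative covers only the open interval. The end point \<open>1\<close>, where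
  \<open>pi^2 / 6\<close> enters, is reached by uniform convergence.\<close>

lemma dilog_cont: "continuous_on {0..1} dilog"
proof -
  have s: "summable (\<lambda>n. 1 / (real n)\<^sup>2)" using inverse_power_summable[of 2, where 'a = real]
    by (simp add: inverse_eq_divide)
  have "uniform_limit {0..1} (\<lambda>n x. \<Sum>i<n. 1 / (real i)\<^sup>2 * x ^ i) (\<lambda>x. \<Sum>i. 1 / (real i)\<^sup>2 * x ^ i) sequentially"
  proof (rule Weierstrass_m_test[where M = "\<lambda>n. 1 / (real n)\<^sup>2"])
    fix n :: nat and x :: real assume "x \<in> {0..1}"
    thus "norm (1 / (real n)\<^sup>2 * x ^ n) \<le> 1 / (real n)\<^sup>2"
      using power_le_one[of x n] by (simp add: abs_mult power_abs divide_right_mono)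
  qed (rule s)
  thus ?thesis unfolding dilog_def[abs_def]
    by (rule uniform_limit_theorem[rotated]) (auto simp: divide_inverse intro!: continuous_intros always_eventually)
qed

definition zeta_int_formula :: "nat \<Rightarrow> real \<Rightarrow> real" where
  "zeta_int_formula k t = dilog (exp (real k * t)) / real k - dilog (exp (real (k+1) * t)) / real (k+1)"

text \<open>An antiderivative on the whole line is wanted, while the dilogarithms make sense only
  for \<open>t <= 0\<close>; so existence comes from continuity and the constant is fixed at
  \<open>0\<close>. By \<open>zeta_int_at_bot\<close> this choice is the integral of
  \<open>zeta k\<close> from minus infinity.\<close>

definition zeta_int :: "nat \<Rightarrow> real \<Rightarrow> real" where
  "zeta_int k = (SOME F. F 0 = lambda_k k / 2 \<and> (\<forall>t. (F has_real_derivative zeta k t) (at t)))"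

lemma zeta_int: assumes "k \<ge> 1"
  shows "zeta_int k 0 = lambda_k k / 2" "(zeta_int k has_real_derivative zeta k t) (at t)"
proof -
  have "\<exists>F. \<forall>x::real. (-\<infinity>) < ereal x \<longrightarrow> ereal x < \<infinity> \<longrightarrow> (F has_vector_derivative zeta k x) (at x)"
    by (rule einterval_antiderivative) (use zeta_deriv[OF assms] DERIV_isCont in auto)
  then obtain F where F: "\<And>t. (F has_real_derivative zeta k t) (at t)"
    by (auto simp: has_real_derivative_iff_has_vector_derivative)
  have "\<exists>F. F 0 = lambda_k k / 2 \<and> (\<forall>t. (F has_real_derivative zeta k t) (at t))"
    by (rule exI[of _ "\<lambda>t. F t - F 0 + lambda_k k / 2"]) (auto intro!: derivative_eq_intros F)
  from someI_ex[OF this]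
  show "zeta_int k 0 = lambda_k k / 2" "(zeta_int k has_real_derivative zeta k t) (at t)"
    unfolding zeta_int_def by auto
qed

lemma zeta_neg: assumes "t < 0" "k \<ge> 1"
  shows "zeta k t = ln (1 - exp (real (k+1) * t)) - ln (1 - exp (real k * t))"
  using zeta_minus[OF assms(2), of "-t"] zeta_closed[of "-t" k] assms by simp

text \<open>Both sides have the same derivative for \<open>t < 0\<close>, and they agree at
  \<open>0\<close> because \<open>pi^2 / 6 * (1/k - 1/(k+1))\<close> is half of
  \<open>lambda_k k\<close>. This is where the constant of the theorem arises.\<close>

lemma zeta_int_eq: assumes "k \<ge> 1" "t \<le> 0" shows "zeta_int k t = zeta_int_formula k t"
proof (cases "t = 0")
  case True
  thus ?thesis using assms by (simp add: zeta_int zeta_int_formula_def dilog_1 lambda_k_def field_simps)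
next
  case False
  let ?f = "\<lambda>t. zeta_int k t - zeta_int_formula k t"
  have "?f 0 = ?f t"
  proof (rule DERIV_isconst_end[where f = ?f and a = t and b = 0])
    show "t < 0" using False assms by simp
    have "continuous_on {t..0} (zeta_int k)"
      using zeta_int(2)[OF assms(1)] DERIV_continuous_on has_field_derivative_at_within by blast
    moreover have "continuous_on {t..0} (zeta_int_formula k)"
      unfolding zeta_int_formula_def[abs_def] using assms
      by (intro continuous_intros continuous_on_compose2[OF dilog_cont]) (auto simp: mult_nonneg_nonpos)
    ultimately show "continuous_on {t..0} ?f" by (intro continuous_intros)
    fix x assume x: "t < x" "x < 0"
    have d: "((\<lambda>t. dilog (exp (c * t)) / c) has_real_derivative - ln (1 - exp (c * x))) (at x)" if "c > 0" for c
    proof -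
      have e: "0 < exp (c * x)" "exp (c * x) < 1" using that x by (auto simp: mult_pos_neg)
      have i: "((\<lambda>t. exp (c * t)) has_real_derivative exp (c * x) * c) (at x)"
        by (auto intro!: derivative_eq_intros)
      have "((\<lambda>t. dilog (exp (c * t))) has_real_derivative - ln (1 - exp (c * x)) / exp (c * x) * (exp (c * x) * c)) (at x)"
        by (rule DERIV_chain2[OF dilog_deriv[OF e] i])
      from DERIV_cdivide[OF this, of c] show ?thesis using that by simp
    qed
    have "real k > 0" "real (k + 1) > 0" using assms by auto
    hence "(zeta_int_formula k has_real_derivative - ln (1 - exp (real k * x)) - - ln (1 - exp (real (k+1) * x))) (at x)"
      unfolding zeta_int_formula_def[abs_def] by (intro DERIV_diff d)
    hence "(zeta_int_formula k has_real_derivative zeta k x) (at x)"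
      by (simp add: zeta_neg[OF x(2) assms(1)])
    from DERIV_diff[OF zeta_int(2)[OF assms(1)] this]
    show "(?f has_real_derivative 0) (at x)" by simp
  qed
  moreover have "?f 0 = 0" using assms by (simp add: zeta_int zeta_int_formula_def dilog_1 lambda_k_def field_simps)
  ultimately show ?thesis by simp
qed

lemma zeta_int_at_bot: assumes "k \<ge> 1" shows "(zeta_int k \<longlongrightarrow> 0) at_bot"
proof -
  have l: "((\<lambda>t. dilog (exp (c * t))) \<longlongrightarrow> 0) at_bot" if "c > 0" for c
  proof -
    have "((\<lambda>t. exp (c * t)) \<longlongrightarrow> 0) at_bot"
      by (rule filterlim_compose[OF exp_at_bot])
         (use that in \<open>auto intro!: filterlim_tendsto_pos_mult_at_bot[OF tendsto_const] filterlim_ident\<close>)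
    from isCont_tendsto_compose[OF dilog_cont0 this] show ?thesis by (simp add: dilog_0)
  qed
  have "real k > 0" "real (k + 1) > 0" using assms by auto
  from tendsto_diff[OF tendsto_divide[OF l[OF this(1)] tendsto_const] tendsto_divide[OF l[OF this(2)] tendsto_const]]
  have "(zeta_int_formula k \<longlongrightarrow> 0) at_bot"
    using assms unfolding zeta_int_formula_def[abs_def] by simp
  moreover have "eventually (\<lambda>t. zeta_int_formula k t = zeta_int k t) at_bot"
    using eventually_le_at_bot[of 0] by eventually_elim (use zeta_int_eq[OF assms] in simp)
  ultimately show ?thesis using tendsto_cong by blast
qed

lemma zeta_int_nonneg: assumes "k \<ge> 1" shows "zeta_int k t \<ge> 0"
proof (rule tendsto_upperbound[OF zeta_int_at_bot[OF assms]])
  have "zeta_int k x \<le> zeta_int k t" if "x \<le> t" for x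
    by (rule DERIV_nonneg_imp_nondecreasing[OF that])
       (use zeta_int(2)[OF assms] zeta_pos[OF assms] less_imp_le in blast)
  thus "eventually (\<lambda>x. zeta_int k x \<le> zeta_int k t) at_bot"
    by (rule eventually_mono[OF eventually_le_at_bot[of t]])
qed auto

lemma zeta_int_reflect: assumes "k \<ge> 1" shows "zeta_int k t + zeta_int k (- t) = lambda_k k + t\<^sup>2 / 2"
proof -
  let ?f = "\<lambda>t. zeta_int k t + zeta_int k (- t) - t\<^sup>2 / 2"
  have "(?f has_real_derivative 0) (at x)" for x
  proof -
    have "((\<lambda>t. zeta_int k (- t)) has_real_derivative zeta k (- x) * (-1)) (at x)"
      by (rule DERIV_chain2[where f = "zeta_int k" and g = "\<lambda>t. - t"]) (use zeta_int(2)[OF assms] in \<open>auto intro!: derivative_eq_intros\<close>)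
    moreover have "((\<lambda>t. t\<^sup>2 / 2) has_real_derivative x) (at x)" by (auto intro!: derivative_eq_intros)
    ultimately have "(?f has_real_derivative zeta k x + zeta k (- x) * (-1) - x) (at x)"
      by (intro DERIV_diff DERIV_add zeta_int assms)
    thus ?thesis using zeta_minus[OF assms, of x] by simp
  qed
  hence "?f t = ?f 0" by (intro DERIV_isconst_all) auto
  thus ?thesis using assms by (simp add: zeta_int)
qed

section \<open>The tail integral of \<open>g\<close>\<close>

definition Gam :: "nat \<Rightarrow> real \<Rightarrow> real" where
  "Gam k z = lambda_k k - z\<^sup>2 / 2 + z * zinv k z - zeta_int k (zinv k z)"

text \<open>\<open>Gam\<close> is the formula for integrating an inverse function, applied to
  \<open>zinv\<close>; therefore the terms containing the derivative of \<open>zinv\<close> cancel.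
  Together with \<open>Gam_lim\<close> it identifies \<open>Gam k z\<close> as the integral of
  \<open>g\<close> over all arguments beyond \<open>z\<close>.\<close>

lemma Gam_deriv: assumes "k \<ge> 1" "z > 0" shows "(Gam k has_real_derivative - gk k z) (at z)"
proof -
  let ?D = "inverse (dzeta k (zinv k z))"
  have "((\<lambda>z. zeta_int k (zinv k z)) has_real_derivative zeta k (zinv k z) * ?D) (at z)"
    by (rule DERIV_chain2[OF zeta_int(2)[OF assms(1)] zinv_deriv[OF assms]])
  hence 1: "((\<lambda>z. zeta_int k (zinv k z)) has_real_derivative z * ?D) (at z)"
    using zeta_zinv[OF assms] by simp
  have 2: "((\<lambda>z. z * zinv k z) has_real_derivative 1 * zinv k z + ?D * z) (at z)"
    by (rule DERIV_mult[OF DERIV_ident zinv_deriv[OF assms]])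
  have 3: "((\<lambda>z. lambda_k k - z\<^sup>2 / 2) has_real_derivative - z) (at z)"
    by (auto intro!: derivative_eq_intros)
  from DERIV_diff[OF DERIV_add[OF 3 2] 1] show ?thesis
    unfolding Gam_def[abs_def] gk_def by (simp add: algebra_simps)
qed

text \<open>The reflection formula removes the divergent \<open>t^2 / 2\<close>, so the limit of
  \<open>Gam\<close> at infinity can be read off from \<open>zeta_int\<close> at minus
  infinity.\<close>

lemma Gam_zeta: assumes "k \<ge> 1" shows "Gam k (zeta k t) = zeta_int k (- t) - (zeta k (- t))\<^sup>2 / 2"
  using zeta_int_reflect[OF assms, of t]
  unfolding Gam_def zinv_zeta[OF assms] zeta_minus[OF assms] by (simp add: power2_eq_square field_simps)

lemma Gam_anti: assumes "k \<ge> 1" "0 < x" "x \<le> y" shows "Gam k y \<le> Gam k x"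
  by (rule DERIV_nonpos_imp_nonincreasing[OF assms(3)])
     (use Gam_deriv[OF assms(1)] gk_pos[OF assms(1)] assms less_imp_le in \<open>metis neg_le_0_iff_le order_less_le_trans\<close>)

lemma zeta_at_bot: assumes "k \<ge> 1" shows "(zeta k \<longlongrightarrow> 0) at_bot"
  by (rule tendsto_sandwich[OF _ _ tendsto_const exp_at_bot])
     (use zeta_pos[OF assms] zeta_le_exp[OF assms] less_imp_le in \<open>auto intro!: always_eventually\<close>)

lemma Gam_lim: assumes "k \<ge> 1" shows "((\<lambda>t. Gam k (zeta k t)) \<longlongrightarrow> 0) at_top"
proof -
  have "((\<lambda>t. zeta_int k t - (zeta k t)\<^sup>2 / 2) \<longlongrightarrow> 0 - 0\<^sup>2 / 2) at_bot"
    by (intro tendsto_intros zeta_int_at_bot zeta_at_bot assms) auto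
  from filterlim_compose[OF this filterlim_uminus_at_bot_at_top]
  show ?thesis using Gam_zeta[OF assms] by simp
qed

lemma Gam_nonneg: assumes "k \<ge> 1" "z > 0" shows "Gam k z \<ge> 0"
proof (rule tendsto_upperbound[OF Gam_lim[OF assms(1)]])
  show "eventually (\<lambda>t. Gam k (zeta k t) \<le> Gam k z) at_top"
    using eventually_ge_at_top[of "z"]
  proof eventually_elim
    case (elim t) thus ?case using zeta_ge[OF assms(1), of t] by (intro Gam_anti assms) linarith
  qed
qed auto

lemma Gam_le_lambda: assumes "k \<ge> 1" "z > 0" shows "Gam k z \<le> lambda_k k"
proof -
  have neg: "Gam k z \<le> lambda_k k" if "z > 0" "zinv k z \<le> 0" for z
    using zeta_int_nonneg[OF assms(1), of "zinv k z"] mult_nonneg_nonpos[of z "zinv k z"] that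
    zero_le_power2[of z] unfolding Gam_def by linarith
  show ?thesis
  proof (cases "zinv k z \<le> 0")
    case True thus ?thesis using neg assms by blast
  next
    case False
    have "zeta k 0 < zeta k (zinv k z)" using False assms by (simp add: zeta_less_iff)
    hence "Gam k z \<le> Gam k (zeta k 0)" using assms zeta_pos[of k 0] by (intro Gam_anti) (auto simp: zeta_zinv)
    also have "\<dots> \<le> lambda_k k" by (rule neg) (use assms zinv_zeta[OF assms(1)] zeta_pos[OF assms(1)] in auto)
    finally show ?thesis .
  qed
qed

text \<open>The geometric sum is \<open>geo k t\<close> divided by \<open>exp (- t)\<close> with
  \<open>t = zinv k z\<close>, so both relations restate \<open>zeta k t = z\<close>.\<close>

lemma gk_eigen:
  assumes "k \<ge> 1" "z > 0"
  shows "exp (- gk k z) * exp (- zinv k z) = exp (- z)"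
    and "1 - exp (- z) = exp (- gk k z) / (\<Sum>i<k. exp (- zinv k z) ^ i)"
proof -
  show "exp (- gk k z) * exp (- zinv k z) = exp (- z)" by (simp add: gk_def exp_add[symmetric])
  let ?t = "zinv k z"
  have p: "geo k ?t > 0" using geo_pos assms by blast
  have e: "exp (- z) = geo k ?t / (1 + geo k ?t)"
    using exp_zeta[OF assms(1), of ?t] p zeta_zinv[OF assms] by (simp add: exp_minus field_simps)
  have q: "geo k ?t = exp (- ?t) * (\<Sum>i<k. exp (- ?t) ^ i)"
    unfolding geo_def sum_distrib_left
    by (rule sum.reindex_bij_witness[of _ "\<lambda>i. i + 1" "\<lambda>i. i - 1"])
       (auto simp: exp_of_nat_mult[symmetric] exp_add[symmetric] algebra_simps of_nat_diff)
  have s: "(\<Sum>i<k. exp (- ?t) ^ i) > 0" using assms by (intro sum_pos) (auto simp: lessThan_empty_iff)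
  have "exp (- gk k z) = exp (- z) / exp (- ?t)" by (simp add: gk_def exp_diff[symmetric])
  also have "\<dots> = (\<Sum>i<k. exp (- ?t) ^ i) / (1 + geo k ?t)" unfolding e using q by simp
  finally have f: "exp (- gk k z) = (\<Sum>i<k. exp (- ?t) ^ i) / (1 + geo k ?t)" .
  show "1 - exp (- z) = exp (- gk k z) / (\<Sum>i<k. exp (- zinv k z) ^ i)"
  proof -
    have "1 - G / (1 + G) = S / (1 + G) / S" if "S > 0" "G > 0" for S G :: real
      using that by (simp add: divide_simps)
    from this[OF s p] show ?thesis
      unfolding f by (simp only: e)
  qed
qed

text \<open>One term of the geometric sum is at least one. In terms of cells: marking every cell is
  one way to avoid gaps, so \<open>g\<close> is at most its value for \<open>k = 1\<close>.\<close>

lemma gk_ge_u: assumes "k \<ge> 1" "z > 0" shows "1 - exp (- z) \<le> exp (- gk k z)"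
proof -
  have "(\<Sum>i\<in>{0}. exp (- zinv k z) ^ i) \<le> (\<Sum>i<k. exp (- zinv k z) ^ i)"
    using assms by (intro sum_mono2) auto
  hence "exp (- gk k z) / (\<Sum>i<k. exp (- zinv k z) ^ i) \<le> exp (- gk k z) / 1"
    by (intro divide_left_mono) auto
  thus ?thesis using gk_eigen(2)[OF assms] by simp
qed

lemma gk_le_log: assumes "k \<ge> 1" "z > 0" shows "gk k z \<le> - ln (1 - exp (- z))"
proof -
  have "ln (1 - exp (- z)) \<le> ln (exp (- gk k z))" using gk_ge_u[OF assms] assms by (subst ln_le_cancel_iff) auto
  thus ?thesis by simp
qed

lemma one_minus_exp_ge: assumes "0 \<le> z" "z \<le> (1::real)" shows "z / 2 \<le> 1 - exp (- z)"
proof -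
  have "exp (- z) \<le> 1 / (1 + z)" using exp_ge_add_one_self[of z] assms by (simp add: exp_minus field_simps)
  moreover have "z / 2 \<le> 1 - 1 / (1 + z)" using assms by (simp add: field_simps) (simp add: mult_left_le)
  ultimately show ?thesis by linarith
qed

lemma gk_le_small: assumes "k \<ge> 1" "0 < z" "z \<le> 1" shows "gk k z \<le> 1 - ln z"
proof -
  have "ln (z / 2) \<le> ln (1 - exp (- z))" using one_minus_exp_ge[of z] assms by (subst ln_le_cancel_iff) auto
  moreover have "ln (z / 2) = ln z - ln 2" using assms by (simp add: ln_div)
  moreover have "ln (2::real) \<le> 1" using ln_le_minus_one[of "2::real"] by simp
  ultimately show ?thesis using gk_le_log[OF assms(1,2)] by linarith
qed

lemma gk_le_large: assumes "k \<ge> 1" "1 \<le> z" shows "gk k z \<le> 2 * exp (- z)"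
proof -
  let ?x = "exp (- z)"
  have "exp (1::real) \<ge> 2" using exp_ge_add_one_self[of "1::real"] by simp
  moreover have "exp 1 \<le> exp z" using assms by simp
  ultimately have "exp z \<ge> 2" by linarith
  hence "?x \<le> 1 / 2" by (simp add: exp_minus field_simps)
  moreover have "- ln (1 - ?x) = ln (1 / (1 - ?x))" using assms by (simp add: ln_div)
  moreover have "ln (1 / (1 - ?x)) \<le> 1 / (1 - ?x) - 1" using assms by (intro ln_le_minus_one) auto
  moreover have "1 / (1 - ?x) - 1 \<le> 2 * ?x"
  proof -
    have "0 \<le> ?x * (1 - 2 * ?x)" using \<open>?x \<le> 1 / 2\<close> by simp
    hence "1 \<le> (1 + 2 * ?x) * (1 - ?x)" by (simp add: algebra_simps)
    thus ?thesis using \<open>?x \<le> 1 / 2\<close> assms by (simp add: divide_simps)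
  qed
  ultimately show ?thesis using gk_le_log[OF assms(1), of z] assms by linarith
qed

text \<open>\<open>z * (2 - ln z)\<close> is the antiderivative, vanishing at \<open>0\<close>, of
  the bound \<open>1 - ln z\<close> for \<open>g\<close>. Hence its sum with \<open>Gam\<close>
  increases, and the limit at \<open>0\<close> is \<open>lambda_k k\<close>; the limit is taken
  along \<open>z = zeta k t\<close> with \<open>t\<close> going to minus infinity.\<close>

lemma Gam_ge: assumes "k \<ge> 1" "0 < z" "z \<le> 1" shows "Gam k z \<ge> lambda_k k - z * (2 - ln z)"
proof -
  let ?P = "\<lambda>z. Gam k z + z * (2 - ln z)"
  have mono: "?P x \<le> ?P z" if "0 < x" "x \<le> z" for x
  proof (rule DERIV_nonneg_imp_nondecreasing[OF that(2)])
    fix y assume y: "x \<le> y" "y \<le> z"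
    have "((\<lambda>z. z * (2 - ln z)) has_real_derivative 1 - ln y) (at y)"
      using y that by (auto intro!: derivative_eq_intros)
    from DERIV_add[OF Gam_deriv[OF assms(1)] this] have "(?P has_real_derivative - gk k y + (1 - ln y)) (at y)"
      using y that by simp
    moreover have "- gk k y + (1 - ln y) \<ge> 0" using gk_le_small[OF assms(1), of y] y that assms by simp
    ultimately show "\<exists>d. (?P has_real_derivative d) (at y) \<and> 0 \<le> d" by blast
  qed
  have "((\<lambda>t::real. t * exp t) \<longlongrightarrow> 0) at_bot" by real_asymp
  hence a: "((\<lambda>t. zeta k t * t) \<longlongrightarrow> 0) at_bot"
  proof (rule tendsto_sandwich[rotated 2])
    show "eventually (\<lambda>t. t * exp t \<le> zeta k t * t) at_bot"
      using eventually_le_at_bot[of 0]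
    proof eventually_elim
      case (elim t) thus ?case using mult_right_mono_neg[OF zeta_le_exp[OF assms(1), of t], of t] by (simp add: mult.commute)
    qed
    show "eventually (\<lambda>t. zeta k t * t \<le> 0) at_bot"
      using eventually_le_at_bot[of 0]
    proof eventually_elim
      case (elim t) thus ?case using zeta_pos[OF assms(1), of t] by (simp add: mult_nonneg_nonpos)
    qed
  qed auto
  have "((\<lambda>t. lambda_k k - (zeta k t)\<^sup>2 / 2 + zeta k t * t - zeta_int k t) \<longlongrightarrow> lambda_k k - 0\<^sup>2 / 2 + 0 - 0) at_bot"
    by (intro tendsto_intros a zeta_at_bot zeta_int_at_bot assms) auto
  hence 1: "((\<lambda>t. Gam k (zeta k t)) \<longlongrightarrow> lambda_k k) at_bot"
    using zinv_zeta[OF assms(1)] by (simp add: Gam_def)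
  have "((\<lambda>x::real. x * (2 - ln x)) \<longlongrightarrow> 0) (at_right 0)" by real_asymp
  moreover have "filterlim (zeta k) (at_right 0) at_bot"
    using zeta_at_bot[OF assms(1)] zeta_pos[OF assms(1)]
    by (auto simp: filterlim_at intro!: always_eventually less_imp_neq[symmetric])
  ultimately have 2: "((\<lambda>t. zeta k t * (2 - ln (zeta k t))) \<longlongrightarrow> 0) at_bot"
    by (rule filterlim_compose)
  have "?P z \<ge> lambda_k k + 0"
  proof (rule tendsto_upperbound[OF tendsto_add[OF 1 2]])
    show "eventually (\<lambda>t. ?P (zeta k t) \<le> ?P z) at_bot"
      using eventually_le_at_bot[of "zinv k z"]
    proof eventually_elim
      case (elim t)
      hence "zeta k t \<le> z" using zeta_le_iff[OF assms(1), of t "zinv k z"] zeta_zinv assms by simp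
      thus ?case using mono zeta_pos assms by blast
    qed
  qed auto
  thus ?thesis by simp
qed

lemma Gam_le_large: assumes "k \<ge> 1" "1 \<le> z" shows "Gam k z \<le> 2 * exp (- z)"
proof -
  let ?P = "\<lambda>z. Gam k z - 2 * exp (- z)"
  have mono: "?P z \<le> ?P x" if "z \<le> x" for x
  proof (rule DERIV_nonneg_imp_nondecreasing[OF that])
    fix y assume y: "z \<le> y" "y \<le> x"
    have "((\<lambda>z. 2 * exp (- z)) has_real_derivative - 2 * exp (- y)) (at y)"
      by (auto intro!: derivative_eq_intros)
    from DERIV_diff[OF Gam_deriv[OF assms(1)] this] have "(?P has_real_derivative - gk k y - (- 2 * exp (- y))) (at y)"
      using y assms by simp
    moreover have "- gk k y - (- 2 * exp (- y)) \<ge> 0" using gk_le_large[OF assms(1), of y] y assms by simp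
    ultimately show "\<exists>d. (?P has_real_derivative d) (at y) \<and> 0 \<le> d" by blast
  qed
  have "?P z \<le> 0"
  proof (rule tendsto_lowerbound[OF Gam_lim[OF assms(1)]])
    show "eventually (\<lambda>t. ?P z \<le> Gam k (zeta k t)) at_top"
      using eventually_ge_at_top[of z]
    proof eventually_elim
      case (elim t)
      hence "?P z \<le> ?P (zeta k t)" using zeta_ge[OF assms(1), of t] by (intro mono) linarith
      thus ?case using exp_gt_zero[of "- zeta k t"] by linarith
    qed
  qed auto
  thus ?thesis by simp
qed

section \<open>Independence and gap-free sequences\<close>

definition gsum :: "nat \<Rightarrow> real \<Rightarrow> real" where "gsum n y = (\<Sum>i<n. y ^ i)"

lemma gsum_Suc: "gsum (Suc n) y = 1 + y * gsum n y"
  unfolding gsum_def by (subst sum.lessThan_Suc_shift) (simp add: sum_distrib_left)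

lemma gsum_ge_1: "y \<ge> 0 \<Longrightarrow> n \<ge> 1 \<Longrightarrow> gsum n y \<ge> 1"
  by (cases n) (simp_all add: gsum_Suc, simp add: gsum_def sum_nonneg)

lemma gsum_nonneg: "y \<ge> 0 \<Longrightarrow> gsum n y \<ge> 0"
  by (auto simp: gsum_def intro!: sum_nonneg)

text \<open>After cross-multiplication the common part cancels and monomials are compared one by
  one, using \<open>j < a <= i\<close>. The lemma allows the eigenvector to change when cell sizes
  grow along a sequence.\<close>

lemma gsum_ratio_anti:
  assumes "0 \<le> y" "y \<le> y'" "a \<le> b" "b \<ge> 1"
  shows "gsum a y' / gsum b y' \<le> gsum a y / gsum b y"
proof -
  have split: "gsum b t = gsum a t + (\<Sum>i=a..<b. t ^ i)" for t
    unfolding gsum_def lessThan_atLeast0 using assms by (simp add: sum.atLeastLessThan_concat)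
  have "gsum a y' * (\<Sum>i=a..<b. y ^ i) \<le> gsum a y * (\<Sum>i=a..<b. y' ^ i)"
    unfolding gsum_def sum_product
  proof (intro sum_mono)
    fix j i assume "j \<in> {..<a}" "i \<in> {a..<b}"
    hence i: "i = j + (i - j)" by auto
    have "y ^ (i - j) \<le> y' ^ (i - j)" using assms by (intro power_mono)
    hence "(y' ^ j * y ^ j) * y ^ (i - j) \<le> (y' ^ j * y ^ j) * y' ^ (i - j)"
      using assms by (intro mult_left_mono) auto
    moreover have "y' ^ j * y ^ i = (y' ^ j * y ^ j) * y ^ (i - j)"
      by (subst i) (simp only: power_add mult_ac)
    moreover have "y ^ j * y' ^ i = (y' ^ j * y ^ j) * y' ^ (i - j)"
      by (subst i) (simp only: power_add mult_ac)
    ultimately show "y' ^ j * y ^ i \<le> y ^ j * y' ^ i" by (simp only:)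
  qed
  hence "gsum a y' * gsum b y \<le> gsum a y * gsum b y'"
    unfolding split by (simp add: algebra_simps)
  moreover have "gsum b y \<ge> 1" "gsum b y' \<ge> 1" using assms by (auto intro!: gsum_ge_1)
  ultimately show ?thesis by (simp add: field_simps)
qed

section \<open>Events determined by a set of sites\<close>

definition cevents :: "config set set" where
  "cevents = sets (\<Pi>\<^sub>M x\<in>(UNIV :: site set). count_space (UNIV :: bool set))"

lemma sets_config: "sets (config_measure s) = cevents"
  unfolding config_measure_def cevents_def by (rule sets_PiM_cong) auto

lemma space_config: "space (config_measure s) = UNIV"
  by (simp add: config_measure_def space_PiM PiE_UNIV_domain)

lemma prob_space_config: "prob_space (config_measure s)"
  unfolding config_measure_def by (intro prob_space_PiM measure_pmf.prob_space_axioms)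

text \<open>Measurability and dependence on \<open>K\<close> are bundled, so that one set of closure
  rules supplies both whenever \<open>Pr_indep\<close> is applied.\<close>

definition dep :: "site set \<Rightarrow> config set \<Rightarrow> bool" where
  "dep K E \<longleftrightarrow> E \<in> cevents \<and> (\<forall>\<omega> \<omega>'. (\<forall>x\<in>K. \<omega> x = \<omega>' x) \<longrightarrow> (\<omega> \<in> E \<longleftrightarrow> \<omega>' \<in> E))"

lemma sigma_algebra_events: "sigma_algebra UNIV cevents"
  using sets.sigma_algebra_axioms[of "config_measure 1"] by (simp add: space_config sets_config)

interpretation ev: sigma_algebra UNIV cevents by (rule sigma_algebra_events)

lemma dep_events: "dep K E \<Longrightarrow> E \<in> cevents" by (simp add: dep_def)

lemma depI: "E \<in> cevents \<Longrightarrow> (\<And>\<omega> \<omega>'. (\<And>x. x \<in> K \<Longrightarrow> \<omega> x = \<omega>' x) \<Longrightarrow> \<omega> \<in> E \<Longrightarrow> \<omega>' \<in> E) \<Longrightarrow> dep K E"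
  unfolding dep_def by (metis (no_types, lifting))

lemma dep_cong: "dep K E \<Longrightarrow> (\<And>x. x \<in> K \<Longrightarrow> \<omega> x = \<omega>' x) \<Longrightarrow> \<omega> \<in> E \<Longrightarrow> \<omega>' \<in> E"
  unfolding dep_def by (metis (no_types, lifting))

lemma dep_Int: assumes "dep K E" "dep K F" shows "dep K (E \<inter> F)"
proof (rule depI)
  show "E \<inter> F \<in> cevents" using assms dep_events by (intro ev.Int) auto
  fix \<omega> \<omega>' :: config assume "\<And>x. x \<in> K \<Longrightarrow> \<omega> x = \<omega>' x" "\<omega> \<in> E \<inter> F"
  thus "\<omega>' \<in> E \<inter> F" using dep_cong[OF assms(1), of \<omega> \<omega>'] dep_cong[OF assms(2), of \<omega> \<omega>'] by simp
qed

lemma dep_Compl: assumes "dep K E" shows "dep K (- E)"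
proof (rule depI)
  show "- E \<in> cevents" using ev.compl_sets[OF dep_events[OF assms]] by (simp add: Compl_eq_Diff_UNIV)
  fix \<omega> \<omega>' :: config assume "\<And>x. x \<in> K \<Longrightarrow> \<omega> x = \<omega>' x" "\<omega> \<in> - E"
  thus "\<omega>' \<in> - E" using dep_cong[OF assms, of \<omega>' \<omega>] by auto
qed

lemma dep_Un: assumes "dep K E" "dep K F" shows "dep K (E \<union> F)"
  using dep_Compl[OF dep_Int[OF dep_Compl[OF assms(1)] dep_Compl[OF assms(2)]]] by (simp add: Compl_Int)

lemma dep_mono: "dep K E \<Longrightarrow> K \<subseteq> K' \<Longrightarrow> dep K' E"
  by (rule depI) (use dep_events dep_cong in blast)+

lemma dep_UNIV [simp]: "dep K UNIV" and dep_empty [simp]: "dep K {}"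
  using ev.top ev.empty_sets by (auto simp: dep_def)

lemma dep_INT: assumes "countable I" "\<And>i. i \<in> I \<Longrightarrow> dep K (E i)" shows "dep K (\<Inter>i\<in>I. E i)"
proof (rule depI)
  show "(\<Inter>i\<in>I. E i) \<in> cevents" using assms dep_events by (intro ev.countable_INT'') auto
  fix \<omega> \<omega>' :: config assume "\<And>x. x \<in> K \<Longrightarrow> \<omega> x = \<omega>' x" "\<omega> \<in> (\<Inter>i\<in>I. E i)"
  thus "\<omega>' \<in> (\<Inter>i\<in>I. E i)" using dep_cong[OF assms(2), of _ \<omega> \<omega>'] by blast
qed

lemma dep_UN: assumes "countable I" "\<And>i. i \<in> I \<Longrightarrow> dep K (E i)" shows "dep K (\<Union>i\<in>I. E i)"
proof -
  have "dep K (- (\<Inter>i\<in>I. - E i))" by (intro dep_Compl dep_INT assms)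
  thus ?thesis by simp
qed

lemma dep_site: "dep {x} {\<omega>. \<omega> x}"
proof -
  have "(\<lambda>\<omega>::config. \<omega> x) -` {True} \<inter> space (\<Pi>\<^sub>M x\<in>(UNIV :: site set). count_space (UNIV :: bool set)) \<in> cevents"
    unfolding cevents_def by (intro measurable_sets[where A = "count_space UNIV"] measurable_component_singleton) auto
  moreover have "(\<lambda>\<omega>::config. \<omega> x) -` {True} = {\<omega>. \<omega> x}" by auto
  ultimately show ?thesis by (simp add: dep_def space_PiM PiE_UNIV_domain)
qed

definition all_occ :: "site set \<Rightarrow> config set" where "all_occ A = {\<omega>. \<forall>x\<in>A. \<omega> x}"
definition all_empty :: "site set \<Rightarrow> config set" where "all_empty A = {\<omega>. \<forall>x\<in>A. \<not> \<omega> x}"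

lemma dep_all_occ: "dep A (all_occ A)"
proof -
  have "all_occ A = (\<Inter>x\<in>A. {\<omega>. \<omega> x})" by (auto simp: all_occ_def)
  also have "dep A \<dots>" by (intro dep_INT countableI_type) (auto intro: dep_mono[OF dep_site])
  finally show ?thesis .
qed

lemma dep_all_empty: "dep A (all_empty A)"
proof -
  have "all_empty A = (\<Inter>x\<in>A. - {\<omega>. \<omega> x})" by (auto simp: all_empty_def)
  also have "dep A \<dots>" by (intro dep_INT countableI_type dep_Compl) (auto intro: dep_mono[OF dep_site])
  finally show ?thesis .
qed

lemma indep_coordinates:
  "prob_space.indep_vars (config_measure s) (\<lambda>_. measure_pmf (bernoulli_pmf (1 - exp (- s)))) (\<lambda>x \<omega>. \<omega> x) UNIV"
proof -
  interpret prob_space "config_measure s" by (rule prob_space_config)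
  let ?B = "\<lambda>_::site. measure_pmf (bernoulli_pmf (1 - exp (- s)))"
  have "distr (config_measure s) (\<Pi>\<^sub>M i\<in>UNIV. ?B i) (\<lambda>x. \<lambda>i\<in>UNIV. x i) = (\<Pi>\<^sub>M i\<in>UNIV. distr (config_measure s) (?B i) (\<lambda>\<omega>. \<omega> i))"
  proof -
    have "distr (config_measure s) (?B i) (\<lambda>\<omega>. \<omega> i) = ?B i" for i
      unfolding config_measure_def by (rule distr_PiM_component) (auto intro: measure_pmf.prob_space_axioms)
    moreover have "distr (config_measure s) (\<Pi>\<^sub>M i\<in>UNIV. ?B i) (\<lambda>x. \<lambda>i\<in>UNIV. x i) = config_measure s"
      unfolding config_measure_def restrict_UNIV by (rule distr_id)
    ultimately show ?thesis by (simp add: config_measure_def)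
  qed
  thus ?thesis
    by (subst indep_vars_iff_distr_eq_PiM) (auto simp: config_measure_def)
qed

text \<open>A configuration on \<open>K\<close> is continued by \<open>False\<close> outside
  \<open>K\<close>. The event does not notice this, so it is the preimage of a measurable set of
  restricted configurations, the form in which independence of restrictions applies.\<close>

lemma dep_restrict:
  assumes "dep K E"
  shows "\<exists>F \<in> sets (PiM K (\<lambda>_. measure_pmf (bernoulli_pmf p))). E = (\<lambda>\<omega>. restrict \<omega> K) -` F"
proof -
  let ?N = "PiM K (\<lambda>_. measure_pmf (bernoulli_pmf p))"
  define ext where "ext = (\<lambda>(f::config) i. if i \<in> K then f i else False)"
  have "ext \<in> measurable ?N (\<Pi>\<^sub>M x\<in>(UNIV :: site set). count_space (UNIV :: bool set))"
    unfolding ext_def by (rule measurable_PiM_single') (auto simp: space_PiM)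
  hence F: "ext -` E \<inter> space ?N \<in> sets ?N"
    using dep_events[OF assms] unfolding cevents_def by (rule measurable_sets)
  moreover have "E = (\<lambda>\<omega>. restrict \<omega> K) -` (ext -` E \<inter> space ?N)"
  proof -
    have "\<omega> \<in> E \<longleftrightarrow> ext (restrict \<omega> K) \<in> E" for \<omega>
      using assms unfolding dep_def by (auto simp: ext_def)
    thus ?thesis by (auto simp: space_PiM)
  qed
  ultimately show ?thesis by blast
qed

abbreviation Pr :: "real \<Rightarrow> config set \<Rightarrow> real" where "Pr s E \<equiv> measure (config_measure s) E"

lemma Pr_indep:
  assumes "dep K E" "dep L F" "K \<inter> L = {}"
  shows "Pr s (E \<inter> F) = Pr s E * Pr s F"
proof -
  interpret prob_space "config_measure s" by (rule prob_space_config)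
  let ?p = "1 - exp (- s)"
  obtain E' where E': "E' \<in> sets (PiM K (\<lambda>_. measure_pmf (bernoulli_pmf ?p)))" "E = (\<lambda>\<omega>. restrict \<omega> K) -` E'"
    using dep_restrict[OF assms(1)] by blast
  obtain F' where F': "F' \<in> sets (PiM L (\<lambda>_. measure_pmf (bernoulli_pmf ?p)))" "F = (\<lambda>\<omega>. restrict \<omega> L) -` F'"
    using dep_restrict[OF assms(2)] by blast
  from indep_varD[OF indep_var_restrict[OF indep_coordinates assms(3)] E'(1) F'(1)]
  show ?thesis unfolding E'(2) F'(2) by (simp add: space_config vimage_def Int_def Collect_conj_eq[symmetric] case_prod_unfold mem_Times_iff)
qed

lemma Pr_mono: "E \<subseteq> F \<Longrightarrow> F \<in> cevents \<Longrightarrow> Pr s E \<le> Pr s F"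
  using finite_measure.finite_measure_mono[OF prob_space.finite_measure[OF prob_space_config]]
  by (simp add: sets_config)

lemma Pr_le_1: "Pr s E \<le> 1"
  using prob_space.prob_le_1[OF prob_space_config] .

lemma Pr_Compl: "E \<in> cevents \<Longrightarrow> Pr s (- E) = 1 - Pr s E"
  using prob_space.prob_compl[OF prob_space_config, of E s] by (simp add: space_config sets_config Compl_eq_Diff_UNIV)

lemma Pr_UNIV [simp]: "Pr s UNIV = 1"
  using prob_space.prob_space[OF prob_space_config, of s] by (simp add: space_config)

lemma Pr_site: assumes "s \<ge> 0" shows "Pr s {\<omega>. \<omega> x} = 1 - exp (- s)"
proof -
  interpret product_prob_space "\<lambda>_. measure_pmf (bernoulli_pmf (1 - exp (- s)))" UNIV
    by unfold_locales
  have "emeasure (config_measure s) {\<omega> \<in> space (config_measure s). \<omega> x \<in> {True}} = emeasure (bernoulli_pmf (1 - exp (- s))) {True}"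
    unfolding config_measure_def by (rule emeasure_PiM_Collect_single) auto
  hence "Pr s {\<omega>. \<omega> x} = measure (bernoulli_pmf (1 - exp (- s))) {True}"
    by (simp add: measure_def space_config)
  also have "\<dots> = 1 - exp (- s)" using assms by (simp add: measure_pmf_single)
  finally show ?thesis .
qed

lemma Pr_all_occ: assumes "s \<ge> 0" "finite A" shows "Pr s (all_occ A) = (1 - exp (- s)) ^ card A"
  using assms(2)
proof (induction A)
  case empty thus ?case by (simp add: all_occ_def)
next
  case (insert x A)
  have "all_occ (insert x A) = {\<omega>. \<omega> x} \<inter> all_occ A" by (auto simp: all_occ_def)
  hence "Pr s (all_occ (insert x A)) = Pr s {\<omega>. \<omega> x} * Pr s (all_occ A)"
    using Pr_indep[OF dep_site dep_all_occ] insert by auto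
  thus ?case using insert Pr_site[OF assms(1)] by simp
qed

lemma Pr_all_empty: assumes "s \<ge> 0" "finite A" shows "Pr s (all_empty A) = exp (- (s * real (card A)))"
  using assms(2)
proof (induction A)
  case empty thus ?case by (simp add: all_empty_def)
next
  case (insert x A)
  have "all_empty (insert x A) = (- {\<omega>. \<omega> x}) \<inter> all_empty A" by (auto simp: all_empty_def)
  hence "Pr s (all_empty (insert x A)) = Pr s (- {\<omega>. \<omega> x}) * Pr s (all_empty A)"
    using Pr_indep[OF dep_Compl[OF dep_site] dep_all_empty] insert by auto
  also have "Pr s (- {\<omega>. \<omega> x}) = exp (- s)"
    using Pr_Compl[OF dep_events[OF dep_site]] Pr_site[OF assms(1)] by simp
  finally show ?case using insert by (simp add: exp_add[symmetric] algebra_simps)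
qed

lemma Pr_not_all_empty: assumes "s \<ge> 0" "finite A" shows "Pr s (- all_empty A) = 1 - exp (- (s * real (card A)))"
  using Pr_Compl[OF dep_events[OF dep_all_empty]] Pr_all_empty[OF assms] by simp

text \<open>A cell is a finite set of sites together with a flag. A cell is marked if it is flagged or
  contains an occupied site; flagged cells are required to be empty. The event below says that,
  \<open>j\<close> unmarked cells having just been seen, there are no \<open>k\<close> consecutive unmarked cells.\<close>

fun gapfree :: "nat \<Rightarrow> nat \<Rightarrow> (site set \<times> bool) list \<Rightarrow> config set" where
  "gapfree k j [] = UNIV"
| "gapfree k j (c # cs) =
    (if snd c then all_empty (fst c) \<inter> gapfree k 0 cs
     else (- all_empty (fst c) \<inter> gapfree k 0 cs) \<union>
          (if Suc j < k then all_empty (fst c) \<inter> gapfree k (Suc j) cs else {}))"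

definition cells :: "(site set \<times> bool) list \<Rightarrow> site set" where
  "cells cs = (\<Union>c\<in>set cs. fst c)"

lemma dep_gapfree: "dep (cells cs) (gapfree k j cs)"
proof (induction cs arbitrary: j)
  case (Cons c cs)
  have s: "fst c \<subseteq> cells (c # cs)" "cells cs \<subseteq> cells (c # cs)" by (auto simp: cells_def)
  show ?case using dep_mono[OF dep_all_empty s(1)] dep_mono[OF Cons.IH s(2)]
    by (auto intro!: dep_Un dep_Int dep_Compl)
qed simp

fun disj_cells :: "(site set \<times> bool) list \<Rightarrow> bool" where
  "disj_cells [] = True"
| "disj_cells (c # cs) = (finite (fst c) \<and> fst c \<inter> cells cs = {} \<and> disj_cells cs)"

lemma Pr_gapfree_Cons:
  assumes "disj_cells (c # cs)" "s \<ge> 0"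
  defines "x \<equiv> exp (- (s * real (card (fst c))))"
  shows "Pr s (gapfree k j (c # cs)) =
    (if snd c then x * Pr s (gapfree k 0 cs)
     else (1 - x) * Pr s (gapfree k 0 cs) + (if Suc j < k then x * Pr s (gapfree k (Suc j) cs) else 0))"
proof -
  interpret prob_space "config_measure s" by (rule prob_space_config)
  have d: "fst c \<inter> cells cs = {}" "finite (fst c)" using assms by auto
  have 1: "Pr s (all_empty (fst c) \<inter> gapfree k i cs) = x * Pr s (gapfree k i cs)" for i
    using Pr_indep[OF dep_all_empty dep_gapfree d(1)] Pr_all_empty[OF assms(2) d(2)] by (simp add: x_def)
  have 2: "Pr s (- all_empty (fst c) \<inter> gapfree k i cs) = (1 - x) * Pr s (gapfree k i cs)" for i
    using Pr_indep[OF dep_Compl[OF dep_all_empty] dep_gapfree d(1)] Pr_not_all_empty[OF assms(2) d(2)] by (simp add: x_def)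
  have ev: "all_empty (fst c) \<inter> gapfree k i cs \<in> cevents" "- all_empty (fst c) \<inter> gapfree k i cs \<in> cevents" for i
    using dep_events[OF dep_all_empty] dep_events[OF dep_Compl[OF dep_all_empty]] dep_events[OF dep_gapfree] by auto
  have "Pr s ((- all_empty (fst c) \<inter> gapfree k 0 cs) \<union> (all_empty (fst c) \<inter> gapfree k (Suc j) cs)) =
    Pr s (- all_empty (fst c) \<inter> gapfree k 0 cs) + Pr s (all_empty (fst c) \<inter> gapfree k (Suc j) cs)"
    using ev by (intro finite_measure_Union) (auto simp: sets_config)
  thus ?thesis by (simp add: 1 2)
qed

text \<open>The vector \<open>gsum (k - j) y\<close>, indexed by the current run \<open>j\<close> of
  empty cells, is an eigenvector with eigenvalue \<open>f\<close>: a marked cell resets the run to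
  \<open>0\<close>, an empty one raises it by one, and a run of length \<open>k\<close> is killed
  since \<open>gsum 0 y = 0\<close>.\<close>

lemma eigen_step:
  assumes "k \<ge> 1" "z > 0" "j < k"
  defines "y \<equiv> exp (- zinv k z)" and "f \<equiv> exp (- gk k z)"
  shows "(1 - exp (- z)) * gsum k y + exp (- z) * gsum (k - Suc j) y = f * gsum (k - j) y"
    and "(1 - exp (- z)) * gsum k y = f"
proof -
  have S: "gsum k y \<ge> 1" using assms by (intro gsum_ge_1) (auto simp: y_def)
  show u: "(1 - exp (- z)) * gsum k y = f"
    using gk_eigen(2)[OF assms(1,2)] S by (simp add: gsum_def y_def f_def)
  have "exp (- z) = f * y" using gk_eigen(1)[OF assms(1,2)] by (simp add: f_def y_def)
  moreover have "gsum (k - j) y = 1 + y * gsum (k - Suc j) y"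
    using gsum_Suc[of "k - Suc j" y] assms(3) by (simp add: Suc_diff_Suc)
  ultimately show "(1 - exp (- z)) * gsum k y + exp (- z) * gsum (k - Suc j) y = f * gsum (k - j) y"
    using u by (simp add: algebra_simps)
qed

text \<open>Induction with the eigenvector as weight; it is at least one for all
  \<open>j < k\<close>. At a flagged cell the probability \<open>1 - exp (- z)\<close> of being
  marked is replaced by the probability \<open>exp (- z)\<close> of being empty, hence one quotient
  per flag.\<close>

lemma Pr_gapfree_upper_aux:
  assumes "k \<ge> 1" "s > 0" "h \<ge> 1" "disj_cells cs" "\<forall>c\<in>set cs. card (fst c) = h" "j < k"
  defines "z \<equiv> s * real h"
  defines "y \<equiv> exp (- zinv k z)" and "f \<equiv> exp (- gk k z)"
  shows "Pr s (gapfree k j cs) \<le> gsum (k - j) y * f ^ length cs * (exp (- z) / (1 - exp (- z))) ^ length (filter snd cs)"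
  using assms(4-6)
proof (induction cs arbitrary: j)
  case Nil
  thus ?case using gsum_ge_1[of y "k - j"] by (simp add: y_def)
next
  case (Cons c cs)
  have z: "z > 0" using assms(2,3) by (simp add: z_def)
  have yp: "y \<ge> 0" and fp: "f > 0" by (auto simp: y_def f_def)
  have xu: "exp (- z) > 0" "1 - exp (- z) > 0" using z by auto
  let ?b = "exp (- z) / (1 - exp (- z))"
  let ?n = "length cs" and ?t = "length (filter snd cs)"
  have bp: "?b \<ge> 0" using xu by simp
  have IH: "Pr s (gapfree k i cs) \<le> gsum (k - i) y * f ^ ?n * ?b ^ ?t" if "i < k" for i
    using Cons.IH[of i] Cons.prems that by simp
  have zc: "exp (- (s * real (card (fst c)))) = exp (- z)" using Cons.prems by (simp add: z_def)
  note E = eigen_step[OF assms(1) z, folded y_def f_def]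
  show ?case
  proof (cases "snd c")
    case True
    have "Pr s (gapfree k j (c # cs)) = exp (- z) * Pr s (gapfree k 0 cs)"
      using Pr_gapfree_Cons[OF Cons.prems(1), of s k j] True assms(2) zc by simp
    also have "\<dots> \<le> exp (- z) * (gsum k y * f ^ ?n * ?b ^ ?t)"
      using IH[of 0] assms(1) by (intro mult_left_mono) auto
    also have "\<dots> = ((1 - exp (- z)) * gsum k y) * f ^ ?n * (?b * ?b ^ ?t)"
      using xu by simp
    also have "\<dots> = 1 * (f ^ Suc ?n * ?b ^ Suc ?t)" unfolding E(2)[OF Cons.prems(3)] by simp
    also have "\<dots> \<le> gsum (k - j) y * (f ^ Suc ?n * ?b ^ Suc ?t)"
      using yp fp bp Cons.prems by (intro mult_right_mono gsum_ge_1 mult_nonneg_nonneg zero_le_power) auto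
    finally show ?thesis using True by (simp add: mult_ac)
  next
    case False
    let ?G = "f ^ ?n * ?b ^ ?t"
    have "Pr s (gapfree k j (c # cs)) = (1 - exp (- z)) * Pr s (gapfree k 0 cs) + (if Suc j < k then exp (- z) * Pr s (gapfree k (Suc j) cs) else 0)"
      using Pr_gapfree_Cons[OF Cons.prems(1), of s k j] False assms(2) zc by simp
    also have "\<dots> \<le> (1 - exp (- z)) * (gsum k y * ?G) + exp (- z) * (gsum (k - Suc j) y * ?G)"
    proof (intro add_mono mult_left_mono)
      show "Pr s (gapfree k 0 cs) \<le> gsum k y * ?G" using IH[of 0] assms(1) by (simp add: mult.assoc)
      show "(if Suc j < k then exp (- z) * Pr s (gapfree k (Suc j) cs) else 0) \<le> exp (- z) * (gsum (k - Suc j) y * ?G)"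
        using IH[of "Suc j"] yp fp bp by (auto simp: mult.assoc intro!: mult_left_mono mult_nonneg_nonneg gsum_nonneg)
    qed (use xu in auto)
    also have "\<dots> = ((1 - exp (- z)) * gsum k y + exp (- z) * gsum (k - Suc j) y) * ?G"
      by (simp add: algebra_simps)
    also have "\<dots> = gsum (k - j) y * f ^ Suc ?n * ?b ^ ?t"
      unfolding E(1)[OF Cons.prems(3)] by simp
    finally show ?thesis using False by simp
  qed
qed

lemma Pr_gapfree_upper:
  assumes "k \<ge> 1" "s > 0" "h \<ge> 1" "disj_cells cs" "\<forall>c\<in>set cs. card (fst c) = h"
  defines "z \<equiv> s * real h"
  shows "Pr s (gapfree k 0 cs) \<le>
    exp (- (gk k z * real (length cs))) * (exp (- z) / (1 - exp (- z))) ^ length (filter snd cs) / (1 - exp (- z))"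
proof -
  have z: "z > 0" using assms by simp
  let ?y = "exp (- zinv k z)"
  have "gsum k ?y = exp (- gk k z) / (1 - exp (- z))"
    using eigen_step(2)[OF assms(1) z, of 0] assms(1) z by (simp add: field_simps)
  also have "\<dots> \<le> 1 / (1 - exp (- z))" using z gk_pos[OF assms(1) z] by (intro divide_right_mono) auto
  finally have g: "gsum k ?y \<le> 1 / (1 - exp (- z))" .
  have "Pr s (gapfree k 0 cs) \<le> gsum k ?y * (exp (- gk k z) ^ length cs * (exp (- z) / (1 - exp (- z))) ^ length (filter snd cs))"
    using Pr_gapfree_upper_aux[OF assms(1-5), of 0] assms(1) unfolding z_def by (simp add: mult.assoc)
  also have "\<dots> \<le> 1 / (1 - exp (- z)) * (exp (- gk k z) ^ length cs * (exp (- z) / (1 - exp (- z))) ^ length (filter snd cs))"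
    using z by (intro mult_right_mono g mult_nonneg_nonneg zero_le_power) auto
  also have "exp (- gk k z) ^ length cs = exp (- (gk k z * real (length cs)))"
    by (simp add: exp_of_nat_mult[symmetric] mult.commute)
  finally show ?thesis by simp
qed

text \<open>The eigenvector depends on the cell size, so it is normalised to be one at run
  \<open>0\<close> and evaluated at a size \<open>h\<close> below all remaining ones. Sizes increase
  along the list, \<open>exp (- zinv k z)\<close> decreases, and by \<open>gsum_ratio_anti\<close>
  passing to the next size only raises the normalised vector.\<close>

lemma Pr_gapfree_lower_aux:
  assumes "k \<ge> 1" "s > 0" "disj_cells cs" "\<forall>c\<in>set cs. \<not> snd c"
    "sorted (map (\<lambda>c. card (fst c)) cs)" "\<forall>c\<in>set cs. h \<le> card (fst c)" "h \<ge> 1" "j < k"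
  shows "Pr s (gapfree k j cs) \<ge> gsum (k - j) (exp (- zinv k (s * real h))) / gsum k (exp (- zinv k (s * real h))) * exp (- (\<Sum>c\<leftarrow>cs. gk k (s * real (card (fst c)))))"
  using assms(3-8)
proof (induction cs arbitrary: j h)
  case (Nil j h)
  let ?y = "exp (- zinv k (s * real h))"
  have "gsum (k - j) ?y \<le> gsum k ?y" unfolding gsum_def by (intro sum_mono2) auto
  moreover have "gsum k ?y \<ge> 1" using assms(1) by (intro gsum_ge_1) auto
  ultimately show ?case by simp
next
  case (Cons c cs j h)
  let ?h = "card (fst c)"
  let ?z = "s * real ?h" and ?w = "s * real h"
  let ?y = "exp (- zinv k ?z)" and ?v = "exp (- zinv k ?w)"
  let ?f = "exp (- gk k ?z)"
  let ?G = "exp (- (\<Sum>c\<leftarrow>cs. gk k (s * real (card (fst c)))))"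
  have hh: "h \<le> ?h" "h \<ge> 1" using Cons.prems by auto
  have z: "?z > 0" "?w > 0" "?w \<le> ?z" using hh assms(2) by auto
  have S: "gsum k ?y \<ge> 1" using assms(1) by (intro gsum_ge_1) auto
  have IH: "Pr s (gapfree k i cs) \<ge> gsum (k - i) ?y / gsum k ?y * ?G" if "i < k" for i
    using Cons.IH[of ?h i] Cons.prems that hh by auto
  have xu: "exp (- ?z) > 0" "1 - exp (- ?z) > 0" using z by auto
  note E = eigen_step[OF assms(1) z(1)]
  have "?y \<le> ?v" using z zinv_less_iff[OF assms(1), of ?z ?w] by simp
  hence "gsum (k - j) ?v / gsum k ?v \<le> gsum (k - j) ?y / gsum k ?y"
    using assms(1) by (intro gsum_ratio_anti) auto
  hence "gsum (k - j) ?v / gsum k ?v * (?f * ?G) \<le> gsum (k - j) ?y / gsum k ?y * (?f * ?G)"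
    by (intro mult_right_mono) auto
  also have "\<dots> = (?f * gsum (k - j) ?y) / gsum k ?y * ?G" by simp
  also have "\<dots> = (1 - exp (- ?z)) * ?G + exp (- ?z) * (gsum (k - Suc j) ?y / gsum k ?y * ?G)"
    unfolding E(1)[OF Cons.prems(6), symmetric] using S by (simp add: field_simps)
  also have "\<dots> \<le> (1 - exp (- ?z)) * Pr s (gapfree k 0 cs) + (if Suc j < k then exp (- ?z) * Pr s (gapfree k (Suc j) cs) else 0)"
  proof (intro add_mono mult_left_mono)
    show "?G \<le> Pr s (gapfree k 0 cs)" using IH[of 0] assms(1) S by simp
    show "exp (- ?z) * (gsum (k - Suc j) ?y / gsum k ?y * ?G) \<le> (if Suc j < k then exp (- ?z) * Pr s (gapfree k (Suc j) cs) else 0)"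
    proof (cases "Suc j < k")
      case True
      thus ?thesis using mult_left_mono[OF IH[OF True], of "exp (- ?z)"] by simp
    qed (simp add: gsum_def)
  qed (use xu in auto)
  also have "\<dots> = Pr s (gapfree k j (c # cs))"
    using Pr_gapfree_Cons[OF Cons.prems(1), of s k j] Cons.prems(2) assms(2) by simp
  finally show ?case by (simp add: exp_add[symmetric] mult.assoc)
qed

lemma Pr_gapfree_lower:
  assumes "k \<ge> 1" "s > 0" "disj_cells cs" "\<forall>c\<in>set cs. \<not> snd c"
    "sorted (map (\<lambda>c. card (fst c)) cs)" "\<forall>c\<in>set cs. 1 \<le> card (fst c)"
  shows "Pr s (gapfree k 0 cs) \<ge> exp (- (\<Sum>c\<leftarrow>cs. gk k (s * real (card (fst c)))))"
  using Pr_gapfree_lower_aux[OF assms(1-6), of 0] gsum_ge_1[of "exp (- zinv k s)" k] assms(1) by simp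

section \<open>Gap-free sequences as a condition on windows\<close>

fun no_gap :: "nat \<Rightarrow> nat \<Rightarrow> bool list \<Rightarrow> bool" where
  "no_gap k j [] = True"
| "no_gap k j (b # bs) = (if b then no_gap k 0 bs else Suc j < k \<and> no_gap k (Suc j) bs)"

text \<open>The unmarked cells already seen are put back in front. A marked cell at position
  \<open>j\<close> serves every window starting at or before it, because \<open>j < k\<close>, so
  only windows behind it remain to be checked.\<close>

lemma no_gap_iff:
  "j < k \<Longrightarrow> no_gap k j bs \<longleftrightarrow>
    (\<forall>i. i + k \<le> j + length bs \<longrightarrow> (\<exists>i'\<in>{i..<i+k}. (replicate j False @ bs) ! i'))"
proof (induction bs arbitrary: j)
  case Nil
  thus ?case by auto
next
  case (Cons b bs)
  show ?case
  proof (cases b)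
    case False
    have eq: "replicate j False @ False # bs = replicate (Suc j) False @ bs"
      by (simp add: replicate_append_same[symmetric] del: replicate_Suc) (simp add: replicate_app_Cons_same)
    show ?thesis
    proof (cases "Suc j < k")
      case True
      thus ?thesis using Cons.IH[OF True] False by (simp add: eq del: replicate_Suc)
    next
      case sj: False
      hence k: "k = Suc j" using Cons.prems by simp
      have "\<not> (\<exists>i'\<in>{0..<0+k}. (replicate (Suc j) False @ bs) ! i')"
        unfolding k by (simp add: nth_append del: replicate_Suc)
      thus ?thesis using False sj k by (auto simp: eq simp del: replicate_Suc)
    qed
  next
    case True
    let ?L = "replicate j False @ True # bs"
    have nth: "?L ! (i + Suc j) = bs ! i" for i by (simp add: nth_append)
    have "(\<forall>i. i + k \<le> j + length (True # bs) \<longrightarrow> (\<exists>i'\<in>{i..<i+k}. ?L ! i')) \<longleftrightarrow>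
      (\<forall>i. i + k \<le> length bs \<longrightarrow> (\<exists>i'\<in>{i..<i+k}. bs ! i'))" (is "?A = ?B")
    proof
      assume A: ?A
      show ?B
      proof (intro allI impI)
        fix i assume "i + k \<le> length bs"
        with A[rule_format, of "i + Suc j"] obtain i' where i': "i' \<in> {i + Suc j..<i + Suc j + k}" "?L ! i'" by auto
        hence "bs ! (i' - Suc j)" using nth[of "i' - Suc j"] by auto
        thus "\<exists>i'\<in>{i..<i+k}. bs ! i'" using i' by (intro bexI[of _ "i' - Suc j"]) auto
      qed
    next
      assume B: ?B
      show ?A
      proof (intro allI impI)
        fix i assume i: "i + k \<le> j + length (True # bs)"
        show "\<exists>i'\<in>{i..<i+k}. ?L ! i'"
        proof (cases "i \<le> j")
          case True
          thus ?thesis using Cons.prems by (intro bexI[of _ j]) (auto simp: nth_append)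
        next
          case False
          have "i - Suc j + k \<le> length bs" using i False by simp
          from B[rule_format, OF this] obtain i' where "i' \<in> {i - Suc j..<i - Suc j + k}" "bs ! i'" by blast
          thus ?thesis using False nth[of i'] by (intro bexI[of _ "i' + Suc j"]) auto
        qed
      qed
    qed
    thus ?thesis using True Cons.IH[of 0] Cons.prems by simp
  qed
qed

lemma gapfree_iff:
  "\<omega> \<in> gapfree k j cs \<longleftrightarrow>
    (\<forall>c\<in>set cs. snd c \<longrightarrow> \<omega> \<in> all_empty (fst c)) \<and>
    no_gap k j (map (\<lambda>c. snd c \<or> \<omega> \<notin> all_empty (fst c)) cs)"
  by (induction cs arbitrary: j) auto

section \<open>Deterministic growth\<close>

lemma occ_rule_mono: "occ_rule M A x \<Longrightarrow> A \<subseteq> B \<Longrightarrow> occ_rule M B x"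
  by (cases M) (auto simp: occ_rule_def)

lemma finite_Nk: "finite (Nk k x)"
proof -
  have "Nk k x \<subseteq> (\<lambda>v. (fst x + v, snd x)) ` {- int k..int k} \<union> (\<lambda>v. (fst x, snd x + v)) ` {- int k..int k}"
    unfolding Nk_def by (intro Un_mono) (auto simp: image_iff)
  thus ?thesis by (rule finite_subset) auto
qed

lemma empty_rule_mono: assumes "empty_rule M A x" "A \<subseteq> B" shows "empty_rule M B x"
proof (cases M)
  case (KPerc k)
  have "card (Nk k x \<inter> A) \<le> card (Nk k x \<inter> B)" using assms finite_Nk by (intro card_mono) auto
  thus ?thesis using assms KPerc by (simp add: empty_rule_def)
qed (use assms in \<open>auto simp: empty_rule_def\<close>)

lemma occ_rule_finitary: "occ_rule M A x \<Longrightarrow> \<exists>F. finite F \<and> F \<subseteq> A \<and> occ_rule M F x"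
proof -
  assume a: "occ_rule M A x"
  then obtain y where "y \<in> A" "occ_rule M {y} x" by (cases M) (auto simp: occ_rule_def)
  thus ?thesis by (intro exI[of _ "{y}"]) auto
qed

lemma empty_rule_finitary: assumes "empty_rule M A x" shows "\<exists>F. finite F \<and> F \<subseteq> A \<and> empty_rule M F x"
proof (cases M)
  case (KPerc k)
  thus ?thesis using assms finite_Nk
    by (intro exI[of _ "Nk k x \<inter> A"]) (auto simp: empty_rule_def)
next
  case Modified1
  let ?F = "{(fst x, snd x + 1), (fst x, snd x - 1), (fst x + 1, snd x), (fst x - 1, snd x)} \<inter> A"
  show ?thesis using assms Modified1 by (intro exI[of _ ?F]) (auto simp: empty_rule_def)
next
  case Frobse1
  then obtain e d where "(fst x + e, snd x) \<in> A" "(fst x, snd x + d) \<in> A" "(fst x + e, snd x + d) \<in> A" "e \<in> {1,-1}" "d \<in> {1,-1}"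
  proof -
    have "\<exists>e\<in>{1,-1}. \<exists>d\<in>{1,-1}. (fst x + e, snd x) \<in> A \<and> (fst x, snd x + d) \<in> A \<and> (fst x + e, snd x + d) \<in> A"
      using assms unfolding Frobse1 empty_rule_def by (simp only: perc_model.case)
    thus ?thesis using that by blast
  qed
  thus ?thesis using Frobse1
    unfolding empty_rule_def perc_model.case
    by (intro exI[of _ "{(fst x + e, snd x), (fst x, snd x + d), (fst x + e, snd x + d)}"] conjI bexI[of _ e] bexI[of _ d]) auto
qed

primrec active_after :: "perc_model \<Rightarrow> config \<Rightarrow> nat \<Rightarrow> site set" where
  "active_after M \<omega> 0 = init_active \<omega>"
| "active_after M \<omega> (Suc n) = active_after M \<omega> n \<union> {x. \<omega> x \<and> occ_rule M (active_after M \<omega> n) x}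
     \<union> {x. \<not> \<omega> x \<and> empty_rule M (active_after M \<omega> n) x}"

lemma active_after_mono: "m \<le> n \<Longrightarrow> active_after M \<omega> m \<subseteq> active_after M \<omega> n"
  by (rule lift_Suc_mono_le) auto

lemma finite_subset_active_after:
  "finite F \<Longrightarrow> F \<subseteq> (\<Union>n. active_after M \<omega> n) \<Longrightarrow> \<exists>n. F \<subseteq> active_after M \<omega> n"
proof (induction F rule: finite_induct)
  case (insert x F)
  then obtain n m where n: "F \<subseteq> active_after M \<omega> n" and m: "x \<in> active_after M \<omega> m" by auto
  have "insert x F \<subseteq> active_after M \<omega> (max m n)"
    using n m active_after_mono[of m "max m n" M \<omega>] active_after_mono[of n "max m n" M \<omega>] by auto
  thus ?case by blast
qed auto

text \<open>Each activation uses finitely many active sites, so the union of the stages is closed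
  under the rules. The countable description is what makes indefinite growth measurable.\<close>

lemma final_active_eq: "final_active M \<omega> = (\<Union>n. active_after M \<omega> n)"
proof
  have "active_after M \<omega> n \<subseteq> S" if "init_active \<omega> \<subseteq> S" "closed_under M \<omega> S" for S n
  proof (induction n)
    case (Suc n)
    thus ?case using that(2) occ_rule_mono[OF _ Suc] empty_rule_mono[OF _ Suc] unfolding closed_under_def by auto
  qed (use that in auto)
  thus "(\<Union>n. active_after M \<omega> n) \<subseteq> final_active M \<omega>" unfolding final_active_def by blast
  have "closed_under M \<omega> (\<Union>n. active_after M \<omega> n)"
    unfolding closed_under_def
  proof (intro allI conjI impI; elim conjE)
    fix x assume x: "\<omega> x" "occ_rule M (\<Union>n. active_after M \<omega> n) x"
    then obtain F n where "F \<subseteq> active_after M \<omega> n" "occ_rule M F x"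
      using occ_rule_finitary[OF x(2)] finite_subset_active_after by meson
    hence "x \<in> active_after M \<omega> (Suc n)" using x(1) occ_rule_mono by auto
    thus "x \<in> (\<Union>n. active_after M \<omega> n)" by blast
  next
    fix x assume x: "\<not> \<omega> x" "empty_rule M (\<Union>n. active_after M \<omega> n) x"
    then obtain F n where "F \<subseteq> active_after M \<omega> n" "empty_rule M F x"
      using empty_rule_finitary[OF x(2)] finite_subset_active_after by meson
    hence "x \<in> active_after M \<omega> (Suc n)" using x(1) empty_rule_mono by auto
    thus "x \<in> (\<Union>n. active_after M \<omega> n)" by blast
  qed
  moreover have "init_active \<omega> \<subseteq> (\<Union>n. active_after M \<omega> n)" by (auto intro!: exI[of _ 0])
  ultimately show "final_active M \<omega> \<subseteq> (\<Union>n. active_after M \<omega> n)" unfolding final_active_def by blast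
qed

text \<open>A monotone finitary condition is a union, over the countably many finite witnesses, of
  finite intersections.\<close>

lemma finitary_rule_event:
  assumes fin: "\<And>A. R A \<Longrightarrow> \<exists>F. finite F \<and> F \<subseteq> A \<and> R F" and mono: "\<And>A B. R A \<Longrightarrow> A \<subseteq> B \<Longrightarrow> R B"
    and ev: "\<And>y. dep UNIV {\<omega>. y \<in> act \<omega>}"
  shows "dep UNIV {\<omega>. R (act \<omega> :: site set)}"
proof -
  have "{\<omega>. R (act \<omega>)} = (\<Union>F\<in>{F. finite F \<and> R F}. \<Inter>y\<in>F. {\<omega>. y \<in> act \<omega>})"
  proof (intro equalityI subsetI)
    fix \<omega> assume "\<omega> \<in> {\<omega>. R (act \<omega>)}"
    then obtain F where "finite F" "F \<subseteq> act \<omega>" "R F" using fin by blast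
    thus "\<omega> \<in> (\<Union>F\<in>{F. finite F \<and> R F}. \<Inter>y\<in>F. {\<omega>. y \<in> act \<omega>})" by blast
  next
    fix \<omega> assume "\<omega> \<in> (\<Union>F\<in>{F. finite F \<and> R F}. \<Inter>y\<in>F. {\<omega>. y \<in> act \<omega>})"
    then obtain F where "F \<subseteq> act \<omega>" "R F" by blast
    thus "\<omega> \<in> {\<omega>. R (act \<omega>)}" using mono by blast
  qed
  moreover have "countable {F. finite F \<and> R F}"
    by (rule countable_subset[OF _ countable_Collect_finite]) auto
  ultimately show ?thesis using ev by (auto intro!: dep_UN dep_INT)
qed

lemma active_after_event: "dep UNIV {\<omega>. x \<in> active_after M \<omega> n}"
proof (induction n arbitrary: x)
  case 0
  have "{\<omega>. x \<in> active_after M \<omega> 0} = (if x = (0,0) then {\<omega>. \<omega> (0,0)} else {})"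
    by (auto simp: init_active_def)
  thus ?case using dep_mono[OF dep_site] by auto
next
  case (Suc n)
  have "{\<omega>. x \<in> active_after M \<omega> (Suc n)} = {\<omega>. x \<in> active_after M \<omega> n} \<union>
    ({\<omega>. \<omega> x} \<inter> {\<omega>. occ_rule M (active_after M \<omega> n) x}) \<union> (- {\<omega>. \<omega> x} \<inter> {\<omega>. empty_rule M (active_after M \<omega> n) x})"
    by auto
  moreover have "dep UNIV {\<omega>. occ_rule M (active_after M \<omega> n) x}"
    by (rule finitary_rule_event) (use occ_rule_finitary occ_rule_mono Suc in auto)
  moreover have "dep UNIV {\<omega>. empty_rule M (active_after M \<omega> n) x}"
    by (rule finitary_rule_event) (use empty_rule_finitary empty_rule_mono Suc in auto)
  moreover have "dep UNIV {\<omega>. \<omega> x}" by (rule dep_mono[OF dep_site]) simp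
  ultimately show ?case using Suc[of x] by (simp only: dep_Un dep_Int dep_Compl)
qed

lemma indefinite_growth_event: "indefinite_growth M \<in> cevents"
proof -
  have "indefinite_growth M = (\<Inter>x. \<Union>n. {\<omega>. x \<in> active_after M \<omega> n})"
    by (auto simp: indefinite_growth_def final_active_eq)
  also have "dep UNIV \<dots>" by (intro dep_INT dep_UN countableI_type active_after_event)
  finally show ?thesis by (rule dep_events)
qed

lemma occ_rule_near:
  assumes "valid_model M" "y \<in> A" "l1dist x y \<le> int (model_k M)"
  shows "occ_rule M A x"
  using assms by (cases M) (auto simp: occ_rule_def model_k_def l1dist_def linfdist_def intro!: bexI[of _ y])

text \<open>The side length that guarantees \<open>k - 1\<close> active sites behind an empty site.
  The maximum covers \<open>k = 1\<close>, where one neighbour behind is still used.\<close>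

definition reach :: "perc_model \<Rightarrow> int" where "reach M = max 1 (int (model_k M) - 1)"

text \<open>The final set is an intersection of closed sets, so growth is proved for an arbitrary
  closed set and no time has to be followed.\<close>

locale closed_active =
  fixes M :: perc_model and \<omega> :: config and A :: "site set"
  assumes valid: "valid_model M" and closed: "closed_under M \<omega> A"
begin

lemma active_near: "y \<in> A \<Longrightarrow> l1dist x y \<le> int (model_k M) \<Longrightarrow> \<omega> x \<Longrightarrow> x \<in> A"
  using closed occ_rule_near[OF valid] unfolding closed_under_def by blast

lemma k_pos: "model_k M \<ge> 1"
  using valid by (cases M) (auto simp: valid_model_def model_k_def)

lemma Nk_row_subset:
  assumes "B \<subseteq> Nk k x \<inter> A" "card B \<ge> k" "finite B" shows "k \<le> card (Nk k x \<inter> A)"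
  using card_mono[of "Nk k x \<inter> A" B] finite_Nk assms by auto

text \<open>An occupied site is activated by its neighbour; an empty one sees \<open>k - 1\<close>
  active sites behind it and one more ahead. For \<open>k = 1\<close> there is no admissible
  \<open>d\<close>.\<close>

lemma active_between:
  assumes left: "\<And>i. 1 \<le> i \<Longrightarrow> i \<le> reach M \<Longrightarrow> (x - i, y) \<in> A"
    and right: "(x + d, y) \<in> A" "1 \<le> d" "d \<le> int (model_k M) - 1"
  shows "(x, y) \<in> A"
proof (cases "\<omega> (x, y)")
  case True
  show ?thesis using active_near[OF left[of 1], of "(x,y)"] True k_pos by (auto simp: l1dist_def reach_def)
next
  case False
  obtain k where k: "M = KPerc k" "k \<ge> 2" using valid right by (cases M) (auto simp: valid_model_def model_k_def)
  let ?B = "insert (x + d, y) ((\<lambda>i. (x - i, y)) ` {1..int k - 1})"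
  have "card ((\<lambda>i. (x - i, y)) ` {1..int k - 1}) = k - 1"
    by (subst card_image) (auto simp: inj_on_def)
  hence "card ?B = k" using k right by (subst card_insert_disjoint) auto
  moreover have "?B \<subseteq> Nk k (x,y) \<inter> A"
    using left right k unfolding Nk_def by (auto simp: reach_def model_k_def intro!: exI[of _ "- _"])
  ultimately have "empty_rule M A (x,y)" unfolding k empty_rule_def
    using Nk_row_subset[of ?B k "(x,y)"] by simp
  thus ?thesis using False closed unfolding closed_under_def by blast
qed

text \<open>Here the \<open>k\<close>-th active neighbour is the vertical one. For
  \<open>k = 1\<close> the site \<open>(x - 1, y)\<close> is the corner that the Frobse rule asks
  for.\<close>

lemma active_beside:
  assumes left: "\<And>i. 1 \<le> i \<Longrightarrow> i \<le> reach M \<Longrightarrow> (x - i, y + d) \<in> A"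
    and "(x, y) \<in> A" "(x - 1, y) \<in> A" and d: "d = 1 \<or> d = -1"
  shows "(x, y + d) \<in> A"
proof (cases "\<omega> (x, y + d)")
  case True
  show ?thesis using active_near[OF left[of 1], of "(x,y+d)"] True k_pos by (auto simp: l1dist_def reach_def)
next
  case False
  have l1: "(x - 1, y + d) \<in> A" using left[of 1] by (simp add: reach_def)
  have "empty_rule M A (x, y + d)"
  proof (cases M)
    case (KPerc k)
    hence k: "k \<ge> 2" using valid by (auto simp: valid_model_def)
    let ?B = "insert (x, y) ((\<lambda>i. (x - i, y + d)) ` {1..int k - 1})"
    have "card ((\<lambda>i. (x - i, y + d)) ` {1..int k - 1}) = k - 1"
      by (subst card_image) (auto simp: inj_on_def)
    hence "card ?B = k" using k d by (subst card_insert_disjoint) auto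
    moreover have "?B \<subseteq> Nk k (x,y + d) \<inter> A"
    proof
      fix z assume "z \<in> ?B"
      then consider "z = (x, y)" | i where "z = (x - i, y + d)" "1 \<le> i" "i \<le> int k - 1" by auto
      thus "z \<in> Nk k (x,y + d) \<inter> A"
      proof cases
        case 1
        thus ?thesis using assms k d unfolding Nk_def by (auto intro!: exI[of _ "- d"])
      next
        case (2 i)
        thus ?thesis using left[of i] KPerc unfolding Nk_def
          by (auto simp: reach_def model_k_def intro!: exI[of _ "- i"])
      qed
    qed
    ultimately show ?thesis unfolding KPerc empty_rule_def
      using Nk_row_subset[of ?B k "(x,y+d)"] by simp
  next
    case Modified1
    thus ?thesis using l1 assms by (auto simp: empty_rule_def)
  next
    case Frobse1
    thus ?thesis using l1 assms by (auto simp: empty_rule_def)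
  qed
  thus ?thesis using False closed unfolding closed_under_def by blast
qed

definition rect :: "int \<Rightarrow> int \<Rightarrow> int \<Rightarrow> int \<Rightarrow> site set" where
  "rect x0 x1 y0 y1 = {x0..x1} \<times> {y0..y1}"

text \<open>The occupied site is close enough to be activated. The gap in its own row is closed from
  left to right by \<open>active_between\<close>; then \<open>active_beside\<close> fills the new
  columns row by row, upwards and downwards from \<open>y\<close>.\<close>

lemma fill_right:
  assumes R: "rect l r d u \<subseteq> A" and w: "r - l + 1 \<ge> reach M" and y: "d \<le> y" "y \<le> u"
    and c: "r < c" "c \<le> r + int (model_k M)" "\<omega> (c, y)"
  shows "rect l c d u \<subseteq> A"
proof -
  have lr: "l \<le> r" using w by (simp add: reach_def)
  have in_R: "(x, v) \<in> A" if "l \<le> x" "x \<le> r" "d \<le> v" "v \<le> u" for x v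
    using R that by (auto simp: rect_def)
  have cA: "(c, y) \<in> A"
    by (rule active_near[of "(r, y)"]) (use in_R[of r y] lr y c in \<open>auto simp: l1dist_def\<close>)
  have "\<forall>x. l \<le> x \<longrightarrow> x \<le> r + int n \<longrightarrow> x < c \<longrightarrow> (x, y) \<in> A" for n
  proof (induction n)
    case 0 thus ?case using in_R y by auto
  next
    case (Suc n)
    show ?case
    proof (intro allI impI)
      fix x assume x: "l \<le> x" "x \<le> r + int (Suc n)" "x < c"
      show "(x, y) \<in> A"
      proof (cases "x \<le> r")
        case True thus ?thesis using in_R y x by auto
      next
        case False
        show ?thesis
        proof (rule active_between[where d = "c - x"])
          show "(x - i, y) \<in> A" if "1 \<le> i" "i \<le> reach M" for i
            using Suc.IH that x w False by auto
        qed (use cA x c False in auto)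
      qed
    qed
  qed
  from this[of "nat (c - r)"] have row: "(x, y) \<in> A" if "l \<le> x" "x \<le> c" for x
    using that cA c by (cases "x = c") auto
  have next_row: "\<forall>x. l \<le> x \<longrightarrow> x \<le> c \<longrightarrow> (x, v + e) \<in> A"
    if v: "\<forall>x. l \<le> x \<longrightarrow> x \<le> c \<longrightarrow> (x, v) \<in> A" "d \<le> v + e" "v + e \<le> u" "e = 1 \<or> e = -1" for v e
  proof -
    have "\<forall>x. l \<le> x \<longrightarrow> x \<le> r + int n \<longrightarrow> x \<le> c \<longrightarrow> (x, v + e) \<in> A" for n
    proof (induction n)
      case 0 thus ?case using in_R v by auto
    next
      case (Suc n)
      show ?case
      proof (intro allI impI)
        fix x assume x: "l \<le> x" "x \<le> r + int (Suc n)" "x \<le> c"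
        show "(x, v + e) \<in> A"
        proof (cases "x \<le> r")
          case True thus ?thesis using in_R v x by auto
        next
          case False
          show ?thesis
          proof (rule active_beside)
            show "(x - i, v + e) \<in> A" if "1 \<le> i" "i \<le> reach M" for i
              using Suc.IH that x w False by auto
          qed (use v x False lr in auto)
        qed
      qed
    qed
    from this[of "nat (c - r)"] show ?thesis using c by auto
  qed
  have up: "y + int n \<le> u \<Longrightarrow> \<forall>x. l \<le> x \<longrightarrow> x \<le> c \<longrightarrow> (x, y + int n) \<in> A" for n
  proof (induction n)
    case (Suc n)
    thus ?case using next_row[of "y + int n" 1] y by (auto simp: algebra_simps)
  qed (use row in auto)
  have down: "d \<le> y - int n \<Longrightarrow> \<forall>x. l \<le> x \<longrightarrow> x \<le> c \<longrightarrow> (x, y - int n) \<in> A" for n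
  proof (induction n)
    case (Suc n)
    thus ?case using next_row[of "y - int n" "-1"] y by (auto simp: algebra_simps)
  qed (use row in auto)
  show ?thesis
  proof
    fix z assume "z \<in> rect l c d u"
    then obtain x v where z: "z = (x, v)" "l \<le> x" "x \<le> c" "d \<le> v" "v \<le> u" by (auto simp: rect_def)
    show "z \<in> A"
    proof (cases "v \<ge> y")
      case True thus ?thesis using up[of "nat (v - y)"] z by auto
    next
      case False thus ?thesis using down[of "nat (y - v)"] z by auto
    qed
  qed
qed

end

section \<open>Symmetries that reduce four directions to one\<close>

definition isometry :: "(site \<Rightarrow> site) \<Rightarrow> bool" where
  "isometry \<phi> \<longleftrightarrow> (\<forall>x. \<phi> (\<phi> x) = x) \<and> (\<forall>M A x. occ_rule M (\<phi> -` A) x \<longleftrightarrow> occ_rule M A (\<phi> x))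
     \<and> (\<forall>M A x. empty_rule M (\<phi> -` A) x \<longleftrightarrow> empty_rule M A (\<phi> x))"

lemma isometryI:
  assumes inv: "\<And>x. \<phi> (\<phi> x) = x" and l1: "\<And>x y. l1dist (\<phi> x) (\<phi> y) = l1dist x y"
    and linf: "\<And>x y. linfdist (\<phi> x) (\<phi> y) = linfdist x y"
    and N: "\<And>k x. \<phi> ` Nk k x = Nk k (\<phi> x)"
    and mo: "\<And>A x. empty_rule Modified1 (\<phi> -` A) x \<longleftrightarrow> empty_rule Modified1 A (\<phi> x)"
    and fr: "\<And>A x. empty_rule Frobse1 (\<phi> -` A) x \<longleftrightarrow> empty_rule Frobse1 A (\<phi> x)"
  shows "isometry \<phi>"
proof -
  have "occ_rule M (\<phi> -` A) x \<longleftrightarrow> occ_rule M A (\<phi> x)" for M A x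
  proof -
    have ball: "(\<exists>y\<in>\<phi> -` A. D y) \<longleftrightarrow> (\<exists>y\<in>A. D (\<phi> y))" for D :: "site \<Rightarrow> bool"
      using inv by (metis vimageI vimageE)
    have e: "l1dist (\<phi> x) y = l1dist x (\<phi> y)" "linfdist (\<phi> x) y = linfdist x (\<phi> y)" for y
      using l1[of x "\<phi> y"] linf[of x "\<phi> y"] by (simp_all add: inv)
    show ?thesis unfolding occ_rule_def e by (cases M) (simp_all only: perc_model.case ball)
  qed
  moreover have "empty_rule M (\<phi> -` A) x \<longleftrightarrow> empty_rule M A (\<phi> x)" for M A x
  proof (cases M)
    case (KPerc k)
    have "inj \<phi>" using inv by (metis injI)
    have "\<phi> ` (Nk k x \<inter> \<phi> -` A) = Nk k (\<phi> x) \<inter> A" unfolding N[symmetric] by auto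
    hence "card (Nk k (\<phi> x) \<inter> A) = card (Nk k x \<inter> \<phi> -` A)"
      using card_image[of \<phi> "Nk k x \<inter> \<phi> -` A"] \<open>inj \<phi>\<close> by (metis inj_on_subset subset_UNIV)
    thus ?thesis by (simp add: KPerc empty_rule_def)
  qed (use mo fr in auto)
  ultimately show ?thesis using inv by (simp add: isometry_def)
qed

lemma isometry_swap: "isometry prod.swap"
proof (rule isometryI)
  show "prod.swap ` Nk k x = Nk k (prod.swap x)" for k x
    by (cases x) (simp add: Nk_def image_Un image_Collect Un_commute, auto)
qed (auto simp: l1dist_def linfdist_def empty_rule_def)

definition reflect :: "site \<Rightarrow> site" where "reflect x = (- fst x, snd x)"

lemma isometry_reflect: "isometry reflect"
proof (rule isometryI)
  have sub: "reflect ` Nk k x \<subseteq> Nk k (reflect x)" for k x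
  proof
    fix z assume "z \<in> reflect ` Nk k x"
    then obtain v where v: "1 \<le> \<bar>v\<bar>" "\<bar>v\<bar> \<le> int k - 1" "z = (- fst x + - v, snd x) \<or> z = (- fst x, snd x + v)"
      by (auto simp: Nk_def reflect_def)
    moreover have "\<bar>- v\<bar> = \<bar>v\<bar>" by simp
    ultimately show "z \<in> Nk k (reflect x)" unfolding Nk_def reflect_def by fastforce
  qed
  have "Nk k (reflect x) = reflect ` reflect ` Nk k (reflect x)" for k x
    by (simp add: image_image reflect_def)
  hence "Nk k (reflect x) \<subseteq> reflect ` Nk k x" for k x
    using image_mono[OF sub[of k "reflect x"], of reflect] by (simp add: reflect_def)
  thus "reflect ` Nk k x = Nk k (reflect x)" for k x using sub by blast
  have n: "- (a + 1) = - a - 1" "- (a - 1) = - a + 1" "- (a + 1) = - a + - 1" "- (a + - 1) = - a + 1" for a :: int by auto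
  show "empty_rule Modified1 (reflect -` A) x \<longleftrightarrow> empty_rule Modified1 A (reflect x)" for A x
    unfolding empty_rule_def perc_model.case vimage_eq reflect_def
    by (simp only: fst_conv snd_conv n(1,2) disj_commute)
  show "empty_rule Frobse1 (reflect -` A) x \<longleftrightarrow> empty_rule Frobse1 A (reflect x)" for A x
    unfolding empty_rule_def perc_model.case vimage_eq reflect_def
    by (simp only: fst_conv snd_conv n(3,4) Set.bex_simps simp_thms disj_ac)
qed (auto simp: l1dist_def linfdist_def reflect_def)

lemma closed_isometry:
  assumes "isometry \<phi>" "closed_under M \<omega> A" shows "closed_under M (\<omega> \<circ> \<phi>) (\<phi> -` A)"
proof -
  have o: "occ_rule M (\<phi> -` A) x = occ_rule M A (\<phi> x)" "empty_rule M (\<phi> -` A) x = empty_rule M A (\<phi> x)" for x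
    using assms(1) unfolding isometry_def by blast+
  show ?thesis unfolding closed_under_def o comp_apply vimage_eq
    using assms(2) unfolding closed_under_def by blast
qed

lemma closed_active_isometry:
  assumes "isometry \<phi>" "closed_active M \<omega> A" shows "closed_active M (\<omega> \<circ> \<phi>) (\<phi> -` A)"
  using assms closed_isometry unfolding closed_active_def by blast

context closed_active
begin

lemma fill_left:
  assumes "rect l r d u \<subseteq> A" "r - l + 1 \<ge> reach M" "d \<le> y" "y \<le> u"
    and "c < l" "l - int (model_k M) \<le> c" "\<omega> (c, y)"
  shows "rect c r d u \<subseteq> A"
proof -
  interpret i: closed_active M "\<omega> \<circ> reflect" "reflect -` A"
    by (rule closed_active_isometry[OF isometry_reflect closed_active_axioms])
  have "rect (-r) (-c) d u \<subseteq> reflect -` A"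
    by (rule i.fill_right[of "-r" "-l" d u y]) (use assms in \<open>auto simp: reflect_def rect_def intro!: subsetD[OF assms(1)[unfolded rect_def]]\<close>)
  note sub = this
  have i: "(x, v) \<in> reflect -` A" if "- r \<le> x" "x \<le> - c" "d \<le> v" "v \<le> u" for x v
    by (rule subsetD[OF sub]) (use that in \<open>simp add: rect_def\<close>)
  show ?thesis
  proof (clarsimp simp: rect_def)
    fix x v assume "c \<le> x" "x \<le> r" "d \<le> v" "v \<le> u"
    thus "(x, v) \<in> A" using i[of "- x" v] by (simp add: reflect_def)
  qed
qed

lemma fill_up:
  assumes "rect l r d u \<subseteq> A" "u - d + 1 \<ge> reach M" "l \<le> x" "x \<le> r"
    and "u < c" "c \<le> u + int (model_k M)" "\<omega> (x, c)"
  shows "rect l r d c \<subseteq> A"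
proof -
  interpret i: closed_active M "\<omega> \<circ> prod.swap" "prod.swap -` A"
    by (rule closed_active_isometry[OF isometry_swap closed_active_axioms])
  have "rect d c l r \<subseteq> prod.swap -` A"
    by (rule i.fill_right[of d u l r x]) (use assms in \<open>auto simp: rect_def\<close>)
  thus ?thesis by (force simp: rect_def)
qed

lemma fill_down:
  assumes "rect l r d u \<subseteq> A" "u - d + 1 \<ge> reach M" "l \<le> x" "x \<le> r"
    and "c < d" "d - int (model_k M) \<le> c" "\<omega> (x, c)"
  shows "rect l r c u \<subseteq> A"
proof -
  interpret i: closed_active M "\<omega> \<circ> prod.swap" "prod.swap -` A"
    by (rule closed_active_isometry[OF isometry_swap closed_active_axioms])
  have "rect c u l r \<subseteq> prod.swap -` A"
    by (rule i.fill_left[of d u l r x]) (use assms in \<open>auto simp: rect_def\<close>)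
  thus ?thesis by (force simp: rect_def)
qed

end

section \<open>The lower bound\<close>

lemma disj_cells_map:
  assumes "distinct xs" "\<And>x. x \<in> set xs \<Longrightarrow> finite (f x)"
    "\<And>x y. x \<in> set xs \<Longrightarrow> y \<in> set xs \<Longrightarrow> x \<noteq> y \<Longrightarrow> f x \<inter> f y = {}"
  shows "disj_cells (map (\<lambda>x. (f x, t x)) xs)"
  using assms
proof (induction xs)
  case (Cons x xs)
  have "f x \<inter> f y = {}" if "y \<in> set xs" for y using Cons.prems that by auto
  hence "f x \<inter> cells (map (\<lambda>x. (f x, t x)) xs) = {}" by (auto simp: cells_def)
  thus ?case using Cons by auto
qed simp

lemma Pr_gapfree_cong:
  assumes "disj_cells cs" "disj_cells ds" "s \<ge> 0"
    "map (\<lambda>c. (card (fst c), snd c)) cs = map (\<lambda>c. (card (fst c), snd c)) ds"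
  shows "Pr s (gapfree k j cs) = Pr s (gapfree k j ds)"
  using assms
proof (induction cs arbitrary: ds j)
  case (Cons c cs ds j)
  then obtain d ds' where ds: "ds = d # ds'" by (cases ds) auto
  have IH: "Pr s (gapfree k i cs) = Pr s (gapfree k i ds')" for i
    using Cons ds by auto
  have "card (fst c) = card (fst d)" "snd c = snd d" using Cons.prems(4) ds by auto
  thus ?case unfolding ds using Pr_gapfree_Cons[OF Cons.prems(1,3), of k j] Pr_gapfree_Cons[of d ds' s k j] Cons.prems(2,3) ds IH
    by simp
qed auto

lemma gapfree_map_iff:
  assumes "k \<ge> 1"
  shows "\<omega> \<in> gapfree k 0 (map (\<lambda>c. (f c, False)) [n..<m]) \<longleftrightarrow>
    (\<forall>i. n \<le> i \<longrightarrow> i + k \<le> m \<longrightarrow> (\<exists>c\<in>{i..<i+k}. \<omega> \<notin> all_empty (f c)))"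
proof -
  let ?bs = "map (\<lambda>c. \<omega> \<notin> all_empty (f c)) [n..<m]"
  have "\<omega> \<in> gapfree k 0 (map (\<lambda>c. (f c, False)) [n..<m]) \<longleftrightarrow> no_gap k 0 ?bs"
    by (simp add: gapfree_iff o_def)
  also have "\<dots> \<longleftrightarrow> (\<forall>i. i + k \<le> m - n \<longrightarrow> (\<exists>i'\<in>{i..<i+k}. ?bs ! i'))"
    using no_gap_iff[of 0 k ?bs] assms by simp
  also have "\<dots> \<longleftrightarrow> (\<forall>i. n \<le> i \<longrightarrow> i + k \<le> m \<longrightarrow> (\<exists>c\<in>{i..<i+k}. \<omega> \<notin> all_empty (f c)))" (is "?A \<longleftrightarrow> ?B")
  proof
    assume A: ?A
    show ?B
    proof (intro allI impI)
      fix i assume i: "n \<le> i" "i + k \<le> m"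
      hence "i - n + k \<le> m - n" by simp
      from A[rule_format, OF this] obtain i' where "i' \<in> {i-n..<i-n+k}" "?bs ! i'" by blast
      thus "\<exists>c\<in>{i..<i+k}. \<omega> \<notin> all_empty (f c)" using i by (intro bexI[of _ "i' + n"]) (auto simp: add.commute)
    qed
  next
    assume B: ?B
    show ?A
    proof (intro allI impI)
      fix i assume i: "i + k \<le> m - n"
      hence "n \<le> i + n" "i + n + k \<le> m" using assms by auto
      from B[rule_format, OF this] obtain c where "c \<in> {i+n..<i+n+k}" "\<omega> \<notin> all_empty (f c)" by blast
      thus "\<exists>i'\<in>{i..<i+k}. ?bs ! i'" using i by (intro bexI[of _ "c - n"]) auto
    qed
  qed
  finally show ?thesis .
qed

section \<open>Crossing events for columns and rows\<close>

definition vline :: "nat \<Rightarrow> nat \<Rightarrow> site set" where "vline c h = {int c} \<times> {0..<int h}"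
definition hline :: "nat \<Rightarrow> nat \<Rightarrow> site set" where "hline c h = {0..<int h} \<times> {int c}"
definition qbox :: "nat \<Rightarrow> nat \<Rightarrow> site set" where "qbox a b = {0..<int a} \<times> {0..<int b}"

definition lines :: "(nat \<Rightarrow> nat \<Rightarrow> site set) \<Rightarrow> bool" where
  "lines L \<longleftrightarrow> (\<forall>c h. finite (L c h) \<and> card (L c h) = h) \<and> (\<forall>c d h h'. c \<noteq> d \<longrightarrow> L c h \<inter> L d h' = {})
     \<and> (\<forall>c h h'. h \<le> h' \<longrightarrow> L c h \<subseteq> L c h')"

lemma linesD:
  assumes "lines L"
  shows "finite (L c h)" "card (L c h) = h" "c \<noteq> d \<Longrightarrow> L c h \<inter> L d h' = {}" "h \<le> h' \<Longrightarrow> L c h \<subseteq> L c h'"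
  using assms unfolding lines_def by simp_all

lemma lines_vline: "lines vline" and lines_hline: "lines hline"
  by (auto simp: lines_def vline_def hline_def)

text \<open>The last line has to be marked, so that growth stops exactly at \<open>m\<close>; the
  next event then starts from a full square and uses fresh sites only.\<close>

definition line_event :: "nat \<Rightarrow> (nat \<Rightarrow> nat \<Rightarrow> site set) \<Rightarrow> nat \<Rightarrow> nat \<Rightarrow> (nat \<Rightarrow> nat) \<Rightarrow> config set" where
  "line_event k L n m h = gapfree k 0 (map (\<lambda>c. (L c (h c), False)) [n..<m - 1]) \<inter> - all_empty (L (m - 1) (h (m - 1)))"

lemma line_event_iff:
  assumes "k \<ge> 1" "n < m"
  shows "\<omega> \<in> line_event k L n m h \<longleftrightarrow>
    (\<forall>i. n \<le> i \<longrightarrow> i < m \<longrightarrow> (\<exists>c. i \<le> c \<and> c < i + k \<and> c < m \<and> \<omega> \<notin> all_empty (L c (h c))))"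
  (is "_ \<longleftrightarrow> ?R")
proof
  assume a: "\<omega> \<in> line_event k L n m h"
  show ?R
  proof (intro allI impI)
    fix i assume i: "n \<le> i" "i < m"
    show "\<exists>c. i \<le> c \<and> c < i + k \<and> c < m \<and> \<omega> \<notin> all_empty (L c (h c))"
    proof (cases "i + k \<le> m - 1")
      case True
      thus ?thesis using a i gapfree_map_iff[OF assms(1), of \<omega> "\<lambda>c. L c (h c)" n "m - 1"]
        unfolding line_event_def by (fastforce simp: Ball_def)
    next
      case False
      thus ?thesis using a i unfolding line_event_def by (intro exI[of _ "m - 1"]) auto
    qed
  qed
next
  assume R: ?R
  have "\<exists>c\<in>{i..<i+k}. \<omega> \<notin> all_empty (L c (h c))" if "n \<le> i" "i + k \<le> m - 1" for i
    using R[rule_format, of i] that assms by fastforce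
  moreover have "n \<le> m - 1" "m - 1 < m" using assms by auto
  from R[rule_format, OF this] obtain c where "m - 1 \<le> c" "c < m" "\<omega> \<notin> all_empty (L c (h c))" by blast
  moreover from this have "c = m - 1" by simp
  ultimately show "\<omega> \<in> line_event k L n m h"
    unfolding line_event_def using gapfree_map_iff[OF assms(1), of \<omega> "\<lambda>c. L c (h c)" n "m - 1"] by auto
qed

lemma line_event_mono:
  assumes "k \<ge> 1" "n < m" "lines L" "\<And>c. h c \<le> h' c"
  shows "line_event k L n m h \<subseteq> line_event k L n m h'"
proof
  fix \<omega> assume "\<omega> \<in> line_event k L n m h"
  moreover have "\<omega> \<notin> all_empty (L c (h' c))" if "\<omega> \<notin> all_empty (L c (h c))" for c
    using that linesD(4)[OF assms(3) assms(4)[of c], of c] unfolding all_empty_def by auto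
  ultimately show "\<omega> \<in> line_event k L n m h'" unfolding line_event_iff[OF assms(1,2)] by blast
qed

lemma dep_line_event:
  assumes "n < m" "\<And>c. n \<le> c \<Longrightarrow> c < m \<Longrightarrow> L c (h c) \<subseteq> K"
  shows "dep K (line_event k L n m h)"
  unfolding line_event_def
proof (intro dep_Int dep_Compl)
  show "dep K (gapfree k 0 (map (\<lambda>c. (L c (h c), False)) [n..<m - 1]))"
    by (rule dep_mono[OF dep_gapfree]) (use assms(2) in \<open>fastforce simp: cells_def\<close>)
  show "dep K (all_empty (L (m - 1) (h (m - 1))))"
    by (rule dep_mono[OF dep_all_empty]) (use assms in auto)
qed

lemma Pr_line_event:
  assumes "lines L" "s \<ge> 0" "n < m"
  shows "Pr s (line_event k L n m h) =
    Pr s (gapfree k 0 (map (\<lambda>c. (L c (h c), False)) [n..<m - 1])) * (1 - exp (- (s * real (h (m - 1)))))"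
proof -
  have "Pr s (line_event k L n m h) =
    Pr s (gapfree k 0 (map (\<lambda>c. (L c (h c), False)) [n..<m - 1])) * Pr s (- all_empty (L (m - 1) (h (m - 1))))"
    unfolding line_event_def
  proof (rule Pr_indep[OF dep_gapfree dep_Compl[OF dep_all_empty]])
    have "L c (h c) \<inter> L (m - 1) (h (m - 1)) = {}" if "c < m - 1" for c
      using that linesD(3)[OF assms(1), of c "m - 1"] by simp
    thus "cells (map (\<lambda>c. (L c (h c), False)) [n..<m - 1]) \<inter> L (m - 1) (h (m - 1)) = {}"
      unfolding cells_def by fastforce
  qed
  also have "Pr s (- all_empty (L (m - 1) (h (m - 1)))) = 1 - exp (- (s * real (h (m - 1))))"
    using assms by (subst Pr_not_all_empty) (auto simp: lines_def)
  finally show ?thesis .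
qed

lemma disj_cells_lines: "lines L \<Longrightarrow> disj_cells (map (\<lambda>c. (L c (h c), t c)) [n..<m])"
  by (rule disj_cells_map) (auto simp: linesD)

lemma Pr_line_event_cong:
  assumes "lines L" "lines L'" "s \<ge> 0" "n < m"
  shows "Pr s (line_event k L n m h) = Pr s (line_event k L' n m h)"
proof -
  have "Pr s (gapfree k 0 (map (\<lambda>c. (L c (h c), False)) [n..<m - 1])) =
    Pr s (gapfree k 0 (map (\<lambda>c. (L' c (h c), False)) [n..<m - 1]))"
    by (rule Pr_gapfree_cong[OF disj_cells_lines disj_cells_lines]) (use assms in \<open>auto simp: lines_def\<close>)
  thus ?thesis using assms by (simp add: Pr_line_event)
qed

lemma Pr_line_event_lower:
  assumes "lines L" "s > 0" "n < m" "k \<ge> 1" "mono_on {n..<m} h" "h n \<ge> 1"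
  shows "Pr s (line_event k L n m h) \<ge>
    (1 - exp (- (s * real (h (m - 1))))) * exp (- (\<Sum>c=n..<m. gk k (s * real (h c))))"
proof -
  let ?cs = "map (\<lambda>c. (L c (h c), False)) [n..<m - 1]"
  have h1: "h c \<ge> 1" if "n \<le> c" "c < m" for c
    using mono_onD[OF assms(5), of n c] that assms(6) by auto
  have card: "card (L c x) = x" for c x using assms by (auto simp: lines_def)
  have "exp (- (\<Sum>c\<leftarrow>?cs. gk k (s * real (card (fst c))))) \<le> Pr s (gapfree k 0 ?cs)"
  proof (rule Pr_gapfree_lower[OF assms(4,2) disj_cells_lines[OF assms(1)]])
    have "sorted (map h [n..<m - 1])"
      using assms(5) by (auto simp: sorted_iff_nth_mono_less intro!: mono_onD[OF assms(5)])
    thus "sorted (map (\<lambda>c. card (fst c)) ?cs)" by (simp add: o_def card)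
    show "\<forall>c\<in>set ?cs. 1 \<le> card (fst c)" using h1 by (auto simp: card)
  qed simp
  also have "(\<Sum>c\<leftarrow>?cs. gk k (s * real (card (fst c)))) = (\<Sum>c=n..<m - 1. gk k (s * real (h c)))"
    by (simp add: o_def card sum_list_distinct_conv_sum_set)
  finally have 1: "exp (- (\<Sum>c=n..<m - 1. gk k (s * real (h c)))) \<le> Pr s (gapfree k 0 ?cs)" .
  have "(\<Sum>c=n..<m. gk k (s * real (h c))) = (\<Sum>c=n..<m - 1. gk k (s * real (h c))) + gk k (s * real (h (m - 1)))"
    using sum.atLeastLessThan_Suc[of n "m - 1" "\<lambda>c. gk k (s * real (h c))"] assms(3) by simp
  moreover have "gk k (s * real (h (m - 1))) \<ge> 0"
  proof -
    have "h (m - 1) \<ge> 1" using h1[of "m - 1"] assms(3) by linarith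
    hence "s * real (h (m - 1)) > 0" using assms(2) by (intro mult_pos_pos) auto
    thus ?thesis using gk_pos[OF assms(4)] less_imp_le by blast
  qed
  ultimately have "exp (- (\<Sum>c=n..<m. gk k (s * real (h c)))) \<le> exp (- (\<Sum>c=n..<m - 1. gk k (s * real (h c))))" by simp
  hence "exp (- (\<Sum>c=n..<m. gk k (s * real (h c)))) \<le> Pr s (gapfree k 0 ?cs)" using 1 by (rule order_trans)
  hence "(1 - exp (- (s * real (h (m - 1))))) * exp (- (\<Sum>c=n..<m. gk k (s * real (h c)))) \<le>
    (1 - exp (- (s * real (h (m - 1))))) * Pr s (gapfree k 0 ?cs)"
    using assms by (intro mult_left_mono) auto
  thus ?thesis using assms by (simp add: Pr_line_event mult.commute)
qed

text \<open>Growth along the diagonal. If the rectangle has \<open>a <= b\<close> columns and rows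
  and \<open>c < a + k\<close>, then \<open>c + 1 - k <= b\<close>, so this initial part of column
  \<open>c\<close> lies within the rows already active. The shortened columns lie below the diagonal
  and the rows above it, which makes the two families independent.\<close>

definition stage_event :: "nat \<Rightarrow> nat \<Rightarrow> nat \<Rightarrow> config set" where
  "stage_event k n m = line_event k vline n m (\<lambda>c. c + 1 - k) \<inter> line_event k hline n m (\<lambda>c. c + 1 - k)"

definition block_event :: "nat \<Rightarrow> nat \<Rightarrow> nat \<Rightarrow> config set" where
  "block_event k n m =
     (line_event k vline n m (\<lambda>_. n) \<inter> line_event k hline n m (\<lambda>_. m)) \<union>
     (line_event k hline n m (\<lambda>_. n) \<inter> line_event k vline n m (\<lambda>_. m))"

lemma dep_stage_event: assumes "n < m" "k \<ge> 1" shows "dep (qbox m m - qbox n n) (stage_event k n m)"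
  unfolding stage_event_def
  by (intro dep_Int dep_line_event) (use assms in \<open>auto simp: vline_def hline_def qbox_def\<close>)

lemma dep_block_event: assumes "n < m" shows "dep (qbox m m - qbox n n) (block_event k n m)"
  unfolding block_event_def
  by (intro dep_Int dep_Un dep_line_event) (use assms in \<open>auto simp: vline_def hline_def qbox_def\<close>)

lemma Pr_stage_event:
  assumes "s > 0" "1 \<le> k" "k \<le> n" "n < m"
  shows "Pr s (stage_event k n m) \<ge>
    (1 - exp (- (s * real (m - k))))\<^sup>2 * exp (- 2 * (\<Sum>c=n..<m. gk k (s * real (c + 1 - k))))"
proof -
  let ?h = "\<lambda>c. c + 1 - k"
  let ?S = "\<Sum>c=n..<m. gk k (s * real (c + 1 - k))"
  let ?a = "(1 - exp (- (s * real (m - k)))) * exp (- ?S)"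
  have "Pr s (stage_event k n m) = Pr s (line_event k vline n m ?h) * Pr s (line_event k hline n m ?h)"
    unfolding stage_event_def
  proof (rule Pr_indep)
    show "dep (\<Union>c\<in>{n..<m}. vline c (?h c)) (line_event k vline n m ?h)"
      by (rule dep_line_event) (use assms in auto)
    show "dep (\<Union>c\<in>{n..<m}. hline c (?h c)) (line_event k hline n m ?h)"
      by (rule dep_line_event) (use assms in auto)
  qed (use assms in \<open>auto simp: vline_def hline_def\<close>)
  moreover have "?a \<le> Pr s (line_event k L n m ?h)" if "lines L" for L
  proof -
    have "mono_on {n..<m} ?h" by (intro mono_onI) simp
    moreover have "?h n \<ge> 1" using assms by simp
    moreover have "m - 1 + 1 - k = m - k" using assms by simp
    ultimately show ?thesis using Pr_line_event_lower[OF that assms(1,4,2), of ?h] by simp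
  qed
  moreover have "?a \<ge> 0" using assms by simp
  ultimately have "?a * ?a \<le> Pr s (stage_event k n m)"
    using lines_vline lines_hline by (simp add: mult_mono)
  also have "?a * ?a = (1 - exp (- (s * real (m - k))))\<^sup>2 * exp (- 2 * ?S)"
    by (simp add: power2_eq_square mult_ac exp_add[symmetric])
  finally show ?thesis .
qed

text \<open>The two ways of crossing a block (columns first or rows first) have about the same
  probability, but both occur simultaneously only with a smaller probability: this is where the
  gain over the naive lower bound comes from.\<close>
lemma Pr_block_event:
  assumes "s > 0" "1 \<le> k" "1 \<le> n" "n < m"
  defines "u \<equiv> 1 - exp (- (s * real n))"
    and "a \<equiv> real (m - n) * gk k (s * real n)" and "b \<equiv> real (m - n) * gk k (s * real m)"
  shows "Pr s (block_event k n m) \<ge> u\<^sup>2 * exp (- a - b) * (2 - exp (- (a - b)))"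
proof -
  interpret prob_space "config_measure s" by (rule prob_space_config)
  let ?C = "\<lambda>h. line_event k vline n m (\<lambda>_. h)" and ?R = "\<lambda>h. line_event k hline n m (\<lambda>_. h)"
  define \<alpha> \<beta> where "\<alpha> = Pr s (?C n)" and "\<beta> = Pr s (?C m)"
  define A B where "A = u * exp (- a)" and "B = u * exp (- b)"
  have R: "Pr s (?R h) = Pr s (?C h)" for h
    by (rule Pr_line_event_cong) (use assms lines_vline lines_hline in auto)
  have up: "u \<ge> 0" using assms by (simp add: u_def)
  have ind: "Pr s (?C h \<inter> ?R h') = Pr s (?C h) * Pr s (?C h')" if "h \<le> n \<or> h' \<le> n" for h h'
  proof -
    have "Pr s (?C h \<inter> ?R h') = Pr s (?C h) * Pr s (?R h')"
    proof (rule Pr_indep)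
      show "dep (\<Union>c\<in>{n..<m}. vline c h) (?C h)" by (rule dep_line_event) (use assms in auto)
      show "dep (\<Union>c\<in>{n..<m}. hline c h') (?R h')" by (rule dep_line_event) (use assms in auto)
    qed (use that in \<open>auto simp: vline_def hline_def\<close>)
    thus ?thesis by (simp add: R)
  qed
  have ev: "?C h \<in> cevents" "?R h \<in> cevents" for h
    by (rule dep_events[of UNIV], rule dep_line_event, use assms in auto)+
  have low: "Pr s (?C h) \<ge> u * exp (- (real (m - n) * gk k (s * real h)))" if "h \<ge> n" for h
  proof -
    have "u * exp (- (real (m - n) * gk k (s * real h))) \<le> (1 - exp (- (s * real h))) * exp (- (\<Sum>c=n..<m. gk k (s * real h)))"
      using that assms by (intro mult_mono) (auto simp: u_def)
    also have "\<dots> \<le> Pr s (?C h)"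
      using Pr_line_event_lower[OF lines_vline assms(1,4,2), of "\<lambda>_. h"] that assms by (simp add: mono_on_def)
    finally show ?thesis .
  qed
  have A: "A \<le> \<alpha>" "B \<le> \<beta>" using low[of n] low[of m] assms unfolding A_def B_def \<alpha>_def \<beta>_def a_def b_def by auto
  have "\<alpha> \<le> \<beta>" unfolding \<alpha>_def \<beta>_def
    by (intro Pr_mono line_event_mono ev) (use assms lines_vline in auto)
  have "Pr s (block_event k n m) = Pr s (?C n \<inter> ?R m) + Pr s (?R n \<inter> ?C m) - Pr s ((?C n \<inter> ?R m) \<inter> (?R n \<inter> ?C m))"
    unfolding block_event_def using ev by (intro measure_Un3) (auto simp: sets_config fmeasurable_eq_sets)
  \<comment> \<open>Both crossings together contain the crossing by short columns and by short rows,
    and these two are independent; so the overlap costs at most the square of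
    \<open>Pr s (?C n)\<close>.\<close>
  moreover have "Pr s ((?C n \<inter> ?R m) \<inter> (?R n \<inter> ?C m)) \<le> Pr s (?C n \<inter> ?R n)"
    using ev by (intro Pr_mono) auto
  moreover have "Pr s (?R n \<inter> ?C m) = Pr s (?C m \<inter> ?R n)" by (simp add: Int_commute)
  ultimately have "Pr s (block_event k n m) \<ge> \<alpha> * \<beta> + \<beta> * \<alpha> - \<alpha> * \<alpha>"
    using ind[of n m] ind[of m n] ind[of n n] by (simp add: \<alpha>_def \<beta>_def)
  \<comment> \<open>Only lower bounds for the two probabilities are known. The expression increases
    in \<open>\<alpha>\<close> as long as \<open>\<alpha> \<le> \<beta>\<close>, so \<open>A\<close>
    may be substituted.\<close>
  moreover have "2 * A * \<beta> - A * A \<le> \<alpha> * \<beta> + \<beta> * \<alpha> - \<alpha> * \<alpha>"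
  proof -
    have "0 \<le> (\<alpha> - A) * (2 * \<beta> - \<alpha> - A)" using A \<open>\<alpha> \<le> \<beta>\<close> by (intro mult_nonneg_nonneg) auto
    thus ?thesis by (simp add: algebra_simps)
  qed
  moreover have "2 * A * B \<le> 2 * A * \<beta>" using A up by (intro mult_left_mono) (auto simp: A_def)
  ultimately have "2 * A * B - A * A \<le> Pr s (block_event k n m)" by linarith
  moreover have "2 * A * B - A * A = u\<^sup>2 * exp (- a - b) * (2 - exp (- (a - b)))"
    unfolding A_def B_def by (simp add: power2_eq_square algebra_simps exp_add[symmetric])
  ultimately show ?thesis by simp
qed

text \<open>The four sides, without corners, of the layer around the box enlarged by
  \<open>j\<close> in every direction; each has \<open>N + 2 * j\<close> sites. Growth to the left
  and downwards takes place only in this final phase.\<close>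

definition ring_line :: "nat \<Rightarrow> nat \<Rightarrow> nat \<Rightarrow> site set" where
  "ring_line N j i = (if i = 0 then {int (N + j)} \<times> {- int j..<int (N + j)}
    else if i = 1 then {- int j - 1} \<times> {- int j..<int (N + j)}
    else if i = 2 then {- int j..<int (N + j)} \<times> {int (N + j)}
    else {- int j..<int (N + j)} \<times> {- int j - 1})"

definition final_event :: "nat \<Rightarrow> config set" where
  "final_event N = (\<Inter>j. \<Inter>i\<in>{0,1,2,3}. - all_empty (ring_line N j i))"

lemma dep_final_event: "dep (- qbox N N) (final_event N)"
  unfolding final_event_def
proof (intro dep_INT countableI_type dep_Compl)
  fix j and i :: nat assume "i \<in> {0,1,2,3}"
  show "dep (- qbox N N) (all_empty (ring_line N j i))"
    by (rule dep_mono[OF dep_all_empty]) (auto simp: ring_line_def qbox_def)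
qed

lemma Pr_final_event:
  assumes "s > 0" shows "Pr s (final_event N) \<ge> 1 - 4 * exp (- (s * real N)) / (1 - exp (- (2 * s)))"
proof -
  interpret prob_space "config_measure s" by (rule prob_space_config)
  let ?E = "\<lambda>j. \<Union>i\<in>{0,1,2,3}. all_empty (ring_line N j i)"
  let ?q = "exp (- (2 * s))"
  have ev: "all_empty K \<in> sets (config_measure s)" for K using dep_events[OF dep_all_empty] by (simp add: sets_config)
  have c: "finite (ring_line N j i)" "card (ring_line N j i) = N + 2 * j" for j i
    by (auto simp: ring_line_def)
  have one: "Pr s (?E j) \<le> 4 * exp (- (s * real N)) * ?q ^ j" for j
  proof -
    have "Pr s (?E j) \<le> (\<Sum>i\<in>{0,1,2,3}. Pr s (all_empty (ring_line N j i)))"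
      by (intro finite_measure_subadditive_finite) (use ev in auto)
    also have "\<dots> = 4 * exp (- (s * real (N + 2 * j)))"
      using Pr_all_empty[of s "ring_line N j _"] c assms by simp
    also have "\<dots> = 4 * exp (- (s * real N)) * ?q ^ j"
      by (simp add: exp_of_nat_mult[symmetric] exp_add[symmetric] algebra_simps)
    finally show ?thesis .
  qed
  have g: "(\<lambda>j. 4 * exp (- (s * real N)) * ?q ^ j) sums (4 * exp (- (s * real N)) * (1 / (1 - ?q)))"
    by (intro sums_mult geometric_sums) (use assms in auto)
  have sm: "summable (\<lambda>j. Pr s (?E j))"
    by (rule summable_comparison_test'[OF sums_summable[OF g]]) (use one in auto)
  have "Pr s (\<Union>j. ?E j) \<le> (\<Sum>j. Pr s (?E j))"
    by (rule finite_measure_subadditive_countably) (use ev sm in auto)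
  also have "\<dots> \<le> (\<Sum>j. 4 * exp (- (s * real N)) * ?q ^ j)"
    by (rule suminf_le[OF one sm sums_summable[OF g]])
  also have "\<dots> = 4 * exp (- (s * real N)) / (1 - ?q)" using g by (simp add: sums_iff)
  finally have "Pr s (\<Union>j. ?E j) \<le> 4 * exp (- (s * real N)) / (1 - ?q)" .
  moreover have "(\<Union>j. ?E j) = - final_event N" by (auto simp: final_event_def)
  ultimately show ?thesis using Pr_Compl[OF dep_events[OF dep_final_event], of s N] by simp
qed

section \<open>Growth of boxes inside a closed set\<close>

context closed_active
begin

lemma qbox_rect: "qbox a b = rect 0 (int a - 1) 0 (int b - 1)"
  by (auto simp: qbox_def rect_def)

lemma grow_right:
  assumes "qbox a b \<subseteq> A" "reach M \<le> int a" "a \<le> c" "c < a + model_k M" "0 \<le> y" "y < int b" "\<omega> (int c, y)"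
  shows "qbox (Suc c) b \<subseteq> A"
  using fill_right[of 0 "int a - 1" 0 "int b - 1" y "int c"] assms unfolding qbox_rect by auto

lemma grow_up:
  assumes "qbox a b \<subseteq> A" "reach M \<le> int b" "b \<le> c" "c < b + model_k M" "0 \<le> x" "x < int a" "\<omega> (x, int c)"
  shows "qbox a (Suc c) \<subseteq> A"
  using fill_up[of 0 "int a - 1" 0 "int b - 1" x "int c"] assms unfolding qbox_rect by auto

lemma grow_columns:
  assumes "qbox a b \<subseteq> A" "reach M \<le> int a" "a \<le> m"
    and "\<And>i. a \<le> i \<Longrightarrow> i < m \<Longrightarrow> \<exists>c. i \<le> c \<and> c < i + model_k M \<and> c < m \<and> \<omega> \<notin> all_empty (vline c b)"
  shows "qbox m b \<subseteq> A"
  using assms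
proof (induction "m - a" arbitrary: a rule: less_induct)
  case less
  show ?case
  proof (cases "a = m")
    case False
    with less.prems(3) less.prems(4)[of a] obtain c y where c: "a \<le> c" "c < a + model_k M" "c < m" "0 \<le> y" "y < int b" "\<omega> (int c, y)"
      by (auto simp: all_empty_def vline_def)
    show ?thesis
    proof (rule less.hyps[of "Suc c"])
      show "qbox (Suc c) b \<subseteq> A" by (rule grow_right[OF less.prems(1,2) c(1,2,4-6)])
    qed (use c less.prems in auto)
  qed (use less.prems in simp)
qed

lemma grow_rows:
  assumes "qbox a b \<subseteq> A" "reach M \<le> int b" "b \<le> m"
    and "\<And>i. b \<le> i \<Longrightarrow> i < m \<Longrightarrow> \<exists>c. i \<le> c \<and> c < i + model_k M \<and> c < m \<and> \<omega> \<notin> all_empty (hline c a)"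
  shows "qbox a m \<subseteq> A"
  using assms
proof (induction "m - b" arbitrary: b rule: less_induct)
  case less
  show ?case
  proof (cases "b = m")
    case False
    with less.prems(3) less.prems(4)[of b] obtain c y where c: "b \<le> c" "c < b + model_k M" "c < m" "0 \<le> y" "y < int a" "\<omega> (y, int c)"
      by (auto simp: all_empty_def hline_def)
    show ?thesis
    proof (rule less.hyps[of "Suc c"])
      show "qbox a (Suc c) \<subseteq> A" by (rule grow_up[OF less.prems(1,2) c(1,2,4-6)])
    qed (use c less.prems in auto)
  qed (use less.prems in simp)
qed

lemma grow_block:
  assumes "qbox n n \<subseteq> A" "reach M \<le> int n" "n < m" "\<omega> \<in> block_event (model_k M) n m"
  shows "qbox m m \<subseteq> A"
proof -
  note iff = line_event_iff[OF k_pos assms(3)]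
  from assms(4) consider
    "\<omega> \<in> line_event (model_k M) vline n m (\<lambda>_. n)" "\<omega> \<in> line_event (model_k M) hline n m (\<lambda>_. m)"
  | "\<omega> \<in> line_event (model_k M) hline n m (\<lambda>_. n)" "\<omega> \<in> line_event (model_k M) vline n m (\<lambda>_. m)"
    by (auto simp: block_event_def)
  thus ?thesis
  proof cases
    case 1
    have "qbox m n \<subseteq> A" using grow_columns[OF assms(1,2), of m] 1(1) assms(3) unfolding iff by auto
    from grow_rows[OF this assms(2), of m] show ?thesis using 1(2) assms(3) unfolding iff by auto
  next
    case 2
    have "qbox n m \<subseteq> A" using grow_rows[OF assms(1,2), of m] 2(1) assms(3) unfolding iff by auto
    from grow_columns[OF this assms(2), of m] show ?thesis using 2(2) assms(3) unfolding iff by auto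
  qed
qed

lemma grow_stage:
  assumes "qbox n n \<subseteq> A" "reach M \<le> int n" "model_k M \<le> n" "n < m" "\<omega> \<in> stage_event (model_k M) n m"
  shows "qbox m m \<subseteq> A"
proof -
  note iff = line_event_iff[OF k_pos assms(4)]
  have C: "\<exists>c. i \<le> c \<and> c < i + model_k M \<and> c < m \<and> \<omega> \<notin> all_empty (vline c (c + 1 - model_k M))" if "n \<le> i" "i < m" for i
    using assms(5) that unfolding stage_event_def iff Int_iff by blast
  have R: "\<exists>c. i \<le> c \<and> c < i + model_k M \<and> c < m \<and> \<omega> \<notin> all_empty (hline c (c + 1 - model_k M))" if "n \<le> i" "i < m" for i
    using assms(5) that unfolding stage_event_def iff Int_iff by blast
  \<comment> \<open>The shorter direction is always extended next, a column if \<open>a <= b\<close>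
    and a row otherwise. This keeps the initial segments of length \<open>c + 1 - k\<close> beside
    the rectangle.\<close>
  have "qbox a b \<subseteq> A \<Longrightarrow> n \<le> a \<Longrightarrow> a \<le> m \<Longrightarrow> n \<le> b \<Longrightarrow> b \<le> m \<Longrightarrow> qbox m m \<subseteq> A" for a b
  proof (induction "2 * m - a - b" arbitrary: a b rule: less_induct)
    case less
    show ?case
    proof (cases "a = m \<and> b = m")
      case False
      show ?thesis
      proof (cases "a \<le> b")
        case True
        hence "a < m" using False less.prems by auto
        with C[of a] less.prems obtain c y where c: "a \<le> c" "c < a + model_k M" "c < m" "0 \<le> y" "y < int (c + 1 - model_k M)" "\<omega> (int c, y)"
          by (auto simp: all_empty_def vline_def)
        have "qbox (Suc c) b \<subseteq> A"
          by (rule grow_right[OF less.prems(1) _ c(1,2,4) _ c(6)]) (use less.prems assms c True in auto)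
        thus ?thesis using less.hyps[of "Suc c" b] c less.prems True by auto
      next
        case f: False
        with R[of b] less.prems obtain c y where c: "b \<le> c" "c < b + model_k M" "c < m" "0 \<le> y" "y < int (c + 1 - model_k M)" "\<omega> (y, int c)"
          by (auto simp: all_empty_def hline_def)
        have "qbox a (Suc c) \<subseteq> A"
          by (rule grow_up[OF less.prems(1) _ c(1,2,4) _ c(6)]) (use less.prems assms c f in auto)
        thus ?thesis using less.hyps[of a "Suc c"] c less.prems f by auto
      qed
    qed (use less.prems in simp)
  qed
  from this[of n n] show ?thesis using assms by auto
qed

lemma grow_final:
  assumes "qbox N N \<subseteq> A" "reach M \<le> int N" "\<omega> \<in> final_event N"
  shows "A = UNIV"
proof -
  have N: "N \<ge> 1" using assms(2) by (auto simp: reach_def)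
  let ?S = "\<lambda>j. rect (- int j) (int (N + j) - 1) (- int j) (int (N + j) - 1)"
  have S: "?S j \<subseteq> A" for j
  proof (induction j)
    case 0 thus ?case using assms(1) by (simp add: qbox_rect)
  next
    case (Suc j)
    let ?l = "- int j" and ?r = "int (N + j) - 1"
    have hit: "\<exists>x\<in>ring_line N j i. \<omega> x" if "i \<in> {0,1,2,3}" for i
      using assms(3) that unfolding final_event_def all_empty_def by blast
    obtain y0 where y0: "?l \<le> y0" "y0 \<le> ?r" "\<omega> (?r + 1, y0)" using hit[of 0] by (auto simp: ring_line_def)
    obtain y1 where y1: "?l \<le> y1" "y1 \<le> ?r" "\<omega> (?l - 1, y1)" using hit[of 1] by (auto simp: ring_line_def)
    obtain x0 where x0: "?l \<le> x0" "x0 \<le> ?r" "\<omega> (x0, ?r + 1)" using hit[of 2] by (auto simp: ring_line_def)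
    obtain x1 where x1: "?l \<le> x1" "x1 \<le> ?r" "\<omega> (x1, ?l - 1)" using hit[of 3] by (auto simp: ring_line_def)
    have "rect ?l (?r + 1) ?l ?r \<subseteq> A"
      by (rule fill_right[OF Suc _ y0(1,2) _ _ y0(3)]) (use assms k_pos in auto)
    hence "rect (?l - 1) (?r + 1) ?l ?r \<subseteq> A"
      by (rule fill_left[OF _ _ y1(1,2) _ _ y1(3)]) (use assms k_pos in auto)
    hence "rect (?l - 1) (?r + 1) ?l (?r + 1) \<subseteq> A"
      by (rule fill_up[OF _ _ _ _ _ _ x0(3)]) (use assms k_pos x0 in auto)
    hence "rect (?l - 1) (?r + 1) (?l - 1) (?r + 1) \<subseteq> A"
      by (rule fill_down[OF _ _ _ _ _ _ x1(3)]) (use assms k_pos x1 in auto)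
    moreover have "?l - 1 = - int (Suc j)" "?r + 1 = int (N + Suc j) - 1" by auto
    ultimately show ?case by (simp only:)
  qed
  have "x \<in> A" for x
  proof -
    have "x \<in> ?S (nat (max \<bar>fst x\<bar> \<bar>snd x\<bar>))" using N by (cases x) (auto simp: rect_def)
    thus ?thesis using S by blast
  qed
  thus ?thesis by auto
qed

lemma occupied_box_active:
  assumes "init_active \<omega> \<subseteq> A" "\<omega> \<in> all_occ (qbox n n)"
  shows "qbox n n \<subseteq> A"
proof (cases "n = 0")
  case False
  have occ: "\<omega> (x, y)" if "0 \<le> x" "x < int n" "0 \<le> y" "y < int n" for x y
    using assms(2) that by (auto simp: all_occ_def qbox_def)
  have 0: "(0,0) \<in> A" using occ[of 0 0] False assms(1) by (auto simp: init_active_def)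
  have bottom: "i < n \<Longrightarrow> (int i, 0) \<in> A" for i
  proof (induction i)
    case (Suc i)
    thus ?case using active_near[of "(int i, 0)" "(int (Suc i), 0)"] occ k_pos by (auto simp: l1dist_def)
  qed (use 0 in auto)
  have "j < n \<Longrightarrow> i < n \<Longrightarrow> (int i, int j) \<in> A" for i j
  proof (induction j)
    case (Suc j)
    thus ?case using active_near[of "(int i, int j)" "(int i, int (Suc j))"] occ k_pos by (auto simp: l1dist_def)
  qed (use bottom in auto)
  hence "(x, y) \<in> A" if "0 \<le> x" "x < int n" "0 \<le> y" "y < int n" for x y
    using that by (metis nat_0_le nat_less_iff)
  thus ?thesis by (auto simp: qbox_def)
qed (simp add: qbox_def)

end

section \<open>The growth scenario and its probability\<close>

definition growth_event :: "nat \<Rightarrow> nat \<Rightarrow> nat \<Rightarrow> nat \<Rightarrow> nat \<Rightarrow> config set" where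
  "growth_event k n m J N = all_occ (qbox k k) \<inter> stage_event k k n \<inter>
     (\<Inter>i<J. block_event k (n + i * m) (n + Suc i * m)) \<inter> stage_event k (n + J * m) N \<inter> final_event N"

lemma growth_event_subset:
  assumes "valid_model M" "model_k M < n" "m \<ge> 1" "n + J * m < N"
  shows "growth_event (model_k M) n m J N \<subseteq> indefinite_growth M"
proof
  let ?k = "model_k M"
  fix \<omega> assume \<omega>: "\<omega> \<in> growth_event ?k n m J N"
  have "A = UNIV" if "init_active \<omega> \<subseteq> A" "closed_under M \<omega> A" for A
  proof -
    interpret closed_active M \<omega> A using assms that by unfold_locales auto
    have rk: "reach M \<le> int ?k" using k_pos by (auto simp: reach_def)
    have rn: "reach M \<le> int (n + i)" for i using rk assms(2) by simp
    have 0: "qbox n n \<subseteq> A"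
      by (rule grow_stage[OF occupied_box_active[OF that(1)] rk _ assms(2)])
         (use \<omega> in \<open>auto simp: growth_event_def\<close>)
    have "i \<le> J \<Longrightarrow> qbox (n + i * m) (n + i * m) \<subseteq> A" for i
    proof (induction i)
      case (Suc i)
      have "\<omega> \<in> block_event ?k (n + i * m) (n + Suc i * m)" using \<omega> Suc.prems by (auto simp: growth_event_def)
      from grow_block[OF Suc.IH rn _ this] show ?case using Suc.prems assms(3) by simp
    qed (use 0 in simp)
    hence 1: "qbox (n + J * m) (n + J * m) \<subseteq> A" by simp
    have 2: "qbox N N \<subseteq> A"
      by (rule grow_stage[OF 1 rn]) (use assms \<omega> in \<open>auto simp: growth_event_def\<close>)
    show ?thesis by (rule grow_final[OF 2]) (use rk assms \<omega> in \<open>auto simp: growth_event_def\<close>)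
  qed
  hence "final_active M \<omega> = UNIV" unfolding final_active_def by blast
  thus "\<omega> \<in> indefinite_growth M" by (simp add: indefinite_growth_def)
qed

lemma qbox_mono: "a \<le> b \<Longrightarrow> qbox a a \<subseteq> qbox b b"
  by (auto simp: qbox_def)

lemma Pr_qbox_chain:
  assumes "dep (qbox n n) E" "dep (qbox m m - qbox n n) F" "n \<le> m"
  shows "Pr s (E \<inter> F) = Pr s E * Pr s F" "dep (qbox m m) (E \<inter> F)"
  using Pr_indep[OF assms(1,2)] dep_Int[OF dep_mono[OF assms(1) qbox_mono[OF assms(3)]] dep_mono[OF assms(2)]]
  by auto

text \<open>Every factor is determined by the shell between two consecutive boxes, and the last one
  by the outside of the largest box, so the probabilities multiply.\<close>

lemma Pr_growth_event:
  assumes "s \<ge> 0" "1 \<le> k" "k < n" "m \<ge> 1" "n + J * m < N"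
  shows "Pr s (growth_event k n m J N) = (1 - exp (- s)) ^ (k * k) * Pr s (stage_event k k n) *
    (\<Prod>i<J. Pr s (block_event k (n + i * m) (n + Suc i * m))) * Pr s (stage_event k (n + J * m) N) * Pr s (final_event N)"
proof -
  let ?B = "\<lambda>i. block_event k (n + i * m) (n + Suc i * m)"
  let ?E0 = "all_occ (qbox k k)" let ?E1 = "?E0 \<inter> stage_event k k n"
  have fb: "finite (qbox k k)" "card (qbox k k) = k * k" by (auto simp: qbox_def)
  have 0: "Pr s ?E0 = (1 - exp (- s)) ^ (k * k)" "dep (qbox k k) ?E0"
    using Pr_all_occ[OF assms(1) fb(1)] fb(2) dep_all_occ by auto
  have 1: "Pr s ?E1 = Pr s ?E0 * Pr s (stage_event k k n)" "dep (qbox n n) ?E1"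
    using Pr_qbox_chain[OF 0(2) dep_stage_event] assms by auto
  have 2: "Pr s (?E1 \<inter> (\<Inter>i<j. ?B i)) = Pr s ?E1 * (\<Prod>i<j. Pr s (?B i)) \<and>
    dep (qbox (n + j * m) (n + j * m)) (?E1 \<inter> (\<Inter>i<j. ?B i))" for j
  proof (induction j)
    case (Suc j)
    have e: "?E1 \<inter> (\<Inter>i<Suc j. ?B i) = (?E1 \<inter> (\<Inter>i<j. ?B i)) \<inter> ?B j" by (auto simp: lessThan_Suc)
    have d: "dep (qbox (n + Suc j * m) (n + Suc j * m) - qbox (n + j * m) (n + j * m)) (?B j)"
      by (rule dep_block_event) (use assms in auto)
    show ?case unfolding e using Pr_qbox_chain[OF conjunct2[OF Suc] d] Suc by auto
  qed (use 1 in auto)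
  let ?E2 = "?E1 \<inter> (\<Inter>i<J. ?B i)"
  have 3: "Pr s (?E2 \<inter> stage_event k (n + J * m) N) = Pr s ?E2 * Pr s (stage_event k (n + J * m) N)"
    "dep (qbox N N) (?E2 \<inter> stage_event k (n + J * m) N)"
    using Pr_qbox_chain[OF conjunct2[OF 2[of J]] dep_stage_event] assms by auto
  have "Pr s (growth_event k n m J N) = Pr s (?E2 \<inter> stage_event k (n + J * m) N) * Pr s (final_event N)"
    unfolding growth_event_def by (rule Pr_indep[OF 3(2) dep_final_event]) auto
  thus ?thesis using 0(1) 1(1) 2[of J] 3(1) by simp
qed

section \<open>Comparing sums of \<open>g\<close> with its integral\<close>

lemma Gam_mvt:
  assumes "k \<ge> 1" "0 < x" "x \<le> y"
  shows "(y - x) * gk k y \<le> Gam k x - Gam k y" "Gam k x - Gam k y \<le> (y - x) * gk k x"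
proof -
  have "(y - x) * gk k y \<le> Gam k x - Gam k y \<and> Gam k x - Gam k y \<le> (y - x) * gk k x"
  proof (cases "x = y")
    case False
    hence "x < y" using assms by simp
    from MVT2[OF this, of "Gam k" "\<lambda>z. - gk k z"] Gam_deriv[OF assms(1)] assms
    obtain z where z: "x < z" "z < y" "Gam k y - Gam k x = (y - x) * (- gk k z)" by auto
    have "gk k y \<le> gk k z" "gk k z \<le> gk k x" using z assms by (auto intro!: gk_anti)
    hence "(y - x) * gk k y \<le> (y - x) * gk k z" "(y - x) * gk k z \<le> (y - x) * gk k x"
      using \<open>x < y\<close> by (auto intro!: mult_left_mono)
    thus ?thesis using z(3) by simp
  qed simp
  thus "(y - x) * gk k y \<le> Gam k x - Gam k y" "Gam k x - Gam k y \<le> (y - x) * gk k x" by auto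
qed

lemma gk_sum_le:
  assumes "k \<ge> 1" "s > 0" "1 \<le> a"
  shows "(\<Sum>i=a..<a+d. gk k (s * real (Suc i))) \<le> (Gam k (s * real a) - Gam k (s * real (a + d))) / s"
proof (induction d)
  case (Suc d)
  have "(s * real (Suc (a + d)) - s * real (a + d)) * gk k (s * real (Suc (a + d))) \<le>
    Gam k (s * real (a + d)) - Gam k (s * real (Suc (a + d)))"
    using assms by (intro Gam_mvt) auto
  hence "gk k (s * real (Suc (a + d))) \<le> (Gam k (s * real (a + d)) - Gam k (s * real (Suc (a + d)))) / s"
    using assms by (simp add: field_simps)
  thus ?case using Suc by (simp add: diff_divide_distrib)
qed simp

text \<open>The midpoint rule underestimates the integral of a convex function: as a function of the
  half-width \<open>t\<close> the difference has derivative
  \<open>g (x - t) + g (x + t) - 2 * g x\<close>.\<close>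

lemma gk_midpoint:
  assumes "k \<ge> 1" "h \<ge> 0" "h / 2 < x"
  shows "h * gk k x \<le> Gam k (x - h / 2) - Gam k (x + h / 2)"
proof -
  let ?F = "\<lambda>t. Gam k (x - t) - Gam k (x + t) - 2 * t * gk k x"
  have "?F 0 \<le> ?F (h / 2)"
  proof (rule DERIV_nonneg_imp_nondecreasing[where f = ?F and a = 0 and b = "h / 2"])
    fix t assume t: "0 \<le> t" "t \<le> h / 2"
    have p: "x - t > 0" "x + t > 0" using t assms by auto
    have "((\<lambda>t. Gam k (x - t)) has_real_derivative - gk k (x - t) * (- 1)) (at t)"
      by (rule DERIV_chain2[where f = "Gam k" and g = "\<lambda>t. x - t", OF Gam_deriv[OF assms(1) p(1)]]) (auto intro!: derivative_eq_intros)
    moreover have "((\<lambda>t. Gam k (x + t)) has_real_derivative - gk k (x + t) * 1) (at t)"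
      by (rule DERIV_chain2[where f = "Gam k" and g = "\<lambda>t. x + t", OF Gam_deriv[OF assms(1) p(2)]]) (auto intro!: derivative_eq_intros)
    moreover have "((\<lambda>t. 2 * t * gk k x) has_real_derivative 2 * gk k x) (at t)"
      by (auto intro!: derivative_eq_intros)
    ultimately have d: "(?F has_real_derivative - gk k (x - t) * (- 1) - - gk k (x + t) * 1 - 2 * gk k x) (at t)"
      by (intro DERIV_diff)
    have "gk k ((1 - 1/2) *\<^sub>R (x - t) + (1/2) *\<^sub>R (x + t)) \<le> (1 - 1/2) * gk k (x - t) + 1/2 * gk k (x + t)"
      using p by (intro convex_onD[OF gk_convex[OF assms(1)]]) auto
    moreover have "(1 - 1/2) *\<^sub>R (x - t) + (1/2) *\<^sub>R (x + t) = x" by (simp add: field_simps)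
    ultimately have "- gk k (x - t) * (- 1) - - gk k (x + t) * 1 - 2 * gk k x \<ge> 0" by simp
    with d show "\<exists>y. (?F has_real_derivative y) (at t) \<and> 0 \<le> y" by blast
  qed (use assms in simp)
  thus ?thesis by simp
qed

text \<open>The midpoint bound around each node gives the integral over an interval longer by
  \<open>h / 2\<close> at both ends; the end terms of the trapezoidal sum compensate up to an error
  quadratic in \<open>h\<close>. A one-sided sum would have an error linear in \<open>h\<close>, for
  \<open>h\<close> of order \<open>sqrt s\<close> as large as the gain.\<close>

lemma gk_trapezoid:
  assumes "k \<ge> 1" "h > 0" "h / 2 < x"
  shows "(\<Sum>i<J. h * (gk k (x + real i * h) + gk k (x + real (Suc i) * h))) \<le>
    2 * (Gam k x - Gam k (x + real J * h)) + h * (gk k (x - h / 2) - gk k x)"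
proof -
  let ?x = "\<lambda>i. x + real i * h"
  have xp: "?x i > h / 2" for i
  proof -
    have "real i * h \<ge> 0" using assms by simp
    thus ?thesis using assms(3) by linarith
  qed
  have "(\<Sum>i<J. h * (gk k (?x i) + gk k (?x (Suc i)))) \<le>
    2 * (Gam k (x - h / 2) - Gam k (?x J + h / 2)) - h * gk k x - h * gk k (?x J)"
  proof (induction J)
    case 0
    show ?case using gk_midpoint[OF assms(1) less_imp_le[OF assms(2)] assms(3)] by simp
  next
    case (Suc J)
    have "?x (Suc J) - h / 2 = ?x J + h / 2" by (simp add: algebra_simps)
    from gk_midpoint[OF assms(1) less_imp_le[OF assms(2)] xp[of "Suc J"]]
    have "h * gk k (?x (Suc J)) \<le> Gam k (?x J + h / 2) - Gam k (?x (Suc J) + h / 2)"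
      unfolding \<open>?x (Suc J) - h / 2 = ?x J + h / 2\<close> .
    thus ?case using Suc by (simp add: distrib_left)
  qed
  moreover have "Gam k (x - h / 2) - Gam k x \<le> (h / 2) * gk k (x - h / 2)"
    using Gam_mvt(2)[OF assms(1), of "x - h / 2" x] assms by simp
  moreover have "Gam k (?x J) - Gam k (?x J + h / 2) \<le> (h / 2) * gk k (?x J)"
    using Gam_mvt(2)[OF assms(1), of "?x J" "?x J + h / 2"] xp[of J] assms by simp
  ultimately show ?thesis by (simp add: algebra_simps)
qed

text \<open>Both chords are compared with the chord from \<open>x\<close> to
  \<open>y + h'\<close>.\<close>

lemma gk_slope:
  assumes "k \<ge> 1" "0 < x" "0 < h" "0 < h'" "x \<le> y" "x + h \<le> y + h'"
  shows "(gk k y - gk k (y + h')) / h' \<le> (gk k x - gk k (x + h)) / h"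
proof -
  note C = gk_convex[OF assms(1)]
  have "(gk k (x + h) - gk k x) / h \<le> (gk k (y + h') - gk k x) / (y + h' - x)"
  proof (cases "x + h = y + h'")
    case False
    have "(gk k x - gk k (x + h)) / (x - (x + h)) \<le> (gk k x - gk k (y + h')) / (x - (y + h'))"
      by (rule convex_on_slope_le[OF C]) (use assms False in auto)
    thus ?thesis using assms by (simp add: field_simps)
  qed (metis add_diff_cancel_left' order_refl)
  also have "\<dots> \<le> (gk k (y + h') - gk k y) / h'"
  proof (cases "x = y")
    case False
    have "(gk k x - gk k (y + h')) / (x - (y + h')) \<le> (gk k y - gk k (y + h')) / (y - (y + h'))"
      by (rule convex_on_slope_le[OF C]) (use assms False in auto)
    thus ?thesis using assms by (simp add: field_simps)
  qed simp
  finally show ?thesis using assms by (simp add: field_simps)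
qed

lemma exp_neg_small: "exp (- 1) \<le> (1 / 2 :: real)" "exp (- 3) \<le> (1 / 8 :: real)"
proof -
  show 1: "exp (- 1) \<le> (1 / 2 :: real)"
    using exp_ge_add_one_self[of "1::real"] by (simp add: exp_minus field_simps)
  have "exp (- 3) = (exp (- 1) :: real) ^ 3" by (simp add: exp_of_nat_mult[symmetric])
  also have "\<dots> \<le> (1 / 2) ^ 3" using 1 by (intro power_mono) auto
  finally show "exp (- 3) \<le> (1 / 8 :: real)" by (simp add: power3_eq_cube)
qed

lemma Pr_stage_event_Gam:
  assumes "s > 0" "1 \<le> k" "k < n" "n < m" "s * real (m - k) \<ge> 1"
  shows "Pr s (stage_event k n m) \<ge> exp (- 2 * Gam k (s * real (n - k)) / s) / 4"
proof -
  let ?S = "\<Sum>c=n..<m. gk k (s * real (c + 1 - k))"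
  have "?S = (\<Sum>i=n-k..<(n-k)+(m-n). gk k (s * real (Suc i)))"
    by (rule sum.reindex_bij_witness[of _ "\<lambda>i. i + k" "\<lambda>c. c - k"]) (use assms in \<open>auto simp: Suc_diff_le\<close>)
  also have "\<dots> \<le> (Gam k (s * real (n - k)) - Gam k (s * real (n - k + (m - n)))) / s"
    using assms by (intro gk_sum_le) auto
  also have "\<dots> \<le> Gam k (s * real (n - k)) / s"
    using Gam_nonneg[OF assms(2), of "s * real (n - k + (m - n))"] assms by (intro divide_right_mono) auto
  finally have S: "?S \<le> Gam k (s * real (n - k)) / s" .
  have "exp (- (s * real (m - k))) \<le> exp (- 1)" using assms by simp
  hence u: "1 - exp (- (s * real (m - k))) \<ge> 1 / 2" using exp_neg_small(1) by linarith
  have "exp (- 2 * Gam k (s * real (n - k)) / s) / 4 \<le> (1 / 2)\<^sup>2 * exp (- 2 * ?S)"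
  proof -
    have "exp (- 2 * X) / 4 \<le> (1 / 2)\<^sup>2 * exp (- 2 * Y)" if "Y \<le> X" for X Y :: real
      using that by (simp add: power2_eq_square)
    from this[OF S] show ?thesis by simp
  qed
  also have "\<dots> \<le> (1 - exp (- (s * real (m - k))))\<^sup>2 * exp (- 2 * ?S)"
    using u by (intro mult_right_mono power_mono) auto
  also have "\<dots> \<le> Pr s (stage_event k n m)" using assms by (intro Pr_stage_event) auto
  finally show ?thesis .
qed

lemma Pr_first_stage:
  assumes "0 < s" "s \<le> 1" "1 \<le> k" "k < n" "s * real (n - k) \<ge> 1"
  shows "Pr s (stage_event k k n) \<ge> exp (- 2 * (1 - ln s + (lambda_k k - Gam k (s * real n)) / s)) / 4"
proof -
  let ?S = "\<Sum>c=k..<n. gk k (s * real (c + 1 - k))"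
  have "?S = (\<Sum>i=0..<n-k. gk k (s * real (Suc i)))"
    by (rule sum.reindex_bij_witness[of _ "\<lambda>i. i + k" "\<lambda>c. c - k"]) (use assms in \<open>auto simp: Suc_diff_le\<close>)
  \<comment> \<open>The first line is treated separately, since \<open>gk_sum_le\<close> compares
    with an integral starting at a positive argument. Its cost \<open>1 - ln s\<close> is only
    logarithmic.\<close>
  also have "\<dots> = gk k s + (\<Sum>i=1..<1+(n-k-1). gk k (s * real (Suc i)))"
  proof -
    have "1 + (n - k - 1) = n - k" using assms by simp
    thus ?thesis using assms by (subst sum.atLeast_Suc_lessThan) auto
  qed
  also have "\<dots> \<le> (1 - ln s) + (Gam k (s * real 1) - Gam k (s * real (1 + (n - k - 1)))) / s"
    using assms by (intro add_mono gk_le_small gk_sum_le) auto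
  also have "\<dots> \<le> (1 - ln s) + (lambda_k k - Gam k (s * real n)) / s"
  proof -
    have "Gam k (s * real n) \<le> Gam k (s * real (1 + (n - k - 1)))" using assms by (intro Gam_anti) auto
    moreover have "Gam k (s * real 1) \<le> lambda_k k" using assms by (intro Gam_le_lambda) auto
    ultimately show ?thesis using assms by (intro add_left_mono divide_right_mono) auto
  qed
  finally have S: "?S \<le> (1 - ln s) + (lambda_k k - Gam k (s * real n)) / s" .
  have "exp (- (s * real (n - k))) \<le> exp (- 1)" using assms by simp
  hence u: "1 - exp (- (s * real (n - k))) \<ge> 1 / 2" using exp_neg_small(1) by linarith
  have "exp (- 2 * (1 - ln s + (lambda_k k - Gam k (s * real n)) / s)) / 4 \<le> (1 / 2)\<^sup>2 * exp (- 2 * ?S)"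
  proof -
    have "exp (- 2 * X) / 4 \<le> (1 / 2)\<^sup>2 * exp (- 2 * Y)" if "Y \<le> X" for X Y :: real
      using that by (simp add: power2_eq_square)
    from this[OF S] show ?thesis by simp
  qed
  also have "\<dots> \<le> (1 - exp (- (s * real (n - k))))\<^sup>2 * exp (- 2 * ?S)"
    using u by (intro mult_right_mono power_mono) auto
  also have "\<dots> \<le> Pr s (stage_event k k n)" using assms by (intro Pr_stage_event) auto
  finally show ?thesis .
qed

text \<open>By convexity \<open>g\<close> falls between the two arguments at least as steeply as on
  \<open>[5, 6]\<close>, so the length condition gives \<open>a - b >= 1\<close>. Then
  \<open>2 - exp (- 1) >= 3/2\<close> and \<open>1 - exp (- 3) >= 7/8\<close> leave the factor
  \<open>49/64 * 3/2 > 11/10\<close>.\<close>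

lemma Pr_block_gain:
  assumes "s > 0" "1 \<le> k" "3 \<le> s * real n" "n < m" "s * real m \<le> 5"
    "s * (real (m - n))\<^sup>2 * (gk k 5 - gk k 6) \<ge> 1"
  shows "Pr s (block_event k n m) \<ge> 11 / 10 * exp (- (real (m - n) * (gk k (s * real n) + gk k (s * real m))))"
proof -
  define l where "l = real (m - n)"
  have n1: "n \<ge> 1" using assms(3) by (cases n) auto
  define a b u where "a = l * gk k (s * real n)" and "b = l * gk k (s * real m)" and "u = 1 - exp (- (s * real n))"
  have sl: "s * l > 0" using assms(1,4) by (simp add: l_def)
  have sm: "s * real n + s * l = s * real m" using assms(4) by (simp add: l_def of_nat_diff algebra_simps)
  have "(gk k 5 - gk k (5 + 1)) / 1 \<le> (gk k (s * real n) - gk k (s * real n + s * l)) / (s * l)"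
    by (rule gk_slope[OF assms(2)]) (use assms(3,5) sm sl in linarith)+
  hence "gk k 5 - gk k 6 \<le> (gk k (s * real n) - gk k (s * real m)) / (s * l)" unfolding sm by simp
  hence "s * l * (gk k 5 - gk k 6) \<le> gk k (s * real n) - gk k (s * real m)"
    unfolding pos_le_divide_eq[OF sl] by (simp add: mult.commute)
  hence "l * (s * l * (gk k 5 - gk k 6)) \<le> l * (gk k (s * real n) - gk k (s * real m))"
    by (intro mult_left_mono) (auto simp: l_def)
  moreover have "l * (s * l * (gk k 5 - gk k 6)) \<ge> 1" using assms(6)[folded l_def] by (simp add: power2_eq_square mult_ac)
  ultimately have "a - b \<ge> 1" by (simp add: a_def b_def right_diff_distrib)
  hence "exp (- (a - b)) \<le> exp (- 1)" by simp
  hence e: "2 - exp (- (a - b)) \<ge> 3 / 2" using exp_neg_small(1) by linarith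
  have "exp (- (s * real n)) \<le> exp (- 3)" using assms by simp
  hence "u \<ge> 7 / 8" using exp_neg_small(2) unfolding u_def by linarith
  hence "u\<^sup>2 \<ge> (7 / 8)\<^sup>2" by (intro power_mono) auto
  hence "u\<^sup>2 \<ge> 49 / 64" by (simp add: power2_eq_square)
  hence "49 / 64 * (3 / 2) \<le> u\<^sup>2 * (2 - exp (- (a - b)))" using e by (intro mult_mono) auto
  hence "11 / 10 \<le> u\<^sup>2 * (2 - exp (- (a - b)))" by simp
  hence "11 / 10 * exp (- a - b) \<le> u\<^sup>2 * (2 - exp (- (a - b))) * exp (- a - b)" by (intro mult_right_mono) auto
  also have "\<dots> \<le> Pr s (block_event k n m)"
    using Pr_block_event[OF assms(1,2) n1 assms(4)] by (simp add: a_def b_def u_def l_def mult_ac)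
  finally show ?thesis by (simp add: a_def b_def l_def distrib_left)
qed

lemma prod_exp_weights:
  assumes "s > (0::real)"
  shows "c ^ J * exp (- ((\<Sum>i<J. s * m * f i) / s)) = (\<Prod>i<J. c * exp (- (m * f i)))"
proof (induction J)
  case (Suc J)
  have "((\<Sum>i<Suc J. s * m * f i) / s) = (\<Sum>i<J. s * m * f i) / s + m * f J"
    using assms by (simp add: add_divide_distrib)
  hence "exp (- ((\<Sum>i<Suc J. s * m * f i) / s)) = exp (- ((\<Sum>i<J. s * m * f i) / s)) * exp (- (m * f J))"
    by (simp add: exp_add[symmetric])
  thus ?case using Suc[symmetric] by simp
qed simp

text \<open>The choice of \<open>C\<close> makes \<open>m\<close>, about \<open>C / sqrt s\<close>,
  just long enough for \<open>Pr_block_gain\<close>. The blocks start at \<open>n\<close>, about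
  \<open>3 / s\<close>, and cover at most \<open>1 / (2 * s)\<close>, so the scaled sides remain in
  \<open>[3, 4]\<close>. With \<open>N\<close> about \<open>2 / s * ln (1 / s)\<close> one has
  \<open>exp (- (s * N)) <= s^2\<close>, and the final phase has probability at least
  \<open>1/2\<close>.\<close>

lemma growth_lower:
  fixes k :: nat and s C :: real
  defines "C \<equiv> 1 / sqrt (gk k 5 - gk k 6)"
  assumes k: "k \<ge> 1" and s: "0 < s" "s \<le> 1 / 8" "s * real k \<le> 1" "ln (1 / s) \<ge> 5 / 2" "(C + 1) * sqrt s \<le> 1"
  shows "\<exists>n m J N. k < n \<and> m \<ge> 1 \<and> n + J * m < N \<and>
    Pr s (growth_event k n m J N) \<ge> exp (- 2 * lambda_k k / s + (1 / (2 * (C + 1) * sqrt s) - 1) / 11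
      - (real (k * k) * ln (2 / s) + 5 + 2 * (1 - ln s) + (C + 1)\<^sup>2 / 2 * (gk k 1 - gk k 2) + 2 * real k * gk k 1))"
proof -
  let ?g = "gk k" and ?G = "Gam k"
  define \<delta> where "\<delta> = ?g 5 - ?g 6"
  have \<delta>: "\<delta> > 0" using gk_strict_anti[OF k, of 5 6] by (simp add: \<delta>_def)
  have C: "C > 0" "C\<^sup>2 * \<delta> = 1" using \<delta> by (auto simp: C_def \<delta>_def power_divide)
  define m where "m = nat \<lceil>C / sqrt s\<rceil>"
  define n where "n = nat \<lceil>3 / s\<rceil>"
  define J where "J = nat \<lfloor>1 / (2 * s * real m)\<rfloor>"
  define N where "N = nat \<lceil>2 / s * ln (1 / s)\<rceil>"
  have sq: "sqrt s > 0" "sqrt s \<le> 1" "sqrt s * sqrt s = s" using s by auto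
  have m1: "real m \<ge> C / sqrt s" "real m \<le> C / sqrt s + 1" "m \<ge> 1"
    unfolding m_def using C sq by (auto simp: le_nat_iff ceiling_le_iff Suc_le_eq intro!: of_nat_ceiling)
  have n1: "real n \<ge> 3 / s" "real n \<le> 3 / s + 1" unfolding n_def using s by (auto intro!: of_nat_ceiling)
  have N1: "real N \<ge> 2 / s * ln (1 / s)" unfolding N_def by (rule of_nat_ceiling)
  have sm: "s * real m \<le> (C + 1) * sqrt s"
  proof -
    have "s * real m \<le> s * (C / sqrt s + 1)" using m1 s by (intro mult_left_mono) auto
    also have "\<dots> = C * sqrt s + sqrt s * sqrt s" using sq by (simp add: field_simps)
    also have "\<dots> \<le> C * sqrt s + sqrt s * 1" using sq by (intro add_left_mono mult_left_mono) auto
    finally show ?thesis by (simp add: algebra_simps)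
  qed
  have sm0: "s * real m > 0" using s m1 by simp
  have J1: "real J \<le> 1 / (2 * s * real m)" "real J \<ge> 1 / (2 * s * real m) - 1"
    unfolding J_def using s m1 by auto
  have J2: "real J * (s * real m) \<le> 1 / 2"
  proof -
    have "real J * (s * real m) \<le> 1 / (2 * s * real m) * (s * real m)" using J1 sm0 by (intro mult_right_mono) auto
    moreover have "1 / (2 * X) * X = 1 / 2" if "X > 0" for X :: real using that by simp
    from this[OF sm0] have "1 / (2 * s * real m) * (s * real m) = 1 / 2" by (simp only: mult.assoc)
    ultimately show ?thesis by simp
  qed
  have J3: "real J \<ge> 1 / (2 * (C + 1) * sqrt s) - 1"
  proof -
    have "1 / (2 * (C + 1) * sqrt s) \<le> 1 / (2 * s * real m)"
    proof -
      have "1 / (2 * Y) \<le> 1 / (2 * X)" if "0 < X" "X \<le> Y" for X Y :: real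
        using that by (intro divide_left_mono) auto
      from this[OF sm0 sm] show ?thesis by (simp only: mult.assoc)
    qed
    thus ?thesis using J1 by linarith
  qed
  have sn: "3 \<le> s * real n" "s * real n \<le> 3 + s" using n1 s by (auto simp: field_simps)
  have x: "s * real (n + i * m) = s * real n + real i * (s * real m)" for i by (simp add: algebra_simps)
  have xi: "3 \<le> s * real (n + i * m)" "s * real (n + i * m) \<le> 4" if "i \<le> J" for i
  proof -
    have "0 \<le> real i * (s * real m)" "real i * (s * real m) \<le> real J * (s * real m)" using that sm0 by (auto intro!: mult_right_mono simp del: mult_le_cancel_right mult_le_cancel_right_pos)
    thus "3 \<le> s * real (n + i * m)" "s * real (n + i * m) \<le> 4" unfolding x using sn J2 s(1,2) by linarith+
  qed
  have sN: "s * real N \<ge> 2 * ln (1 / s)" using N1 s by (simp add: field_simps)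
  have nN: "n + J * m < N"
  proof -
    have "s * real (n + J * m) < s * real N" using xi(2)[of J] sN s by linarith
    thus ?thesis using s(1) by (simp only: mult_less_cancel_left_pos of_nat_less_iff)
  qed
  have kn: "k < n"
  proof -
    have "s * real k < s * real n" using sn s by linarith
    thus ?thesis using s(1) by (simp only: mult_less_cancel_left_pos of_nat_less_iff)
  qed
  have minus_k: "s * real (c - k) = s * real c - s * real k" if "k \<le> c" for c using that by (simp add: of_nat_diff algebra_simps)
  have b1: "Pr s (stage_event k k n) \<ge> exp (- 2 * (1 - ln s + (lambda_k k - ?G (s * real n)) / s)) / 4"
  proof (rule Pr_first_stage[OF s(1) _ k kn])
    show "1 \<le> s * real (n - k)" using minus_k[OF less_imp_le[OF kn]] sn s(3) by linarith
  qed (use s in simp)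
  define Y where "Y = s * real (n + J * m)"
  have b2: "Pr s (stage_event k (n + J * m) N) \<ge> exp (- 2 * (?G Y / s + real k * ?g 1)) / 4"
  proof -
    have kk: "k < n + J * m" using kn by simp
    \<comment> \<open>The stage event is charged from \<open>n + J * m - k\<close> on, because its
      lines are shortened by \<open>k\<close>. Moving the starting point to \<open>Y\<close> costs
      at most \<open>k * gk k 1\<close>.\<close>
    define Z where "Z = s * real (n + J * m - k)"
    have z: "Z \<ge> 1" "Z \<le> Y" "Y - Z = s * real k"
      using minus_k[of "n + J * m"] kk xi(1)[of J] s by (auto simp: Y_def Z_def)
    have "?G Z - ?G Y \<le> s * real k * ?g Z"
      using Gam_mvt(2)[OF k _ z(2)] z(1,3) by simp
    also have "\<dots> \<le> s * real k * ?g 1" using z s k by (intro mult_left_mono gk_anti) auto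
    finally have "?G Z \<le> ?G Y + s * real k * ?g 1" by simp
    hence "?G Z / s \<le> (?G Y + s * real k * ?g 1) / s" using s by (intro divide_right_mono) auto
    hence "?G Z / s \<le> ?G Y / s + real k * ?g 1"
      using s by (simp add: add_divide_distrib)
    hence "exp (- 2 * (?G Y / s + real k * ?g 1)) / 4 \<le> exp (- 2 * ?G Z / s) / 4" by simp
    also have "\<dots> \<le> Pr s (stage_event k (n + J * m) N)" unfolding Z_def
    proof (rule Pr_stage_event_Gam[OF s(1) k kk nN])
      have "s * real (n + J * m - k) \<le> s * real (N - k)" using nN s by (intro mult_left_mono) auto
      thus "1 \<le> s * real (N - k)" using z(1) unfolding Z_def by linarith
    qed
    finally show ?thesis .
  qed
  have sN0: "exp (- (s * real N)) \<le> s\<^sup>2"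
  proof -
    have "exp (- (s * real N)) \<le> exp (- (2 * ln (1 / s)))" using sN by simp
    also have "\<dots> = s\<^sup>2" using s by (simp add: ln_div exp_double exp_minus)
    finally show ?thesis .
  qed
  have b3: "Pr s (final_event N) \<ge> 1 / 2"
  proof -
    have q: "1 - exp (- (2 * s)) \<ge> s" using one_minus_exp_ge[of "2 * s"] s by simp
    have "4 * exp (- (s * real N)) / (1 - exp (- (2 * s))) \<le> 4 * s\<^sup>2 / s"
      using sN0 q s by (intro frac_le) auto
    also have "\<dots> \<le> 1 / 2" using s by (simp add: power2_eq_square)
    finally show ?thesis using Pr_final_event[OF s(1), of N] by linarith
  qed
  have b4: "(1 - exp (- s)) ^ (k * k) \<ge> exp (- real (k * k) * ln (2 / s))"
  proof -
    have "exp (- real (k * k) * ln (2 / s)) = exp (real (k * k) * ln (s / 2))"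
      using s by (simp add: ln_div algebra_simps)
    also have "\<dots> = (s / 2) ^ (k * k)" using s by (simp only: exp_of_nat_mult) (simp add: exp_ln)
    also have "\<dots> \<le> (1 - exp (- s)) ^ (k * k)" using one_minus_exp_ge[of s] s by (intro power_mono) auto
    finally show ?thesis .
  qed
  let ?T = "\<Sum>i<J. s * real m * (?g (s * real n + real i * (s * real m)) + ?g (s * real n + real (Suc i) * (s * real m)))"
  have b5: "(\<Prod>i<J. Pr s (block_event k (n + i * m) (n + Suc i * m))) \<ge> (11 / 10) ^ J * exp (- (?T / s))"
  proof -
    have "(11 / 10) ^ J * exp (- (?T / s)) = (\<Prod>i<J. 11 / 10 * exp (- (real m * (?g (s * real n + real i * (s * real m)) + ?g (s * real n + real (Suc i) * (s * real m))))))"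
      by (rule prod_exp_weights[OF s(1)])
    also have "\<dots> \<le> (\<Prod>i<J. Pr s (block_event k (n + i * m) (n + Suc i * m)))"
    proof (intro prod_mono conjI)
      fix i assume "i \<in> {..<J}"
      hence i: "Suc i \<le> J" by simp
      have l: "n + Suc i * m - (n + i * m) = m" by simp
      have "s * (real m)\<^sup>2 * \<delta> \<ge> s * (C / sqrt s)\<^sup>2 * \<delta>"
        using m1 C s \<delta> by (intro mult_right_mono mult_left_mono power_mono) auto
      moreover have "s * (C / sqrt s)\<^sup>2 * \<delta> = 1" using C s by (simp add: power_divide)
      ultimately have "s * (real m)\<^sup>2 * \<delta> \<ge> 1" by simp
      hence "11 / 10 * exp (- (real (n + Suc i * m - (n + i * m)) * (?g (s * real (n + i * m)) + ?g (s * real (n + Suc i * m))))) \<le> Pr s (block_event k (n + i * m) (n + Suc i * m))"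
        by (intro Pr_block_gain) (use s k xi[of i] xi[OF i] i m1 l in \<open>auto simp: \<delta>_def\<close>)
      thus "11 / 10 * exp (- (real m * (?g (s * real n + real i * (s * real m)) + ?g (s * real n + real (Suc i) * (s * real m))))) \<le> Pr s (block_event k (n + i * m) (n + Suc i * m))"
        unfolding l x .
    qed auto
    finally show ?thesis .
  qed
  have T: "?T / s \<le> 2 * (?G (s * real n) - ?G Y) / s + (C + 1)\<^sup>2 / 2 * (?g 1 - ?g 2)"
  proof -
    let ?h = "s * real m" and ?x = "s * real n"
    have h1: "?h \<le> 1" using sm s by linarith
    have "?T \<le> 2 * (?G ?x - ?G (?x + real J * ?h)) + ?h * (?g (?x - ?h / 2) - ?g ?x)"
      by (rule gk_trapezoid) (use k sm0 h1 sn in auto)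
    moreover have "?g (?x - ?h / 2) - ?g ?x \<le> ?h / 2 * (?g 1 - ?g 2)"
    proof -
      have "(?g (?x - ?h / 2) - ?g (?x - ?h / 2 + ?h / 2)) / (?h / 2) \<le> (?g 1 - ?g (1 + 1)) / 1"
        by (rule gk_slope) (use k sm0 h1 sn in auto)
      moreover have "A \<le> H * D" if "A / H \<le> D / 1" "H > 0" for A H D :: real
        using that by (simp add: pos_divide_le_eq mult.commute)
      ultimately have "?g (?x - ?h / 2) - ?g (?x - ?h / 2 + ?h / 2) \<le> ?h / 2 * (?g 1 - ?g (1 + 1))"
        using sm0 half_gt_zero by blast
      thus ?thesis by simp
    qed
    hence "?h * (?g (?x - ?h / 2) - ?g ?x) \<le> ?h * (?h / 2 * (?g 1 - ?g 2))" using sm0 by (intro mult_left_mono) auto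
    ultimately have "?T \<le> 2 * (?G ?x - ?G Y) + ?h * ?h / 2 * (?g 1 - ?g 2)" unfolding Y_def x by simp
    moreover have "?h * ?h / 2 * (?g 1 - ?g 2) \<le> s * ((C + 1)\<^sup>2 / 2 * (?g 1 - ?g 2))"
    proof -
      have "?h * ?h \<le> ((C + 1) * sqrt s) * ((C + 1) * sqrt s)" by (rule mult_mono'[OF sm sm]) (use sm0 in linarith)+
      also have "\<dots> = s * (C + 1)\<^sup>2" using sq by (simp add: power2_eq_square mult_ac)
      finally have "?h * ?h \<le> s * (C + 1)\<^sup>2" .
      moreover have "?g 1 - ?g 2 \<ge> 0" using gk_anti[OF k, of 1 2] by simp
      ultimately have "?h * ?h * ((?g 1 - ?g 2) / 2) \<le> s * (C + 1)\<^sup>2 * ((?g 1 - ?g 2) / 2)" by (intro mult_right_mono) auto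
      thus ?thesis by simp
    qed
    ultimately have "?T \<le> 2 * (?G ?x - ?G Y) + s * ((C + 1)\<^sup>2 / 2 * (?g 1 - ?g 2))" by linarith
    hence "?T / s \<le> (2 * (?G ?x - ?G Y) + s * ((C + 1)\<^sup>2 / 2 * (?g 1 - ?g 2))) / s" using s by (intro divide_right_mono) auto
    thus ?thesis using s by (simp add: add_divide_distrib)
  qed
  have b6: "(11 / 10) ^ J \<ge> exp ((1 / (2 * (C + 1) * sqrt s) - 1) / 11)"
  proof -
    have "ln (10 / 11 :: real) \<le> 10 / 11 - 1" by (rule ln_le_minus_one) simp
    hence l: "ln (11 / 10 :: real) \<ge> 1 / 11" by (simp add: ln_div)
    have "exp ((1 / (2 * (C + 1) * sqrt s) - 1) / 11) \<le> exp (real J * (1 / 11))" using J3 by simp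
    also have "\<dots> \<le> exp (real J * ln (11 / 10))" using mult_left_mono[OF l, of "real J"] by (simp only: exp_le_cancel_iff)
    also have "\<dots> = (11 / 10) ^ J" by (simp only: exp_of_nat_mult) simp
    finally show ?thesis .
  qed
  \<comment> \<open>This absorbs the constants \<open>1/4\<close>, \<open>1/4\<close> and
    \<open>1/2\<close> of the two stages and of the final phase.\<close>
  have b7: "exp (- 5) \<le> 1 / 4 * (1 / 4) * (1 / 2 :: real)"
  proof -
    have "exp (- 5) = (exp (- 1) :: real) ^ 5" by (simp add: exp_of_nat_mult[symmetric])
    also have "\<dots> \<le> (1 / 2) ^ 5" using exp_neg_small(1) by (intro power_mono) auto
    finally show ?thesis by (simp add: power_divide)
  qed
  define a1 where "a1 = - 2 * (1 - ln s + (lambda_k k - ?G (s * real n)) / s)"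
  define a2 where "a2 = - 2 * (?G Y / s + real k * ?g 1)"
  define a3 where "a3 = - real (k * k) * ln (2 / s)"
  define a4 where "a4 = (1 / (2 * (C + 1) * sqrt s) - 1) / 11"
  have "exp (a3 + a1 + a4 - ?T / s + a2 - 5) = exp a3 * exp a1 * (exp a4 * exp (- (?T / s))) * exp a2 * exp (- 5)"
    by (simp add: exp_add exp_diff exp_minus field_simps)
  also have "\<dots> \<le> exp a3 * exp a1 * (exp a4 * exp (- (?T / s))) * exp a2 * (1 / 4 * (1 / 4) * (1 / 2))"
    by (intro mult_left_mono b7) auto
  also have "\<dots> = exp a3 * (exp a1 / 4) * (exp a4 * exp (- (?T / s))) * (exp a2 / 4) * (1 / 2)" by simp
  also have "\<dots> \<le> (1 - exp (- s)) ^ (k * k) * Pr s (stage_event k k n) *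
    (\<Prod>i<J. Pr s (block_event k (n + i * m) (n + Suc i * m))) * Pr s (stage_event k (n + J * m) N) * Pr s (final_event N)"
  proof (intro mult_mono)
    show "exp a4 * exp (- (?T / s)) \<le> (\<Prod>i<J. Pr s (block_event k (n + i * m) (n + Suc i * m)))"
      by (rule order_trans[OF mult_right_mono[OF b6[folded a4_def]] b5]) auto
  qed (use b1 b2 b3 b4 s in \<open>auto simp: a1_def a2_def a3_def intro!: prod_nonneg mult_nonneg_nonneg\<close>)
  also have "\<dots> = Pr s (growth_event k n m J N)"
    using Pr_growth_event[OF less_imp_le[OF s(1)] k kn m1(3) nN] by simp
  finally have F: "exp (a3 + a1 + a4 - ?T / s + a2 - 5) \<le> Pr s (growth_event k n m J N)" .
  have "- 2 * lambda_k k / s + a4 - (real (k * k) * ln (2 / s) + 5 + 2 * (1 - ln s) + (C + 1)\<^sup>2 / 2 * (?g 1 - ?g 2) + 2 * real k * ?g 1)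
    \<le> a3 + a1 + a4 - ?T / s + a2 - 5"
    using T by (simp add: a1_def a2_def a3_def diff_divide_distrib algebra_simps)
  hence "exp (- 2 * lambda_k k / s + a4 - (real (k * k) * ln (2 / s) + 5 + 2 * (1 - ln s) + (C + 1)\<^sup>2 / 2 * (?g 1 - ?g 2) + 2 * real k * ?g 1))
    \<le> Pr s (growth_event k n m J N)" using F by (meson exp_le_cancel_iff order_trans)
  thus ?thesis using kn m1(3) nN unfolding a4_def by blast
qed

theorem growth_lower_bound:
  assumes "valid_model M"
  shows "\<exists>c>0. eventually (\<lambda>s. exp (- 2 * lambda_k (model_k M) / s + c * s powr (- 1 / 2)) \<le> P_growth M s) (at_right 0)"
proof -
  let ?k = "model_k M"
  have k: "?k \<ge> 1" using assms by (cases M) (auto simp: valid_model_def model_k_def)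
  define C where "C = 1 / sqrt (gk ?k 5 - gk ?k 6)"
  have C: "C > 0" using gk_strict_anti[OF k, of 5 6] by (simp add: C_def)
  \<comment> \<open>Half of the gain rate \<open>1 / (22 * (C + 1))\<close>; the other half absorbs
    the error terms, which are logarithmic in \<open>s\<close>.\<close>
  define c where "c = 1 / (44 * (C + 1))"
  define D where "D = 1 / 11 + 5 + 2 + (C + 1)\<^sup>2 / 2 * (gk ?k 1 - gk ?k 2) + 2 * real ?k * gk ?k 1"
  have "((\<lambda>s. (real (?k * ?k) * ln (2 / s) - 2 * ln s + D) / s powr (- 1 / 2)) \<longlongrightarrow> 0) (at_right 0)"
    by real_asymp
  moreover have "c > 0" using C by (simp add: c_def)
  ultimately have 1: "eventually (\<lambda>s. (real (?k * ?k) * ln (2 / s) - 2 * ln s + D) / s powr (- 1 / 2) < c) (at_right 0)"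
    by (rule order_tendstoD)
  have 2: "eventually (\<lambda>s::real. 0 < s) (at_right 0)" by (simp add: eventually_at_right_less)
  have 3: "eventually (\<lambda>s::real. s \<le> 1 / 8) (at_right 0)" by real_asymp
  have 4: "eventually (\<lambda>s::real. ln (1 / s) \<ge> 5 / 2) (at_right 0)" by real_asymp
  have "((\<lambda>s. s * real ?k) \<longlongrightarrow> 0) (at_right 0)" by real_asymp
  hence 5: "eventually (\<lambda>s. s * real ?k < 1) (at_right 0)" by (rule order_tendstoD) simp
  have "((\<lambda>s. (C + 1) * sqrt s) \<longlongrightarrow> 0) (at_right 0)" by real_asymp
  hence 6: "eventually (\<lambda>s. (C + 1) * sqrt s < 1) (at_right 0)" by (rule order_tendstoD) simp
  have "eventually (\<lambda>s. exp (- 2 * lambda_k ?k / s + c * s powr (- 1 / 2)) \<le> P_growth M s) (at_right 0)"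
    using 1 2 3 4 5 6
  proof eventually_elim
    case (elim s)
    have r: "s powr (- 1 / 2) = 1 / sqrt s" using elim by (simp add: powr_minus powr_half_sqrt field_simps)
    obtain n m J N where *: "?k < n" "m \<ge> 1" "n + J * m < N"
      "Pr s (growth_event ?k n m J N) \<ge> exp (- 2 * lambda_k ?k / s + (1 / (2 * (C + 1) * sqrt s) - 1) / 11
      - (real (?k * ?k) * ln (2 / s) + 5 + 2 * (1 - ln s) + (C + 1)\<^sup>2 / 2 * (gk ?k 1 - gk ?k 2) + 2 * real ?k * gk ?k 1))"
      using growth_lower[OF k, of s] elim unfolding C_def[symmetric] by auto
    have sp: "s powr (- 1 / 2) > 0" using elim by simp
    have "real (?k * ?k) * ln (2 / s) - 2 * ln s + D < c * s powr (- 1 / 2)"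
      using elim(1) sp by (simp add: pos_divide_less_eq)
    moreover have "1 / (2 * (C + 1) * sqrt s) / 11 = 2 * c * s powr (- 1 / 2)"
    proof -
      have "1 / (2 * X * Y) / 11 = 2 * (1 / (44 * X)) * (1 / Y)" for X Y :: real by simp
      thus ?thesis unfolding r c_def .
    qed
    ultimately have "- 2 * lambda_k ?k / s + c * s powr (- 1 / 2) \<le>
      - 2 * lambda_k ?k / s + (1 / (2 * (C + 1) * sqrt s) - 1) / 11
      - (real (?k * ?k) * ln (2 / s) + 5 + 2 * (1 - ln s) + (C + 1)\<^sup>2 / 2 * (gk ?k 1 - gk ?k 2) + 2 * real ?k * gk ?k 1)"
      unfolding D_def by (simp add: diff_divide_distrib)
    hence "exp (- 2 * lambda_k ?k / s + c * s powr (- 1 / 2)) \<le> Pr s (growth_event ?k n m J N)"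
      using *(4) by (meson exp_le_cancel_iff order_trans)
    also have "\<dots> \<le> Pr s (indefinite_growth M)"
      by (intro Pr_mono growth_event_subset indefinite_growth_event assms *)
    finally show ?case by (simp add: P_growth_def)
  qed
  thus ?thesis using \<open>c > 0\<close> by blast
qed

section \<open>Exploration of rectangles and the upper bound\<close>

text \<open>A rectangle is given by its left, right, lower and upper coordinates. The depth of a site
  in direction \<open>i\<close> (right, left, up, down for \<open>i = 0, 1, 2, 3\<close>) is how far it lies beyond the
  corresponding side.\<close>

type_synonym rectangle = "int \<times> int \<times> int \<times> int"

fun area :: "rectangle \<Rightarrow> site set" where
  "area (l, r, d, u) = {l..r} \<times> {d..u}"

fun proper :: "rectangle \<Rightarrow> bool" where
  "proper (l, r, d, u) \<longleftrightarrow> l \<le> r \<and> d \<le> u"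

fun width :: "rectangle \<Rightarrow> nat" where "width (l, r, d, u) = nat (r - l + 1)"
fun height :: "rectangle \<Rightarrow> nat" where "height (l, r, d, u) = nat (u - d + 1)"

fun depth :: "rectangle \<Rightarrow> nat \<Rightarrow> site \<Rightarrow> nat" where
  "depth (l, r, d, u) i x =
    (if i = 0 then nat (fst x - r) else if i = 1 then nat (l - fst x)
     else if i = 2 then nat (snd x - u) else nat (d - snd x))"

fun ext :: "rectangle \<Rightarrow> (nat \<Rightarrow> nat) \<Rightarrow> rectangle" where
  "ext (l, r, d, u) e = (l - int (e 1), r + int (e 0), d - int (e 3), u + int (e 2))"

fun included :: "rectangle \<Rightarrow> rectangle \<Rightarrow> bool" where
  "included (l, r, d, u) (l', r', d', u') \<longleftrightarrow> l' \<le> l \<and> r \<le> r' \<and> d' \<le> d \<and> u \<le> u'"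

fun cell :: "rectangle \<Rightarrow> nat \<Rightarrow> nat \<Rightarrow> site set" where
  "cell (l, r, d, u) i j =
    (if i = 0 then {r + 1 + int j} \<times> {d..u} else if i = 1 then {l - 1 - int j} \<times> {d..u}
     else if i = 2 then {l..r} \<times> {u + 1 + int j} else {l..r} \<times> {d - 1 - int j})"

fun corners :: "rectangle \<Rightarrow> (nat \<Rightarrow> nat) \<Rightarrow> site set" where
  "corners (l, r, d, u) e = ({l - int (e 1)..<l} \<union> {r<..r + int (e 0)}) \<times> ({d - int (e 3)..<d} \<union> {u<..u + int (e 2)})"

section \<open>Geometry of rectangles\<close>

lemma less_4: "i < 4 \<Longrightarrow> i = 0 \<or> i = 1 \<or> i = 2 \<or> i = (3::nat)" by auto

lemma all_less_4: "(\<forall>i<4. P i) \<longleftrightarrow> P 0 \<and> P 1 \<and> P 2 \<and> P (3::nat)"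
  using less_4 by fastforce

lemma area_ext_iff: "proper R \<Longrightarrow> x \<in> area (ext R e) \<longleftrightarrow> (\<forall>i<4. depth R i x \<le> e i)"
proof -
  obtain l r d u a b where e: "R = (l, r, d, u)" "x = (a, b)" by (cases R; cases x)
  show ?thesis unfolding e by (simp add: all_less_4 nat_le_iff) linarith
qed

lemma proper_ext: "proper R \<Longrightarrow> proper (ext R e)"
  by (cases R) auto

lemma included_ext: "included R (ext R e)"
  by (cases R) auto

lemma included_trans: "included R S \<Longrightarrow> included S T \<Longrightarrow> included R T"
  by (cases R; cases S; cases T) auto

lemma included_area: "included R S \<Longrightarrow> area R \<subseteq> area S"
  by (cases R; cases S) auto

lemma depth_ext: "i < 4 \<Longrightarrow> depth (ext R e) i x = depth R i x - e i"
  using less_4[of i] by (cases R) (elim meta_impE disjE; auto)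

lemma width_ext: "proper R \<Longrightarrow> width (ext R e) = width R + (e 0 + e 1)"
  by (cases R) auto

lemma height_ext: "proper R \<Longrightarrow> height (ext R e) = height R + (e 2 + e 3)"
  by (cases R) auto

lemma depth_opposite:
  "proper R \<Longrightarrow> depth R 0 x > 0 \<Longrightarrow> depth R 1 x = 0" "proper R \<Longrightarrow> depth R 2 x > 0 \<Longrightarrow> depth R 3 x = 0"
  by (cases R; auto)+

lemma corners_iff: "proper R \<Longrightarrow> x \<in> corners R e \<longleftrightarrow>
   x \<in> area (ext R e) \<and> depth R 0 x + depth R 1 x > 0 \<and> depth R 2 x + depth R 3 x > 0"
proof -
  assume R: "proper R"
  obtain l r d u a b where e: "R = (l, r, d, u)" "x = (a, b)" by (cases R; cases x)
  have lr: "l \<le> r" "d \<le> u" using R e by auto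
  have 1: "a \<in> {l - int m..<l} \<union> {r<..r + int n} \<longleftrightarrow> a \<in> {l - int m..r + int n} \<and> nat (a - r) + nat (l - a) > 0"
    if "l \<le> r" for a l r :: int and m n using that by auto
  show ?thesis unfolding e using 1[OF lr(1), of a "e 1" "e 0"] 1[OF lr(2), of b "e 3" "e 2"] by simp blast
qed

lemma cell_iff: assumes "proper R" "i < 4"
  shows "x \<in> cell R i j \<longleftrightarrow> depth R i x = Suc j \<and>
    (if i < 2 then depth R 2 x + depth R 3 x = 0 else depth R 0 x + depth R 1 x = 0)"
  using less_4[OF assms(2)] assms(1) by (cases R; cases x) (elim disjE; auto)

lemma finite_cell: "finite (cell R i j)" by (cases R) auto

lemma card_cell: assumes "proper R" "i < 4" shows "card (cell R i j) = (if i < 2 then height R else width R)"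
  using less_4[OF assms(2)] assms(1) by (cases R) (elim disjE; auto)

lemma finite_corners: "finite (corners R e)" by (cases R) auto

lemma card_corners: assumes "proper R" shows "card (corners R e) = (e 0 + e 1) * (e 2 + e 3)"
proof -
  obtain l r d u where R: "R = (l, r, d, u)" by (cases R)
  have "card ({l - int m..<l} \<union> {r<..r + int n}) = n + m" if "l \<le> r" for l r :: int and m n
    using that by (subst card_Un_disjoint) auto
  thus ?thesis using assms unfolding R by (simp add: card_cartesian_product)
qed

text \<open>An upper estimate of the sites that an active rectangle can activate: the distance balls
  are enlarged to boxes. For Frobse the exact shape is kept, because then a near site of a proper
  rectangle lies beyond exactly one side and cannot serve a column and a row at once.\<close>

definition near :: "perc_model \<Rightarrow> rectangle \<Rightarrow> site \<Rightarrow> bool" where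
  "near M R x \<longleftrightarrow> x \<notin> area R \<and> (\<forall>i<4. depth R i x \<le> model_k M) \<and>
     (M = Frobse1 \<longrightarrow> depth R 0 x + depth R 1 x + depth R 2 x + depth R 3 x \<le> 1)"

text \<open>Speaking of all larger rectangles at once makes the event independent of everything
  inside \<open>R\<close> and increasing in \<open>R\<close>; both are used when the recursion
  passes from \<open>R\<close> to an enlarged rectangle.\<close>

definition survive :: "perc_model \<Rightarrow> rectangle \<Rightarrow> config set" where
  "survive M R = (\<Inter>S\<in>{S. included R S}. \<Union>x\<in>{x. near M S x}. {\<omega>. \<omega> x})"

lemma dep_survive: "dep (- area R) (survive M R)"
  unfolding survive_def
proof (intro dep_INT dep_UN countableI_type)
  fix S x assume "S \<in> {S. included R S}" "x \<in> {x. near M S x}"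
  hence "x \<notin> area R" using included_area[of R S] by (auto simp: near_def)
  thus "dep (- area R) {\<omega>. \<omega> x}" using dep_mono[OF dep_site] by auto
qed

lemma survive_mono: "included R S \<Longrightarrow> survive M R \<subseteq> survive M S"
  unfolding survive_def using included_trans by blast

section \<open>Survival as a necessary condition for indefinite growth\<close>

lemma area_closed:
  assumes "valid_model M" "proper S" "\<And>x. near M S x \<Longrightarrow> \<not> \<omega> x"
  shows "closed_under M \<omega> (area S)"
  unfolding closed_under_def
proof (intro allI conjI impI; elim conjE)
  obtain l r d u where S: "S = (l, r, d, u)" by (cases S)
  have lr: "l \<le> r" "d \<le> u" using assms(2) S by auto
  fix x assume x: "\<omega> x" "occ_rule M (area S) x"
  show "x \<in> area S"
  proof (rule ccontr)
    assume nx: "x \<notin> area S"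
    obtain a b where ab: "x = (a, b)" by (cases x)
    have "near M S x"
      using x(2) nx unfolding near_def occ_rule_def all_less_4 S ab
      by (cases M) (auto simp: model_k_def l1dist_def linfdist_def)
    thus False using assms(3) x(1) by blast
  qed
next
  obtain l r d u where S: "S = (l, r, d, u)" by (cases S)
  fix x assume x: "\<not> \<omega> x" "empty_rule M (area S) x"
  obtain a b where ab: "x = (a, b)" by (cases x)
  show "x \<in> area S"
  proof (cases M)
    case (KPerc k)
    have k: "k \<ge> 2" using assms(1) KPerc by (simp add: valid_model_def)
    have c: "k \<le> card (Nk k x \<inter> area S)" using x(2) KPerc by (simp add: empty_rule_def)
    show ?thesis
    proof (rule ccontr)
      assume nx: "x \<notin> area S"
      \<comment> \<open>Seen from a site outside, the part of its neighbourhood inside the rectangle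
        lies on a single ray, which has only \<open>k - 1\<close> sites; so empty sites outside are
        never activated.\<close>
      have cases: "Nk k x \<inter> area S \<subseteq> (\<lambda>v. (a + v, b)) ` {1..int k - 1} \<or>
        Nk k x \<inter> area S \<subseteq> (\<lambda>v. (a - v, b)) ` {1..int k - 1} \<or>
        Nk k x \<inter> area S \<subseteq> (\<lambda>v. (a, b + v)) ` {1..int k - 1} \<or>
        Nk k x \<inter> area S \<subseteq> (\<lambda>v. (a, b - v)) ` {1..int k - 1}"
      proof -
        consider "a < l" | "a > r" | "b < d" | "b > u" using nx ab S by fastforce
        thus ?thesis
        proof cases
          case 1
          have "Nk k x \<inter> area S \<subseteq> (\<lambda>v. (a + v, b)) ` {1..int k - 1}"
            using 1 unfolding Nk_def ab S by auto
          thus ?thesis by blast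
        next
          case 2
          have "z \<in> (\<lambda>v. (a - v, b)) ` {1..int k - 1}" if z: "z \<in> Nk k x \<inter> area S" for z
          proof -
            have "z = (a - (a - fst z), b)" "1 \<le> a - fst z" "a - fst z \<le> int k - 1"
              using z 2 unfolding Nk_def ab S by auto
            thus ?thesis by (metis atLeastAtMost_iff imageI)
          qed
          thus ?thesis by blast
        next
          case 3
          have "Nk k x \<inter> area S \<subseteq> (\<lambda>v. (a, b + v)) ` {1..int k - 1}"
            using 3 unfolding Nk_def ab S by auto
          thus ?thesis by blast
        next
          case 4
          have "z \<in> (\<lambda>v. (a, b - v)) ` {1..int k - 1}" if z: "z \<in> Nk k x \<inter> area S" for z
          proof -
            have "z = (a, b - (b - snd z))" "1 \<le> b - snd z" "b - snd z \<le> int k - 1"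
              using z 4 unfolding Nk_def ab S by auto
            thus ?thesis by (metis atLeastAtMost_iff imageI)
          qed
          thus ?thesis by blast
        qed
      qed
      have "card (Nk k x \<inter> area S) \<le> k - 1" if "Nk k x \<inter> area S \<subseteq> f ` {1..int k - 1}" for f
      proof -
        have "card (Nk k x \<inter> area S) \<le> card (f ` {1..int k - 1})" using that by (intro card_mono) auto
        also have "\<dots> \<le> card {1..int k - 1}" by (rule card_image_le) simp
        finally show ?thesis by simp
      qed
      hence "card (Nk k x \<inter> area S) \<le> k - 1" using cases by blast
      thus False using c k by simp
    qed
  next
    case Modified1
    thus ?thesis using x(2) unfolding empty_rule_def ab S by auto
  next
    case Frobse1
    thus ?thesis using x(2) unfolding empty_rule_def ab S by auto
  qed
qed

lemma indefinite_growth_survive: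
  assumes "valid_model M" shows "indefinite_growth M \<subseteq> survive M (0, 0, 0, 0)"
proof
  fix \<omega> assume g: "\<omega> \<in> indefinite_growth M"
  show "\<omega> \<in> survive M (0, 0, 0, 0)"
  proof (rule ccontr)
    assume "\<omega> \<notin> survive M (0, 0, 0, 0)"
    then obtain S where S: "included (0,0,0,0) S" "\<And>x. near M S x \<Longrightarrow> \<not> \<omega> x"
      unfolding survive_def by blast
    obtain l r d u where S': "S = (l, r, d, u)" by (cases S)
    have "proper S" using S(1) S' by auto
    hence "closed_under M \<omega> (area S)" by (intro area_closed assms S)
    moreover have "init_active \<omega> \<subseteq> area S" using S(1) S' by (auto simp: init_active_def)
    ultimately have "final_active M \<omega> \<subseteq> area S" unfolding final_active_def by blast
    hence "area S = UNIV" using g by (auto simp: indefinite_growth_def)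
    hence "(r + 1, 0) \<in> area S" by simp
    thus False by (simp add: S')
  qed
qed

text \<open>The labels in the first component of \<open>L\<close> are corner sites used to mark a column whose
  strip is empty, those in the second component are used for rows.\<close>

definition label :: "site set \<times> site set \<Rightarrow> nat \<Rightarrow> site set" where
  "label L i = (if i < 2 then fst L else snd L)"

definition flag :: "rectangle \<Rightarrow> site set \<times> site set \<Rightarrow> nat \<Rightarrow> nat \<Rightarrow> bool" where
  "flag R L i j \<longleftrightarrow> (\<exists>x\<in>label L i. depth R i x = Suc j)"

definition labelling :: "perc_model \<Rightarrow> rectangle \<Rightarrow> (nat \<Rightarrow> nat) \<Rightarrow> site set \<times> site set \<Rightarrow> bool" where
  "labelling M R e L \<longleftrightarrow> fst L \<subseteq> corners R e \<and> snd L \<subseteq> corners R e \<and>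
     (M = Frobse1 \<longrightarrow> fst L \<inter> snd L = {}) \<and>
     (\<forall>i<4. \<forall>x\<in>label L i. \<forall>y\<in>label L i. depth R i x > 0 \<longrightarrow> depth R i x = depth R i y \<longrightarrow> x = y)"

definition marked :: "rectangle \<Rightarrow> config \<Rightarrow> site set \<times> site set \<Rightarrow> nat \<Rightarrow> nat \<Rightarrow> bool" where
  "marked R \<omega> L i j \<longleftrightarrow> flag R L i j \<or> \<omega> \<notin> all_empty (cell R i j)"

text \<open>A corner site is charged only where the strip itself is empty, which makes labels cheap
  for long strips. That the outermost strip is marked is the invariant that lets the window
  condition survive a jump by up to \<open>k\<close>.\<close>

definition explored :: "perc_model \<Rightarrow> rectangle \<Rightarrow> config \<Rightarrow> (nat \<Rightarrow> nat) \<Rightarrow> site set \<times> site set \<Rightarrow> bool" where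
  "explored M R \<omega> e L \<longleftrightarrow> labelling M R e L \<and> \<omega> \<in> all_occ (fst L \<union> snd L) \<and>
     (\<forall>i<4. (\<forall>j. flag R L i j \<longrightarrow> \<omega> \<in> all_empty (cell R i j)) \<and>
        (\<forall>j. j + model_k M \<le> e i \<longrightarrow> (\<exists>j'\<in>{j..<j + model_k M}. marked R \<omega> L i j')) \<and>
        (e i > 0 \<longrightarrow> marked R \<omega> L i (e i - 1)))"

lemma explored_0: assumes "model_k M \<ge> 1" shows "explored M R \<omega> (\<lambda>_. 0) ({}, {})"
  using assms by (auto simp: explored_def labelling_def label_def flag_def all_occ_def)

lemma corners_mono: "(\<And>i. e i \<le> e' i) \<Longrightarrow> corners R e \<subseteq> corners R e'"
proof -
  assume a: "\<And>i. e i \<le> e' i"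
  show ?thesis using a[of 0] a[of 1] a[of 2] a[of 3] by (cases R) auto
qed

text \<open>The rectangle is enlarged just enough to contain \<open>x\<close>. For every side that
  moves, either the strip through \<open>x\<close> contains an occupied site, or \<open>x\<close>
  lies in a corner and becomes the label of that strip.\<close>

lemma explored_step:
  assumes R: "proper R" and k: "model_k M \<ge> 1" and E: "explored M R \<omega> e L"
    and x: "near M (ext R e) x" "\<omega> x"
  defines "e' \<equiv> \<lambda>i. max (e i) (depth R i x)"
  shows "\<exists>L'. explored M R \<omega> e' L'"
proof -
  let ?k = "model_k M"
  define new where "new = (\<lambda>i. x \<in> corners R e' \<and> depth R i x > e i \<and> \<omega> \<in> all_empty (cell R i (depth R i x - 1)))"
  define L' where "L' = ((if new 0 \<or> new 1 then insert x (fst L) else fst L), (if new 2 \<or> new 3 then insert x (snd L) else snd L))"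
  have lab: "labelling M R e L" and occ: "\<omega> \<in> all_occ (fst L \<union> snd L)"
    and fl: "\<And>i j. i < 4 \<Longrightarrow> flag R L i j \<Longrightarrow> \<omega> \<in> all_empty (cell R i j)"
    and win: "\<And>i j. i < 4 \<Longrightarrow> j + ?k \<le> e i \<Longrightarrow> \<exists>j'\<in>{j..<j + ?k}. marked R \<omega> L i j'"
    and top: "\<And>i. i < 4 \<Longrightarrow> e i > 0 \<Longrightarrow> marked R \<omega> L i (e i - 1)"
    using E by (auto simp: explored_def)
  have xe: "x \<notin> area (ext R e)" using x(1) by (simp add: near_def)
  have xd: "depth R i x - e i \<le> ?k" if "i < 4" for i
  proof -
    have "depth (ext R e) i x \<le> ?k" using x(1) that unfolding near_def by blast
    thus ?thesis by (simp add: depth_ext[OF that])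
  qed
  have xin: "x \<in> area (ext R e')" using area_ext_iff[OF R] by (auto simp: e'_def)
  have Cmono: "corners R e \<subseteq> corners R e'" by (rule corners_mono) (simp add: e'_def)
  have Osub: "fst L \<subseteq> corners R e" "snd L \<subseteq> corners R e" using lab by (auto simp: labelling_def)
  have Odepth: "depth R i y \<le> e i" if "y \<in> label L i" "i < 4" for i y
  proof -
    have "y \<in> corners R e" using that Osub by (auto simp: label_def split: if_splits)
    thus ?thesis using corners_iff[OF R] area_ext_iff[OF R] that by blast
  qed
  have xnotO: "x \<notin> fst L" "x \<notin> snd L" using Osub xe corners_iff[OF R, of x e] by auto
  have label': "label L' i = (if (if i < 2 then new 0 \<or> new 1 else new 2 \<or> new 3) then insert x (label L i) else label L i)" for i
    by (simp add: L'_def label_def)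
  have newpos: "depth R i x > 0" if "new i" for i using that by (auto simp: new_def)
  \<comment> \<open>A site lies beyond at most one of two opposite sides, so a new label of the pair
    belongs to the side beyond which \<open>x\<close> lies.\<close>
  have pair: "new i" if "i < 4" "depth R i x > 0" "if i < 2 then new 0 \<or> new 1 else new 2 \<or> new 3" for i
    using less_4[OF that(1)] that(2,3) newpos[of 0] newpos[of 1] newpos[of 2] newpos[of 3] depth_opposite[OF R, of x] by (elim disjE) auto
  have flag': "flag R L' i j \<Longrightarrow> flag R L i j \<or> (new i \<and> depth R i x = Suc j)" if "i < 4" for i j
    using pair[OF that] unfolding flag_def label' by (auto split: if_splits)
  have flag_mono: "flag R L i j \<Longrightarrow> flag R L' i j" for i j unfolding flag_def label' by auto
  have marked_mono: "marked R \<omega> L i j \<Longrightarrow> marked R \<omega> L' i j" for i j unfolding marked_def using flag_mono by blast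
  have lab': "labelling M R e' L'"
    unfolding labelling_def
  proof (intro conjI allI impI ballI)
    show "fst L' \<subseteq> corners R e'" "snd L' \<subseteq> corners R e'"
      using Osub Cmono by (auto simp: L'_def new_def)
  next
    assume M: "M = Frobse1"
    have "\<not> ((new 0 \<or> new 1) \<and> (new 2 \<or> new 3))"
    proof
      assume n: "(new 0 \<or> new 1) \<and> (new 2 \<or> new 3)"
      have "depth (ext R e) 0 x + depth (ext R e) 1 x + depth (ext R e) 2 x + depth (ext R e) 3 x \<le> 1"
        using x(1) M by (simp add: near_def)
      thus False using n by (auto simp: depth_ext new_def)
    qed
    thus "fst L' \<inter> snd L' = {}" using lab M xnotO by (auto simp: L'_def labelling_def)
  next
    fix i y z assume i: "i < 4" and y: "y \<in> label L' i" and z: "z \<in> label L' i"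
      and p: "depth R i y > 0" "depth R i y = depth R i z"
    have old: "y = z" if "y \<in> label L i" "z \<in> label L i"
      using lab that i p unfolding labelling_def by blast
    have mix: False if "y' \<in> label L i" "x \<in> label L' i" "x \<notin> label L i" "depth R i x = depth R i y'" "depth R i x > 0" for y'
    proof -
      have "new i" using pair[OF i that(5)] that(2,3) unfolding label' by (auto split: if_splits)
      thus False using Odepth[OF that(1) i] that(4) by (auto simp: new_def)
    qed
    have xl: "x \<notin> label L i" using xnotO by (auto simp: label_def)
    have "y = x \<or> y \<in> label L i" "z = x \<or> z \<in> label L i" using y z unfolding label' by (auto split: if_splits)
    thus "y = z" using old mix[of y] mix[of z] xl y z p by auto
  qed
  have top': "marked R \<omega> L' i (e' i - 1)" if i: "i < 4" "e' i > 0" for i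
  proof (cases "depth R i x > e i")
    case True
    hence e': "e' i = depth R i x" by (simp add: e'_def)
    show ?thesis
    proof (cases "\<omega> \<in> all_empty (cell R i (depth R i x - 1))")
      case True
      have "x \<notin> cell R i (depth R i x - 1)" using True x(2) by (auto simp: all_empty_def)
      hence "if i < 2 then depth R 2 x + depth R 3 x > 0 else depth R 0 x + depth R 1 x > 0"
        using cell_iff[OF R i(1), of x "depth R i x - 1"] i(2) e' by (auto split: if_splits)
      moreover have "if i < 2 then depth R 0 x + depth R 1 x > 0 else depth R 2 x + depth R 3 x > 0"
        using less_4[OF i(1)] i(2) e' by (elim disjE) auto
      ultimately have "x \<in> corners R e'" using corners_iff[OF R] xin by (auto split: if_splits)
      hence "new i" using True \<open>depth R i x > e i\<close> by (simp add: new_def)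
      hence "x \<in> label L' i" using less_4[OF i(1)] unfolding label' by (elim disjE) auto
      hence "flag R L' i (depth R i x - 1)" unfolding flag_def using i(2) e' by (intro bexI[of _ x]) auto
      thus ?thesis unfolding marked_def e' by blast
    qed (simp add: marked_def e')
  next
    case False
    hence "e' i = e i" by (simp add: e'_def)
    thus ?thesis using top[OF i(1)] i(2) marked_mono by simp
  qed
  have win': "\<exists>j'\<in>{j..<j + ?k}. marked R \<omega> L' i j'" if i: "i < 4" "j + ?k \<le> e' i" for i j
  proof (cases "j + ?k \<le> e i")
    case True
    thus ?thesis using win[OF i(1)] marked_mono by blast
  next
    case False
    show ?thesis
    \<comment> \<open>A window not contained in the old range either straddles its end and contains
      the old outermost strip, or starts there and contains the new outermost strip.\<close>
    proof (cases "j < e i")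
      case True
      hence "marked R \<omega> L' i (e i - 1)" using top[OF i(1)] marked_mono by simp
      thus ?thesis using True False by (intro bexI[of _ "e i - 1"]) auto
    next
      case f: False
      have "e' i \<le> e i + ?k" using xd[OF i(1)] by (simp add: e'_def)
      hence "j = e i" "e' i = j + ?k" using f i(2) by auto
      thus ?thesis using top'[OF i(1)] k by (intro bexI[of _ "e' i - 1"]) auto
    qed
  qed
  have "explored M R \<omega> e' L'"
    unfolding explored_def
  proof (intro conjI allI impI)
    show "\<omega> \<in> all_occ (fst L' \<union> snd L')" using occ x(2) by (auto simp: L'_def all_occ_def)
    fix i j assume "i < 4" "flag R L' i j"
    thus "\<omega> \<in> all_empty (cell R i j)" using flag' fl by (fastforce simp: new_def)
  qed (use lab' top' win' in auto)
  thus ?thesis by blast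
qed

lemma exploration_stops:
  assumes R: "proper R" and k: "model_k M \<ge> 1" and S: "\<omega> \<in> survive M R"
  shows "explored M R \<omega> e L \<Longrightarrow> e 0 + e 1 < A \<Longrightarrow> e 2 + e 3 < B \<Longrightarrow>
    \<exists>e L. explored M R \<omega> e L \<and> (e 0 + e 1 \<ge> A \<or> e 2 + e 3 \<ge> B) \<and>
      e 0 + e 1 < A + model_k M \<and> e 2 + e 3 < B + model_k M"
proof (induction "A + B - (e 0 + e 1 + e 2 + e 3)" arbitrary: e L rule: less_induct)
  case less
  have "included R (ext R e)" by (rule included_ext)
  then obtain x where x: "near M (ext R e) x" "\<omega> x" using S unfolding survive_def by blast
  define e' where "e' = (\<lambda>i. max (e i) (depth R i x))"
  obtain L' where L': "explored M R \<omega> e' L'" using explored_step[OF R k less.prems(1) x] unfolding e'_def by blast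
  have d: "depth R i x - e i \<le> model_k M" if "i < 4" for i
  proof -
    have "depth (ext R e) i x \<le> model_k M" using x(1) that unfolding near_def by blast
    thus ?thesis by (simp add: depth_ext[OF that])
  qed
  \<comment> \<open>Since \<open>x\<close> is beyond at most one of two opposite sides, each
    dimension grows by at most \<open>k\<close> per step; this bounds the overshoot at the stopping
    time.\<close>
  have b: "e' 0 + e' 1 \<le> e 0 + e 1 + model_k M" "e' 2 + e' 3 \<le> e 2 + e 3 + model_k M"
    using d[of 0] d[of 1] d[of 2] d[of 3] depth_opposite[OF R, of x] unfolding e'_def
    by (cases "depth R 0 x > 0"; cases "depth R 2 x > 0"; auto simp: max_def)+
  have "\<not> (\<forall>i<4. depth R i x \<le> e i)" using x(1) area_ext_iff[OF R] unfolding near_def by blast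
  hence inc: "e' 0 + e' 1 + e' 2 + e' 3 > e 0 + e 1 + e 2 + e 3"
    unfolding all_less_4 e'_def by auto
  show ?case
  proof (cases "e' 0 + e' 1 < A \<and> e' 2 + e' 3 < B")
    case True
    show ?thesis by (rule less.hyps[OF _ L']) (use True inc less.prems in auto)
  next
    case False
    thus ?thesis using L' b less.prems by (intro exI[of _ e'] exI[of _ L']) auto
  qed
qed

definition exploration_event :: "perc_model \<Rightarrow> rectangle \<Rightarrow> (nat \<Rightarrow> nat) \<Rightarrow> site set \<times> site set \<Rightarrow> config set" where
  "exploration_event M R e L =
    (\<Inter>i<4. gapfree (model_k M) 0 (map (\<lambda>j. (cell R i j, flag R L i j)) [0..<e i])) \<inter> all_occ (fst L \<union> snd L)"

lemma explored_event:
  assumes "explored M R \<omega> e L" "model_k M \<ge> 1"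
  shows "\<omega> \<in> exploration_event M R e L"
proof -
  have "\<omega> \<in> gapfree (model_k M) 0 (map (\<lambda>j. (cell R i j, flag R L i j)) [0..<e i])" if i: "i < 4" for i
    unfolding gapfree_iff
  proof
    show "\<forall>c\<in>set (map (\<lambda>j. (cell R i j, flag R L i j)) [0..<e i]). snd c \<longrightarrow> \<omega> \<in> all_empty (fst c)"
      using assms i by (auto simp: explored_def)
    have "no_gap (model_k M) 0 (map (marked R \<omega> L i) [0..<e i])"
    proof (subst no_gap_iff, use assms(2) in simp, intro allI impI)
      fix j assume "j + model_k M \<le> 0 + length (map (marked R \<omega> L i) [0..<e i])"
      hence j: "j + model_k M \<le> e i" by simp
      then obtain j' where "j' \<in> {j..<j + model_k M}" "marked R \<omega> L i j'" using assms(1) i unfolding explored_def by blast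
      thus "\<exists>i'\<in>{j..<j + model_k M}. (replicate 0 False @ map (marked R \<omega> L i) [0..<e i]) ! i'"
        using j by (intro bexI[of _ j']) auto
    qed
    thus "no_gap (model_k M) 0 (map (\<lambda>c. snd c \<or> \<omega> \<notin> all_empty (fst c)) (map (\<lambda>j. (cell R i j, flag R L i j)) [0..<e i]))"
      by (simp add: o_def marked_def[abs_def])
  qed
  thus ?thesis using assms(1) by (auto simp: exploration_event_def explored_def)
qed

lemma exploration_event_cong:
  assumes "\<And>i. i < 4 \<Longrightarrow> e i = e' i"
  shows "exploration_event M R e L = exploration_event M R e' L" "labelling M R e L = labelling M R e' L" "ext R e = ext R e'"
proof -
  have "e 0 = e' 0" "e 1 = e' 1" "e 2 = e' 2" "e 3 = e' 3" using assms by auto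
  thus "labelling M R e L = labelling M R e' L" "ext R e = ext R e'"
    by (cases R; simp add: labelling_def)+
  show "exploration_event M R e L = exploration_event M R e' L" using assms by (simp add: exploration_event_def)
qed

section \<open>Summing over the labels\<close>

lemma sum_Pow_insert:
  assumes "finite C" "x \<notin> C"
  shows "(\<Sum>A\<in>Pow (insert x C). f A) = (\<Sum>A\<in>Pow C. f A + f (insert x A) :: real)"
proof -
  have "(\<Sum>A\<in>Pow (insert x C). f A) = (\<Sum>A\<in>Pow C. f A) + (\<Sum>A\<in>insert x ` Pow C. f A)"
    unfolding Pow_insert using assms by (intro sum.union_disjoint) auto
  also have "(\<Sum>A\<in>insert x ` Pow C. f A) = (\<Sum>A\<in>Pow C. f (insert x A))"
    using assms by (subst sum.reindex) (auto simp: inj_on_def)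
  finally show ?thesis by (simp add: sum.distrib)
qed

text \<open>The occupation probability \<open>p\<close> is paid once per site, even if the site
  labels both a column and a row; hence the union in the exponent.\<close>

definition label_weight :: "bool \<Rightarrow> real \<Rightarrow> real \<Rightarrow> real \<Rightarrow> site set \<Rightarrow> site set \<Rightarrow> real" where
  "label_weight dis p a b A B = (if dis \<and> A \<inter> B \<noteq> {} then 0 else p ^ card (A \<union> B) * a ^ card A * b ^ card B)"

text \<open>The weight factorises over the sites: each carries no label, one of either kind, or,
  unless \<open>dis\<close> forbids it, both.\<close>

lemma label_weight_sum:
  assumes "finite C"
  shows "(\<Sum>A\<in>Pow C. \<Sum>B\<in>Pow C. label_weight dis p a b A B) = (1 + p * a + p * b + (if dis then 0 else p * a * b)) ^ card C"
  using assms
proof (induction C)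
  case empty
  show ?case by (simp add: label_weight_def)
next
  case (insert x C)
  let ?W = "label_weight dis p a b"
  have *: "?W A B + ?W A (insert x B) + (?W (insert x A) B + ?W (insert x A) (insert x B)) =
    (1 + p * a + p * b + (if dis then 0 else p * a * b)) * ?W A B" if "A \<in> Pow C" "B \<in> Pow C" for A B
  proof -
    have f: "finite A" "finite B" "x \<notin> A" "x \<notin> B" using that insert finite_subset by auto
    have c: "card (A \<union> insert x B) = Suc (card (A \<union> B))" "card (insert x A \<union> B) = Suc (card (A \<union> B))"
      "card (insert x A \<union> insert x B) = Suc (card (A \<union> B))"
      using f by (auto simp: insert_commute)
    have i: "A \<inter> insert x B = A \<inter> B" "insert x A \<inter> B = A \<inter> B" using f by auto
    show ?thesis unfolding label_weight_def c i using f by (auto simp: algebra_simps)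
  qed
  have "(\<Sum>A\<in>Pow (insert x C). \<Sum>B\<in>Pow (insert x C). ?W A B) =
    (\<Sum>A\<in>Pow C. \<Sum>B\<in>Pow C. ?W A B + ?W A (insert x B) + (?W (insert x A) B + ?W (insert x A) (insert x B)))"
    using insert by (simp add: sum_Pow_insert sum.distrib)
  also have "\<dots> = (\<Sum>A\<in>Pow C. \<Sum>B\<in>Pow C. (1 + p * a + p * b + (if dis then 0 else p * a * b)) * ?W A B)"
    by (intro sum.cong refl *)
  also have "\<dots> = (1 + p * a + p * b + (if dis then 0 else p * a * b)) * (\<Sum>A\<in>Pow C. \<Sum>B\<in>Pow C. ?W A B)"
    by (simp add: sum_distrib_left)
  finally show ?case using insert by simp
qed

lemma card_flags:
  assumes "proper R" "labelling M R e L" "i < 4"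
  shows "card {j. j < e i \<and> flag R L i j} = card {x\<in>label L i. depth R i x > 0}"
proof -
  have inj: "inj_on (\<lambda>x. depth R i x - 1) {x\<in>label L i. depth R i x > 0}"
  proof (rule inj_onI)
    fix x y assume "x \<in> {x\<in>label L i. depth R i x > 0}" "y \<in> {x\<in>label L i. depth R i x > 0}" "depth R i x - 1 = depth R i y - 1"
    hence "x \<in> label L i" "y \<in> label L i" "depth R i x > 0" "depth R i x = depth R i y" by auto
    thus "x = y" using assms unfolding labelling_def by blast
  qed
  have le: "depth R i x \<le> e i" if "x \<in> label L i" for x
  proof -
    have "x \<in> corners R e" using that assms(2) by (auto simp: label_def labelling_def split: if_splits)
    thus ?thesis using corners_iff[OF assms(1)] area_ext_iff[OF assms(1)] assms(3) by blast
  qed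
  have "(\<lambda>x. depth R i x - 1) ` {x\<in>label L i. depth R i x > 0} = {j. j < e i \<and> flag R L i j}"
  proof (intro equalityI subsetI)
    fix j assume "j \<in> (\<lambda>x. depth R i x - 1) ` {x\<in>label L i. depth R i x > 0}"
    then obtain x where "x \<in> label L i" "depth R i x > 0" "j = depth R i x - 1" by blast
    thus "j \<in> {j. j < e i \<and> flag R L i j}" using le[of x] unfolding flag_def by (auto intro!: bexI[of _ x])
  next
    fix j assume "j \<in> {j. j < e i \<and> flag R L i j}"
    then obtain x where "x \<in> label L i" "depth R i x = Suc j" unfolding flag_def by blast
    thus "j \<in> (\<lambda>x. depth R i x - 1) ` {x\<in>label L i. depth R i x > 0}" by (intro image_eqI[of _ _ x]) auto
  qed
  thus ?thesis using card_image[OF inj] by simp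
qed

text \<open>A corner site has positive depth in exactly one of two opposite directions, so every
  label flags exactly one strip of its pair and the powers in \<open>Pr_gapfree_upper\<close> add up
  to the number of labels.\<close>

lemma card_flags_pair:
  assumes "proper R" "labelling M R e L"
  shows "card {j. j < e 0 \<and> flag R L 0 j} + card {j. j < e 1 \<and> flag R L 1 j} = card (fst L)"
    and "card {j. j < e 2 \<and> flag R L 2 j} + card {j. j < e 3 \<and> flag R L 3 j} = card (snd L)"
proof -
  have sub: "fst L \<subseteq> corners R e" "snd L \<subseteq> corners R e" using assms(2) by (auto simp: labelling_def)
  have fin: "finite (fst L)" "finite (snd L)" using sub finite_corners finite_subset by blast+
  have "fst L = {x\<in>label L 0. depth R 0 x > 0} \<union> {x\<in>label L 1. depth R 1 x > 0}"
    using sub corners_iff[OF assms(1), of _ e] by (fastforce simp: label_def)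
  moreover have "{x\<in>label L 0. depth R 0 x > 0} \<inter> {x\<in>label L 1. depth R 1 x > 0} = {}"
    using depth_opposite[OF assms(1)] by fastforce
  ultimately show "card {j. j < e 0 \<and> flag R L 0 j} + card {j. j < e 1 \<and> flag R L 1 j} = card (fst L)"
    using fin by (simp add: card_flags[OF assms] card_Un_disjoint[symmetric] label_def)
  have "snd L = {x\<in>label L 2. depth R 2 x > 0} \<union> {x\<in>label L 3. depth R 3 x > 0}"
    using sub corners_iff[OF assms(1), of _ e] by (fastforce simp: label_def)
  moreover have "{x\<in>label L 2. depth R 2 x > 0} \<inter> {x\<in>label L 3. depth R 3 x > 0} = {}"
    using depth_opposite[OF assms(1)] by fastforce
  ultimately show "card {j. j < e 2 \<and> flag R L 2 j} + card {j. j < e 3 \<and> flag R L 3 j} = card (snd L)"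
    using fin by (simp add: card_flags[OF assms] card_Un_disjoint[symmetric] label_def)
qed

lemma Pr_indep_chain:
  assumes "dep K E" "dep L F" "K \<inter> L = {}"
  shows "Pr s (E \<inter> F) = Pr s E * Pr s F \<and> dep (K \<union> L) (E \<inter> F)"
  using Pr_indep[OF assms] dep_Int[OF dep_mono[OF assms(1)] dep_mono[OF assms(2)]] by auto

text \<open>The four families of strips, the corner sites and the outside of the enlarged rectangle
  are pairwise disjoint, so the event splits into independent factors.\<close>

lemma Pr_exploration_event:
  assumes R: "proper R" and lab: "labelling M R e L" and s: "s > 0" and k: "model_k M \<ge> 1"
  defines "a \<equiv> s * real (width R)" and "b \<equiv> s * real (height R)"
  shows "Pr s (exploration_event M R e L \<inter> survive M (ext R e)) \<le>
    exp (- (gk (model_k M) b * real (e 0 + e 1) + gk (model_k M) a * real (e 2 + e 3))) / ((1 - exp (- b))\<^sup>2 * (1 - exp (- a))\<^sup>2)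
    * label_weight (M = Frobse1) (1 - exp (- s)) (exp (- b) / (1 - exp (- b))) (exp (- a) / (1 - exp (- a))) (fst L) (snd L)
    * Pr s (survive M (ext R e))"
proof -
  let ?k = "model_k M"
  define cs where "cs = (\<lambda>i. map (\<lambda>j. (cell R i j, flag R L i j)) [0..<e i])"
  define F where "F = (\<lambda>i. gapfree ?k 0 (cs i))"
  define K where "K = (\<lambda>i. cells (cs i))"
  define z where "z = (\<lambda>i::nat. if i < 2 then b else a)"
  have wh: "width R \<ge> 1" "height R \<ge> 1" using R by (cases R; auto)+
  have zp: "z i > 0" for i using wh s by (auto simp: z_def a_def b_def)
  have K: "K i = (\<Union>j<e i. cell R i j)" for i by (auto simp: K_def cs_def cells_def)
  have KK: "K i \<inter> K i' = {}" if "i < i'" "i' < 4" for i i'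
  proof -
    have "\<not> (x \<in> cell R i j \<and> x \<in> cell R i' j')" for x j j'
    proof
      assume h: "x \<in> cell R i j \<and> x \<in> cell R i' j'"
      have "i < 4" using that by simp
      note c = cell_iff[OF R \<open>i < 4\<close>, of x j] cell_iff[OF R that(2), of x j']
      have "(i = 0 \<and> i' = 1) \<or> (i = 2 \<and> i' = 3) \<or> (i < 2 \<and> i' = 2) \<or> (i < 2 \<and> i' = 3)" using that by auto
      thus False using h c depth_opposite[OF R, of x] less_4[OF \<open>i < 4\<close>] by (elim disjE conjE; simp)
    qed
    thus ?thesis unfolding K by blast
  qed
  have KC: "K i \<inter> corners R e = {}" if "i < 4" for i
  proof -
    have "\<not> (x \<in> cell R i j \<and> x \<in> corners R e)" for x j
      using cell_iff[OF R that, of x j] corners_iff[OF R, of x e] by (auto split: if_splits)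
    thus ?thesis unfolding K by blast
  qed
  have KA: "K i \<subseteq> area (ext R e)" if "i < 4" for i
  proof
    fix x assume "x \<in> K i"
    then obtain j where "j < e i" "x \<in> cell R i j" unfolding K by blast
    thus "x \<in> area (ext R e)"
      using that less_4[OF that] cell_iff[OF R that, of x j] depth_opposite[OF R, of x]
      unfolding area_ext_iff[OF R] all_less_4
      by (elim disjE; cases "depth R 0 x > 0"; cases "depth R 2 x > 0"; simp)
  qed
  have CA: "corners R e \<subseteq> area (ext R e)" using corners_iff[OF R] by blast
  let ?O = "fst L \<union> snd L"
  have OC: "?O \<subseteq> corners R e" using lab by (auto simp: labelling_def)
  have dF: "dep (K i) (F i)" for i unfolding K_def F_def by (rule dep_gapfree)
  have dO: "dep (corners R e) (all_occ ?O)" by (rule dep_mono[OF dep_all_occ OC])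
  have 1: "Pr s (F 0 \<inter> F 1) = Pr s (F 0) * Pr s (F 1) \<and> dep (K 0 \<union> K 1) (F 0 \<inter> F 1)"
    by (rule Pr_indep_chain[OF dF dF]) (use KK in auto)
  have 2: "Pr s (F 0 \<inter> F 1 \<inter> F 2) = Pr s (F 0 \<inter> F 1) * Pr s (F 2) \<and> dep (K 0 \<union> K 1 \<union> K 2) (F 0 \<inter> F 1 \<inter> F 2)"
    by (rule Pr_indep_chain[OF conjunct2[OF 1] dF]) (use KK[of 0 2] KK[of 1 2] in auto)
  have 3: "Pr s (F 0 \<inter> F 1 \<inter> F 2 \<inter> F 3) = Pr s (F 0 \<inter> F 1 \<inter> F 2) * Pr s (F 3) \<and>
      dep (K 0 \<union> K 1 \<union> K 2 \<union> K 3) (F 0 \<inter> F 1 \<inter> F 2 \<inter> F 3)"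
    by (rule Pr_indep_chain[OF conjunct2[OF 2] dF]) (use KK[of 0 3] KK[of 1 3] KK[of 2 3] in auto)
  have 4: "Pr s (F 0 \<inter> F 1 \<inter> F 2 \<inter> F 3 \<inter> all_occ ?O) = Pr s (F 0 \<inter> F 1 \<inter> F 2 \<inter> F 3) * Pr s (all_occ ?O) \<and>
      dep (K 0 \<union> K 1 \<union> K 2 \<union> K 3 \<union> corners R e) (F 0 \<inter> F 1 \<inter> F 2 \<inter> F 3 \<inter> all_occ ?O)"
    by (rule Pr_indep_chain[OF conjunct2[OF 3] dO]) (use KC[of 0] KC[of 1] KC[of 2] KC[of 3] in auto)
  have 5: "Pr s (F 0 \<inter> F 1 \<inter> F 2 \<inter> F 3 \<inter> all_occ ?O \<inter> survive M (ext R e)) =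
      Pr s (F 0 \<inter> F 1 \<inter> F 2 \<inter> F 3 \<inter> all_occ ?O) * Pr s (survive M (ext R e))"
    by (rule Pr_indep[OF conjunct2[OF 4] dep_survive]) (use KA[of 0] KA[of 1] KA[of 2] KA[of 3] CA in auto)
  have inter: "(\<Inter>i<4. F i) = F 0 \<inter> F 1 \<inter> F 2 \<inter> F 3"
  proof -
    have "{..<4::nat} = {0, 1, 2, 3}" by auto
    thus ?thesis by (simp add: Int_assoc)
  qed
  have PO: "Pr s (all_occ ?O) = (1 - exp (- s)) ^ card ?O"
    using finite_subset[OF OC finite_corners] s by (intro Pr_all_occ) auto
  define \<beta> where "\<beta> = (\<lambda>i. exp (- z i) / (1 - exp (- z i)))"
  define n where "n = (\<lambda>i. card {j. j < e i \<and> flag R L i j})"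
  have PF: "Pr s (F i) \<le> exp (- (gk ?k (z i) * real (e i))) * \<beta> i ^ n i / (1 - exp (- z i))" if "i < 4" for i
  proof -
    have "length (filter snd (cs i)) = n i"
    proof -
      have "length (filter snd (cs i)) = length (filter (flag R L i) [0..<e i])"
        by (simp add: cs_def filter_map o_def)
      also have "\<dots> = card ({j. flag R L i j} \<inter> set [0..<e i])" by (rule distinct_length_filter) simp
      also have "{j. flag R L i j} \<inter> set [0..<e i] = {j. j < e i \<and> flag R L i j}" by auto
      finally show ?thesis by (simp add: n_def)
    qed
    moreover have "disj_cells (cs i)" unfolding cs_def
    proof (rule disj_cells_map)
      fix j j' :: nat assume "j \<noteq> j'"
      thus "cell R i j \<inter> cell R i j' = {}" using cell_iff[OF R that] by auto
    qed (auto simp: finite_cell)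
    moreover have "\<forall>c\<in>set (cs i). card (fst c) = (if i < 2 then height R else width R)"
      using card_cell[OF R that] by (auto simp: cs_def)
    moreover have "(if i < 2 then height R else width R) \<ge> 1" using wh by auto
    moreover have "s * real (if i < 2 then height R else width R) = z i" by (auto simp: z_def a_def b_def)
    moreover have "length (cs i) = e i" by (simp add: cs_def)
    ultimately show ?thesis using Pr_gapfree_upper[OF k s, of "if i < 2 then height R else width R" "cs i"]
      unfolding F_def \<beta>_def by simp
  qed
  let ?D = "\<lambda>i. exp (- (gk ?k (z i) * real (e i))) * \<beta> i ^ n i / (1 - exp (- z i))"
  have D0: "0 \<le> ?D i" "0 \<le> Pr s (F i)" for i using zp[of i] by (auto simp: \<beta>_def)
  have "Pr s (F 0) * Pr s (F 1) * Pr s (F 2) * Pr s (F 3) \<le> ?D 0 * ?D 1 * ?D 2 * ?D 3"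
    using D0 by (intro mult_mono PF mult_nonneg_nonneg) auto
  also have "\<dots> = exp (- (gk ?k b * real (e 0 + e 1) + gk ?k a * real (e 2 + e 3))) / ((1 - exp (- b))\<^sup>2 * (1 - exp (- a))\<^sup>2)
     * ((exp (- b) / (1 - exp (- b))) ^ card (fst L) * (exp (- a) / (1 - exp (- a))) ^ card (snd L))"
  proof -
    have e: "exp (- (gk ?k b * real (e 0 + e 1) + gk ?k a * real (e 2 + e 3))) =
      exp (- (gk ?k b * real (e 0))) * exp (- (gk ?k b * real (e 1))) * exp (- (gk ?k a * real (e 2))) * exp (- (gk ?k a * real (e 3)))"
      by (simp add: exp_add[symmetric] algebra_simps)
    have f: "card (fst L) = n 0 + n 1" "card (snd L) = n 2 + n 3" using card_flags_pair[OF R lab] by (auto simp: n_def)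
    show ?thesis unfolding e f by (simp add: z_def \<beta>_def power_add power2_eq_square mult_ac)
  qed
  finally have PP: "Pr s (F 0) * Pr s (F 1) * Pr s (F 2) * Pr s (F 3) \<le> \<dots>" .
  have dis: "\<not> (M = Frobse1 \<and> fst L \<inter> snd L \<noteq> {})" using lab by (auto simp: labelling_def)
  have "Pr s (exploration_event M R e L \<inter> survive M (ext R e)) =
    Pr s (F 0) * Pr s (F 1) * Pr s (F 2) * Pr s (F 3) * (1 - exp (- s)) ^ card ?O * Pr s (survive M (ext R e))"
    using 1 2 3 4 5 PO inter by (simp add: exploration_event_def F_def cs_def)
  also have "\<dots> \<le> exp (- (gk ?k b * real (e 0 + e 1) + gk ?k a * real (e 2 + e 3))) / ((1 - exp (- b))\<^sup>2 * (1 - exp (- a))\<^sup>2)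
     * ((exp (- b) / (1 - exp (- b))) ^ card (fst L) * (exp (- a) / (1 - exp (- a))) ^ card (snd L)) * (1 - exp (- s)) ^ card ?O * Pr s (survive M (ext R e))"
    using PP s by (intro mult_right_mono) auto
  finally show ?thesis unfolding label_weight_def if_not_P[OF dis] by (simp only: mult_ac)
qed

section \<open>The recursive inequality\<close>

definition explorations :: "perc_model \<Rightarrow> nat \<Rightarrow> nat \<Rightarrow> (nat \<Rightarrow> nat) set" where
  "explorations M A B = {e \<in> {..<4} \<rightarrow>\<^sub>E {..<A + B + model_k M}. (A \<le> e 0 + e 1 \<or> B \<le> e 2 + e 3) \<and>
     e 0 + e 1 < A + model_k M \<and> e 2 + e 3 < B + model_k M}"

lemma finite_explorations: "finite (explorations M A B)"
  unfolding explorations_def by (rule finite_subset[of _ "{..<4} \<rightarrow>\<^sub>E {..<A + B + model_k M}"]) (auto intro!: finite_PiE)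

lemma card_explorations: "card (explorations M A B) \<le> (A + B + model_k M) ^ 4"
proof -
  have "card (explorations M A B) \<le> card ({..<4::nat} \<rightarrow>\<^sub>E {..<A + B + model_k M})"
    unfolding explorations_def by (intro card_mono finite_PiE) auto
  thus ?thesis by (simp add: card_PiE)
qed

lemma survive_subset:
  assumes R: "proper R" and k: "model_k M \<ge> 1" and AB: "A \<ge> 1" "B \<ge> 1"
  shows "survive M R \<subseteq> (\<Union>e\<in>explorations M A B. \<Union>L\<in>{L \<in> Pow (corners R e) \<times> Pow (corners R e). labelling M R e L}.
     exploration_event M R e L \<inter> survive M (ext R e))"
proof
  fix \<omega> assume S: "\<omega> \<in> survive M R"
  obtain e L where e: "explored M R \<omega> e L" "e 0 + e 1 \<ge> A \<or> e 2 + e 3 \<ge> B" "e 0 + e 1 < A + model_k M" "e 2 + e 3 < B + model_k M"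
    using exploration_stops[OF R k S explored_0[OF k], of A B] AB by auto
  \<comment> \<open>Restriction to the four sides selects one representative of each extent, so that
    the union bound runs over a finite set.\<close>
  define e' where "e' = restrict e {..<4}"
  have ee: "e i = e' i" if "i < 4" for i using that by (simp add: e'_def)
  have e0: "e' 0 = e 0" "e' 1 = e 1" "e' 2 = e 2" "e' 3 = e 3" using ee by auto
  have "e' i < A + B + model_k M" if "i < 4" for i
    using less_4[OF that] e(3,4) e0 by (elim disjE) auto
  hence "e' \<in> explorations M A B" unfolding explorations_def using e(2-4) e0 by (auto simp: e'_def)
  moreover have "\<omega> \<in> exploration_event M R e' L" "labelling M R e' L"
    using explored_event[OF e(1) k] e(1) exploration_event_cong(1)[OF ee, where M = M and R = R and L = L]
      exploration_event_cong(2)[OF ee, where M = M and R = R and L = L] unfolding explored_def by auto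
  moreover have "\<omega> \<in> survive M (ext R e')" using S survive_mono[OF included_ext] by blast
  moreover have "L \<in> Pow (corners R e') \<times> Pow (corners R e')"
    using \<open>labelling M R e' L\<close> unfolding labelling_def by (auto simp: mem_Times_iff)
  ultimately show "\<omega> \<in> (\<Union>e\<in>explorations M A B. \<Union>L\<in>{L \<in> Pow (corners R e) \<times> Pow (corners R e). labelling M R e L}.
     exploration_event M R e L \<inter> survive M (ext R e))" by blast
qed

lemma exploration_event_measurable: "exploration_event M R e L \<in> cevents"
proof -
  have "dep UNIV (exploration_event M R e L)"
    unfolding exploration_event_def
    by (intro dep_Int dep_INT countableI_type dep_mono[OF dep_gapfree] dep_mono[OF dep_all_occ]) auto
  thus ?thesis by (rule dep_events)
qed

text \<open>Union bound over extents and labels. The label sum is \<open>(1 + p * v)\<close> raised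
  to the number of corner sites, and \<open>p <= s\<close> turns it into the exponential.\<close>

lemma Pr_survive_step:
  assumes R: "proper R" and s: "s > 0" and k: "model_k M \<ge> 1" and AB: "A \<ge> 1" "B \<ge> 1"
  defines "a \<equiv> s * real (width R)" and "b \<equiv> s * real (height R)"
  defines "\<alpha> \<equiv> exp (- a) / (1 - exp (- a))" and "\<beta> \<equiv> exp (- b) / (1 - exp (- b))"
  shows "Pr s (survive M R) \<le> (\<Sum>e\<in>explorations M A B.
    exp (s * real ((e 0 + e 1) * (e 2 + e 3)) * (\<beta> + \<alpha> + (if M = Frobse1 then 0 else \<beta> * \<alpha>))
      - (gk (model_k M) b * real (e 0 + e 1) + gk (model_k M) a * real (e 2 + e 3)))
      / ((1 - exp (- b))\<^sup>2 * (1 - exp (- a))\<^sup>2) * Pr s (survive M (ext R e)))"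
proof -
  interpret prob_space "config_measure s" by (rule prob_space_config)
  let ?k = "model_k M" and ?p = "1 - exp (- s)"
  let ?Ls = "\<lambda>e. {L \<in> Pow (corners R e) \<times> Pow (corners R e). labelling M R e L}"
  let ?c = "\<lambda>e. exp (- (gk ?k b * real (e 0 + e 1) + gk ?k a * real (e 2 + e 3))) / ((1 - exp (- b))\<^sup>2 * (1 - exp (- a))\<^sup>2)"
  let ?W = "label_weight (M = Frobse1) ?p \<beta> \<alpha>"
  have wh: "width R \<ge> 1" "height R \<ge> 1" using R by (cases R; auto)+
  have ab: "a > 0" "b > 0" using wh s by (auto simp: a_def b_def)
  have al: "\<alpha> \<ge> 0" "\<beta> \<ge> 0" using ab by (auto simp: \<alpha>_def \<beta>_def)
  have p: "0 \<le> ?p" "?p \<le> s" using s exp_ge_add_one_self[of "- s"] by auto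
  have W0: "?W X Y \<ge> 0" for X Y using p al by (simp add: label_weight_def)
  have finL: "finite (?Ls e)" for e
    by (rule finite_subset[of _ "Pow (corners R e) \<times> Pow (corners R e)"]) (auto simp: finite_corners)
  have ev: "exploration_event M R e L \<inter> survive M (ext R e) \<in> sets (config_measure s)" for e L
    by (intro sets.Int) (simp_all only: sets_config exploration_event_measurable dep_events[OF dep_survive])
  have "Pr s (survive M R) \<le> Pr s (\<Union>e\<in>explorations M A B. \<Union>L\<in>?Ls e. exploration_event M R e L \<inter> survive M (ext R e))"
    by (rule finite_measure_mono[OF survive_subset[OF R k AB]])
       (intro sets.finite_UN finite_explorations finL ev)
  also have "\<dots> \<le> (\<Sum>e\<in>explorations M A B. Pr s (\<Union>L\<in>?Ls e. exploration_event M R e L \<inter> survive M (ext R e)))"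
    by (rule finite_measure_subadditive_finite[OF finite_explorations], rule image_subsetI, intro sets.finite_UN finL ev)
  also have "\<dots> \<le> (\<Sum>e\<in>explorations M A B. \<Sum>L\<in>?Ls e. Pr s (exploration_event M R e L \<inter> survive M (ext R e)))"
    by (intro sum_mono finite_measure_subadditive_finite finL) (use ev in auto)
  also have "\<dots> \<le> (\<Sum>e\<in>explorations M A B.
    exp (s * real ((e 0 + e 1) * (e 2 + e 3)) * (\<beta> + \<alpha> + (if M = Frobse1 then 0 else \<beta> * \<alpha>))
      - (gk ?k b * real (e 0 + e 1) + gk ?k a * real (e 2 + e 3)))
      / ((1 - exp (- b))\<^sup>2 * (1 - exp (- a))\<^sup>2) * Pr s (survive M (ext R e)))"
  proof (rule sum_mono)
    fix e
    let ?S = "Pr s (survive M (ext R e))" and ?n = "(e 0 + e 1) * (e 2 + e 3)"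
    let ?v = "\<beta> + \<alpha> + (if M = Frobse1 then 0 else \<beta> * \<alpha>)"
    have c0: "?c e \<ge> 0" by simp
    have v0: "?v \<ge> 0" using al by auto
    have "(\<Sum>L\<in>?Ls e. Pr s (exploration_event M R e L \<inter> survive M (ext R e))) \<le> (\<Sum>L\<in>?Ls e. ?c e * ?W (fst L) (snd L) * ?S)"
    proof (rule sum_mono)
      fix L assume "L \<in> ?Ls e"
      hence "labelling M R e L" by simp
      from Pr_exploration_event[OF R this s k]
      show "Pr s (exploration_event M R e L \<inter> survive M (ext R e)) \<le> ?c e * ?W (fst L) (snd L) * ?S"
        unfolding a_def[symmetric] b_def[symmetric] \<alpha>_def[symmetric] \<beta>_def[symmetric] .
    qed
    also have "\<dots> \<le> (\<Sum>L\<in>Pow (corners R e) \<times> Pow (corners R e). ?c e * ?W (fst L) (snd L) * ?S)"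
      using c0 W0 by (intro sum_mono2) (auto simp: finite_corners intro!: mult_nonneg_nonneg)
    also have "\<dots> = ?c e * (\<Sum>X\<in>Pow (corners R e). \<Sum>Y\<in>Pow (corners R e). ?W X Y) * ?S"
    proof -
      have "(\<Sum>X\<in>Pow (corners R e). \<Sum>Y\<in>Pow (corners R e). ?W X Y) = (\<Sum>L\<in>Pow (corners R e) \<times> Pow (corners R e). ?W (fst L) (snd L))"
        by (simp add: sum.cartesian_product split_beta)
      thus ?thesis by (simp only: sum_distrib_left sum_distrib_right)
    qed
    also have "(\<Sum>X\<in>Pow (corners R e). \<Sum>Y\<in>Pow (corners R e). ?W X Y) = (1 + ?p * \<beta> + ?p * \<alpha> + (if M = Frobse1 then 0 else ?p * \<beta> * \<alpha>)) ^ ?n"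
      unfolding label_weight_sum[OF finite_corners] card_corners[OF R] ..
    also have "1 + ?p * \<beta> + ?p * \<alpha> + (if M = Frobse1 then 0 else ?p * \<beta> * \<alpha>) = 1 + ?p * ?v" by (simp add: algebra_simps)
    also have "?c e * (1 + ?p * ?v) ^ ?n * ?S \<le> ?c e * exp (s * real ?n * ?v) * ?S"
    proof (intro mult_right_mono mult_left_mono)
      have "1 + ?p * ?v \<le> exp (s * ?v)"
        using exp_ge_add_one_self[of "s * ?v"] mult_right_mono[OF p(2) v0] by linarith
      hence "(1 + ?p * ?v) ^ ?n \<le> exp (s * ?v) ^ ?n" using p v0 by (intro power_mono) auto
      thus "(1 + ?p * ?v) ^ ?n \<le> exp (s * real ?n * ?v)" by (simp add: exp_of_nat_mult[symmetric] mult_ac)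
    qed (use c0 in auto)
    also have "?c e * exp (s * real ?n * ?v) * ?S = exp (s * real ?n * ?v - (gk ?k b * real (e 0 + e 1) + gk ?k a * real (e 2 + e 3)))
      / ((1 - exp (- b))\<^sup>2 * (1 - exp (- a))\<^sup>2) * ?S"
      by (simp only: exp_diff exp_minus divide_inverse) (simp only: mult_ac)
    finally show "(\<Sum>L\<in>?Ls e. Pr s (exploration_event M R e L \<inter> survive M (ext R e))) \<le>
      exp (s * real ?n * ?v - (gk ?k b * real (e 0 + e 1) + gk ?k a * real (e 2 + e 3)))
      / ((1 - exp (- b))\<^sup>2 * (1 - exp (- a))\<^sup>2) * ?S" .
  qed
  finally show ?thesis .
qed

section \<open>The potential\<close>

locale cost =
  fixes g G :: "real \<Rightarrow> real"
  assumes conv: "convex_on {0<..} g"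
    and anti: "\<And>x y. 0 < x \<Longrightarrow> x \<le> y \<Longrightarrow> g y \<le> g x"
    and deriv: "\<And>z. z > 0 \<Longrightarrow> (G has_real_derivative - g z) (at z)"
begin

lemma chord: assumes "0 < x" "x \<le> t" "t \<le> y" "x < y"
  shows "(y - x) * g t \<le> (y - t) * g x + (t - x) * g y"
proof -
  define w where "w = (t - x) / (y - x)"
  have w: "0 \<le> w" "w \<le> 1" using assms by (auto simp: w_def)
  have wy: "w * (y - x) = t - x" using assms by (simp add: w_def)
  hence "(1 - w) *\<^sub>R x + w *\<^sub>R y = t" by (simp add: algebra_simps)
  hence "g t \<le> (1 - w) * g x + w * g y"
    using convex_onD[OF conv w, of x y] assms by simp
  hence "(y - x) * g t \<le> (y - x) * ((1 - w) * g x + w * g y)" using assms by (intro mult_left_mono) auto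
  also have "\<dots> = ((y - x) - w * (y - x)) * g x + (w * (y - x)) * g y" by (simp add: algebra_simps)
  finally show ?thesis unfolding wy by simp
qed

text \<open>A convex function lies below its chord, whose slope is \<open>m\<close>;
  \<open>?F\<close> compares \<open>G\<close> with the antiderivative of the chord.\<close>

lemma trapezoid: assumes "0 < x" "x \<le> y" shows "G x - G y \<le> (y - x) * (g x + g y) / 2"
proof (cases "x = y")
  case False
  hence xy: "x < y" using assms by simp
  define m where "m = (g y - g x) / (y - x)"
  let ?F = "\<lambda>t. G t + g x * (t - x) + m * (t - x)\<^sup>2 / 2"
  have "?F x \<le> ?F y"
  proof (rule DERIV_nonneg_imp_nondecreasing[where f = ?F and a = x and b = y])
    fix t assume t: "x \<le> t" "t \<le> y"
    have "((\<lambda>t. g x * (t - x) + m * (t - x)\<^sup>2 / 2) has_real_derivative g x + m * (t - x)) (at t)"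
      by (auto intro!: derivative_eq_intros)
    from DERIV_add[OF deriv this] have d: "(?F has_real_derivative - g t + (g x + m * (t - x))) (at t)"
      using t assms by (simp add: add.assoc)
    have "g t \<le> ((y - t) * g x + (t - x) * g y) / (y - x)"
      using chord[OF assms(1) t xy] xy by (simp add: pos_le_divide_eq mult.commute)
    also have "\<dots> = g x + m * (t - x)" using xy by (simp add: m_def field_simps)
    finally show "\<exists>z. (?F has_real_derivative z) (at t) \<and> 0 \<le> z" using d
      by (intro exI[of _ "- g t + (g x + m * (t - x))"]) auto
  qed (use xy in simp)
  moreover have "m * (y - x)\<^sup>2 = (g y - g x) * (y - x)" using xy by (simp add: m_def power2_eq_square)
  ultimately have "G x \<le> G y + g x * (y - x) + (g y - g x) * (y - x) / 2" by simp
  moreover have "(y - x) * (g x + g y) / 2 = g x * (y - x) + (g y - g x) * (y - x) / 2" by (simp add: field_simps)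
  ultimately show ?thesis by linarith
qed simp

definition W :: "real \<Rightarrow> real \<Rightarrow> real" where
  "W x y = (max x y - min x y) * g (max x y) + 2 * G (max x y)"

lemma W_commute: "W x y = W y x" by (simp add: W_def max.commute min.commute)

text \<open>While the growing side is the shorter one the potential changes by exactly this amount.
  Afterwards the integral is bounded by a trapezoid, and the claim becomes the chord inequality at
  \<open>x\<close> between \<open>y\<close> and \<open>x'\<close>. A step crossing the diagonal is
  split there.\<close>

lemma W_step1: assumes "0 < y" "0 < x" "x \<le> x'" shows "W x y - W x' y \<le> g y * (x' - x)"
proof -
  have low: "W x y - W x' y = g y * (x' - x)" if "x \<le> x'" "x' \<le> y" for x x'
    using that by (simp add: W_def max_def min_def algebra_simps)
  have high: "W x y - W x' y \<le> g y * (x' - x)" if "y \<le> x" "x \<le> x'" for x x'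
  proof (cases "x' = y")
    case False
    hence "y < x'" using that by simp
    have "W x y = (x - y) * g x + 2 * G x" "W x' y = (x' - y) * g x' + 2 * G x'"
      using that False by (auto simp: W_def max_def min_def)
    hence "W x y - W x' y \<le> (x - y) * g x - (x' - y) * g x' + (x' - x) * (g x + g x')"
      using trapezoid[of x x'] that assms by simp
    also have "\<dots> = (x' - y) * g x - (x - y) * g x'" by (simp add: algebra_simps)
    also have "\<dots> \<le> (x' - x) * g y"
      using chord[of y x x'] that assms \<open>y < x'\<close> by simp
    finally show ?thesis by (simp add: mult.commute)
  qed (use that in simp)
  consider "x' \<le> y" | "y \<le> x" | "x \<le> y" "y \<le> x'" by linarith
  thus ?thesis
  proof cases
    case 3
    have "W x y - W x' y \<le> g y * (y - x) + g y * (x' - y)" using low[of x y] high[of y x'] 3 by linarith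
    thus ?thesis by (simp add: algebra_simps)
  qed (use low high assms in auto)
qed

text \<open>Diagonal growth is cheapest because the cost is convex and decreasing.\<close>
lemma W_step: assumes "0 < x" "x \<le> x'" "0 < y" "y \<le> y'"
  shows "W x y - W x' y' \<le> g y * (x' - x) + g x * (y' - y)"
proof -
  have "W x' y - W x' y' \<le> g x' * (y' - y)"
    using W_step1[of x' y y'] assms by (simp add: W_commute)
  also have "\<dots> \<le> g x * (y' - y)" using assms by (intro mult_right_mono anti) auto
  finally show ?thesis using W_step1[of y x x'] assms by linarith
qed

end

section \<open>Counting the rounds of exploration\<close>

lemma nu_deriv: "z > 0 \<Longrightarrow> ((\<lambda>z. ln (exp z - 1)) has_real_derivative 1 / (1 - exp (- z))) (at (z::real))"
  by (auto intro!: derivative_eq_intros simp: exp_minus field_simps)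

text \<open>A bound for the number of rounds left at scaled side \<open>z\<close>. A complete round
  in this dimension moves \<open>z\<close> by at least \<open>h * (1 - exp (- z))\<close> with
  \<open>h = sqrt s * ln (1 / s)\<close>. The coordinate \<open>ln (exp z - 1)\<close> has
  derivative \<open>1 / (1 - exp (- z))\<close> and so moves by at least \<open>h / 2\<close>. The
  end point is \<open>ln (1 / s) + 1\<close>, since the comparison step is at most one.\<close>

definition steps :: "real \<Rightarrow> real \<Rightarrow> real" where
  "steps s z = 2 / (sqrt s * ln (1 / s)) * max 0 (ln (exp (ln (1 / s) + 1) - 1) - ln (exp z - 1))"

lemma steps_anti: assumes "0 < s" "s < 1" "0 < z" "z \<le> w" shows "steps s w \<le> steps s z"
proof -
  have "exp z \<le> exp w" using assms by simp
  moreover have "exp z > 1" using assms by simp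
  ultimately have "ln (exp z - 1) \<le> ln (exp w - 1)" by (subst ln_le_cancel_iff) auto
  moreover have "2 / (sqrt s * ln (1 / s)) \<ge> 0" using assms by simp
  ultimately show ?thesis unfolding steps_def by (intro mult_left_mono) auto
qed

lemma steps_nonneg: assumes "0 < s" "s < 1" shows "steps s z \<ge> 0"
  unfolding steps_def using assms by (intro mult_nonneg_nonneg) auto

lemma steps_decrease:
  assumes s: "0 < s" "s < 1" and T: "sqrt s * ln (1 / s) \<le> 1" and z: "0 < z" "z \<le> ln (1 / s)"
    and w: "w \<ge> z + sqrt s * ln (1 / s) * (1 - exp (- z))"
  shows "steps s w + 1 \<le> steps s z"
proof -
  define h where "h = sqrt s * ln (1 / s)"
  have h: "h > 0" "h \<le> 1" using s T by (auto simp: h_def)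
  let ?u = "1 - exp (- z)"
  have u: "0 < ?u" "?u < 1" using z by auto
  define z' where "z' = z + h * ?u"
  have zz: "z < z'" "z' \<le> z + 1" using h u mult_le_one[of h ?u] by (auto simp: z'_def)
  have "\<And>x. z \<le> x \<Longrightarrow> x \<le> z' \<Longrightarrow> ((\<lambda>z. ln (exp z - 1)) has_real_derivative 1 / (1 - exp (- x))) (at x)"
    using z by (intro nu_deriv) auto
  from MVT2[OF zz(1) this] obtain \<xi> where \<xi>: "z < \<xi>" "\<xi> < z'"
    "ln (exp z' - 1) - ln (exp z - 1) = (z' - z) * (1 / (1 - exp (- \<xi>)))" by auto
  \<comment> \<open>Within one step \<open>1 - exp (- z)\<close> at most doubles, because the step
    itself is at most \<open>?u\<close>.\<close>
  have "1 - exp (- \<xi>) \<le> 2 * ?u"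
  proof -
    have "exp (- \<xi>) \<ge> exp (- z')" using \<xi> by simp
    moreover have "exp (- z') = exp (- z) * exp (- (z' - z))" by (simp add: exp_add[symmetric])
    moreover have "1 - (z' - z) \<le> exp (- (z' - z))" using exp_ge_add_one_self[of "- (z' - z)"] by linarith
    hence "exp (- z) * exp (- (z' - z)) \<ge> exp (- z) * (1 - (z' - z))" by (rule mult_left_mono) simp
    moreover have "exp (- z) * (z' - z) \<le> 1 * (1 * ?u)" using h u zz z by (intro mult_mono) (auto simp: z'_def)
    ultimately show ?thesis by (simp add: algebra_simps)
  qed
  moreover have "1 - exp (- \<xi>) > 0" using \<xi> z by simp
  ultimately have "1 / (1 - exp (- \<xi>)) \<ge> 1 / (2 * ?u)" using u by (intro divide_left_mono) auto
  hence "(z' - z) * (1 / (1 - exp (- \<xi>))) \<ge> (z' - z) * (1 / (2 * ?u))" using zz by (intro mult_left_mono) auto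
  moreover have "(z' - z) * (1 / (2 * ?u)) = h / 2"
  proof -
    have "h * U * (1 / (2 * U)) = h / 2" if "U > 0" for U using that by simp
    from this[OF u(1)] show ?thesis by (simp only: z'_def add_diff_cancel_left')
  qed
  ultimately have inc: "ln (exp z' - 1) - ln (exp z - 1) \<ge> h / 2" by (simp only: \<xi>(3))
  let ?B = "ln (exp (ln (1 / s) + 1) - 1)"
  have "exp z' \<le> exp (ln (1 / s) + 1)" "exp z' > 1" using zz z by auto
  hence B: "ln (exp z' - 1) \<le> ?B" by (subst ln_le_cancel_iff) auto
  have "steps s w \<le> steps s z'"
  proof (rule steps_anti[OF s])
    show "0 < z'" using zz(1) z(1) by linarith
    show "z' \<le> w" using w by (simp add: z'_def h_def)
  qed
  also have "steps s z' + 1 \<le> steps s z"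
  proof -
    have "steps s z' = 2 / h * (?B - ln (exp z' - 1))" "steps s z = 2 / h * (?B - ln (exp z - 1))"
      using B inc h by (auto simp: steps_def h_def max_def)
    hence "steps s z - steps s z' = 2 / h * (ln (exp z' - 1) - ln (exp z - 1))" by (simp add: algebra_simps)
    also have "\<dots> \<ge> 2 / h * (h / 2)" using inc h by (intro mult_left_mono) auto
    finally show ?thesis using h by simp
  qed
  finally show ?thesis by linarith
qed

text \<open>From \<open>sqrt s\<close> on, the coordinate \<open>ln (exp z - 1)\<close> is at least
  \<open>- ln (1 / s) / 2\<close>, so the total range is at most
  \<open>5/2 * ln (1 / s)\<close>.\<close>

lemma steps_start:
  assumes s: "0 < s" "ln (1 / s) \<ge> 1" and x: "sqrt s \<le> x" shows "steps s x \<le> 5 / sqrt s"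
proof -
  let ?T = "ln (1 / s)"
  have sp: "sqrt s > 0" using s by simp
  have "ln (exp (?T + 1) - 1) \<le> ln (exp (?T + 1))" using s by (subst ln_le_cancel_iff) auto
  hence 1: "ln (exp (?T + 1) - 1) \<le> ?T + 1" by simp
  have 2: "sqrt s \<le> exp x - 1" using exp_ge_add_one_self[of x] x by linarith
  hence "exp x - 1 > 0" using sp by linarith
  hence "ln (sqrt s) \<le> ln (exp x - 1)" using ln_le_cancel_iff[OF sp] 2 by blast
  moreover have "ln (sqrt s) = - ?T / 2" using s by (simp add: ln_sqrt ln_div)
  ultimately have "max 0 (ln (exp (?T + 1) - 1) - ln (exp x - 1)) \<le> 5 / 2 * ?T"
    using 1 s(2) by (intro max.boundedI) linarith+
  moreover have "0 \<le> 2 / (sqrt s * ?T)" using mult_pos_pos[OF sp, of ?T] s(2) by simp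
  ultimately have "steps s x \<le> 2 / (sqrt s * ?T) * (5 / 2 * ?T)" unfolding steps_def by (rule mult_left_mono)
  also have "\<dots> = 5 / sqrt s"
  proof -
    have "2 / (X * Y) * (5 / 2 * Y) = 5 / X" if "Y > 0" for X Y :: real using that by simp
    moreover have "?T > 0" using s(2) by linarith
    ultimately show ?thesis by blast
  qed
  finally show ?thesis .
qed

text \<open>The exploration of a rectangle of width \<open>a\<close> is stopped once it has gained
  \<open>s\<^sup>-\<^sup>1\<^sup>/\<^sup>2 ln (1/s) (1 - exp (- s a))\<close> columns (or, similarly, rows): this balances the number of
  explorations against the error from the corners.\<close>

definition gain :: "real \<Rightarrow> nat \<Rightarrow> real" where
  "gain s a = ln (1 / s) / sqrt s * (1 - exp (- (s * real a)))"

text \<open>The cost \<open>g\<close> may lie below the true rate. The corner error of a round is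
  paid by \<open>err\<close> or by the difference of the two rates; the general case uses only the
  former and Frobse only the latter.\<close>

locale upper_bound = cost g G for g G :: "real \<Rightarrow> real" +
  fixes M :: perc_model and s err :: real
  assumes valid: "valid_model M" and s: "0 < s" "s < 1" and T: "ln (1 / s) \<ge> 3" "sqrt s * ln (1 / s) \<le> 1"
    and small: "2 * (ln (1 / s) / sqrt s) + real (model_k M) + 2 \<le> 1 / s"
    and g_le: "\<And>z. z > 0 \<Longrightarrow> g z \<le> gk (model_k M) z" and G_le: "\<And>z. z > 0 \<Longrightarrow> G z \<le> Gam (model_k M) z"
    and err: "err \<ge> 0" "\<And>a b m n. 1 \<le> gain s a \<Longrightarrow> 1 \<le> gain s b \<Longrightarrow>
      real m \<le> gain s a + real (model_k M) \<Longrightarrow> real n \<le> gain s b + real (model_k M) \<Longrightarrow> a \<ge> 1 \<Longrightarrow> b \<ge> 1 \<Longrightarrow>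
      s * real (m * n) * (exp (- (s * real b)) / (1 - exp (- (s * real b))) + exp (- (s * real a)) / (1 - exp (- (s * real a)))
        + (if M = Frobse1 then 0 else exp (- (s * real b)) / (1 - exp (- (s * real b))) * (exp (- (s * real a)) / (1 - exp (- (s * real a))))))
      \<le> err + (gk (model_k M) (s * real b) - g (s * real b)) * real m + (gk (model_k M) (s * real a) - g (s * real a)) * real n"
begin

abbreviation "TT \<equiv> ln (1 / s)"

lemma k_pos: "model_k M \<ge> 1"
  using valid by (cases M) (auto simp: valid_model_def model_k_def)

text \<open>Beyond scaled side \<open>ln (1 / s)\<close> the potential is so small that the trivial
  bound by one suffices; this ends the recursion.\<close>

lemma W_large: assumes "0 < x" "0 < y" "TT \<le> max x y" shows "W x y \<le> s * (2 * TT + 4)"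
proof -
  define m where "m = max x y"
  have m: "m \<ge> TT" "m \<ge> 1" "m > 0" using assms T by (auto simp: m_def)
  have e: "exp (- m) \<le> s"
  proof -
    have "exp (- m) \<le> exp (- TT)" using m by simp
    also have "exp (- TT) = s" using s by (simp add: exp_minus)
    finally show ?thesis .
  qed
  have me: "m * exp (- m) \<le> TT * s"
  proof -
    have "TT * exp (- TT) \<ge> m * exp (- m)"
    proof (rule DERIV_nonpos_imp_nonincreasing[where f = "\<lambda>x. x * exp (- x)"])
      fix x assume "TT \<le> x" "x \<le> m"
      hence "(1 - x) * exp (- x) \<le> 0" using T by (intro mult_nonpos_nonneg) auto
      moreover have "((\<lambda>x. x * exp (- x)) has_real_derivative (1 - x) * exp (- x)) (at x)"
        by (auto intro!: derivative_eq_intros simp: algebra_simps)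
      ultimately show "\<exists>y. ((\<lambda>x. x * exp (- x)) has_real_derivative y) (at x) \<and> y \<le> 0" by blast
    qed (use m in simp)
    moreover have "exp (- TT) = s" using s by (simp add: exp_minus)
    ultimately show ?thesis by simp
  qed
  have g1: "g m \<le> 2 * exp (- m)" using g_le[OF m(3)] gk_le_large[OF k_pos m(2)] by linarith
  have "W x y = (m - min x y) * g m + 2 * G m" by (simp add: W_def m_def)
  also have "(m - min x y) * g m \<le> (m - min x y) * (2 * exp (- m))" using g1 by (intro mult_left_mono) (auto simp: m_def)
  also have "\<dots> \<le> m * (2 * exp (- m))" using assms by (intro mult_right_mono) auto
  also have "2 * G m \<le> 2 * (2 * exp (- m))" using G_le[OF m(3)] Gam_le_large[OF k_pos m(2)] by linarith
  finally show ?thesis using me e by (simp add: algebra_simps)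
qed

text \<open>The potential \<open>W\<close> pays for the new columns and rows. Beyond that a round
  costs \<open>4 * TT\<close> for at most \<open>s^(-4)\<close> extents, \<open>5 * TT\<close> for
  the denominators, and \<open>err\<close> for the corners; as \<open>steps\<close> drops by at
  least one per round, the multiple of \<open>steps\<close> pays for this.\<close>

lemma survive_bound:
  assumes "proper R" "real (width R) \<ge> 1 / sqrt s" "real (height R) \<ge> 1 / sqrt s"
  shows "Pr s (survive M R) \<le> exp (- W (s * real (width R)) (s * real (height R)) / s
    + (9 * TT + err) * (steps s (s * real (width R)) + steps s (s * real (height R))) + (2 * TT + 4))"
  using assms
proof (induction "2 * nat \<lceil>TT / s\<rceil> - (width R + height R)" arbitrary: R rule: less_induct)
  case less
  let ?k = "model_k M" and ?a = "width R" and ?b = "height R"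
  let ?e = "9 * TT + err"
  have sq: "sqrt s > 0" "sqrt s < 1" "sqrt s * sqrt s = s" using s by auto
  have wh: "?a \<ge> 1" "?b \<ge> 1" using less.prems(1) by (cases R; auto)+
  have ab: "s * real ?a > 0" "s * real ?b > 0" using wh s by auto
  have e0: "?e \<ge> 0" using T err by simp
  show ?case
  proof (cases "TT \<le> max (s * real ?a) (s * real ?b)")
    case True
    have "W (s * real ?a) (s * real ?b) / s \<le> 2 * TT + 4" using W_large[OF ab True] s by (simp add: field_simps)
    moreover have "?e * (steps s (s * real ?a) + steps s (s * real ?b)) \<ge> 0"
      using steps_nonneg[OF s] by (intro mult_nonneg_nonneg[OF e0] add_nonneg_nonneg) auto
    ultimately have "0 \<le> - W (s * real ?a) (s * real ?b) / s + ?e * (steps s (s * real ?a) + steps s (s * real ?b)) + (2 * TT + 4)"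
      by simp
    hence "1 \<le> exp (- W (s * real ?a) (s * real ?b) / s + ?e * (steps s (s * real ?a) + steps s (s * real ?b)) + (2 * TT + 4))"
      by simp
    thus ?thesis using Pr_le_1 by (rule order_trans[rotated])
  next
    case False
    hence lt: "s * real ?a < TT" "s * real ?b < TT" by auto
    have sab: "s * real ?a \<ge> sqrt s" "s * real ?b \<ge> sqrt s"
    proof -
      have "s * (1 / sqrt s) = sqrt s" using sq by (simp add: real_div_sqrt)
      thus "s * real ?a \<ge> sqrt s" "s * real ?b \<ge> sqrt s"
        using less.prems(2,3) s mult_left_mono[of "1 / sqrt s" _ s] by (metis less_imp_le)+
    qed
    have u: "1 - exp (- z) \<ge> sqrt s / 2" if "z \<ge> sqrt s" for z
    proof -
      have "sqrt s / 2 \<le> 1 - exp (- sqrt s)" using sq by (intro one_minus_exp_ge) auto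
      also have "\<dots> \<le> 1 - exp (- z)" using that by simp
      finally show ?thesis .
    qed
    have gain1: "gain s c \<ge> 1" "gain s c \<le> TT / sqrt s" if "s * real c \<ge> sqrt s" for c
    proof -
      have "TT / sqrt s * (sqrt s / 2) \<le> gain s c" unfolding gain_def using u[OF that] T sq by (intro mult_left_mono) auto
      moreover have "TT / sqrt s * (sqrt s / 2) = TT / 2" using sq by simp
      ultimately show "gain s c \<ge> 1" using T by linarith
      show "gain s c \<le> TT / sqrt s" unfolding gain_def using T sq by (intro mult_left_le) auto
    qed
    define A where "A = nat \<lceil>gain s ?a\<rceil>"
    define B where "B = nat \<lceil>gain s ?b\<rceil>"
    have AB: "A \<ge> 1" "B \<ge> 1" "real A \<ge> gain s ?a" "real B \<ge> gain s ?b" "real A \<le> gain s ?a + 1" "real B \<le> gain s ?b + 1"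
      using gain1[OF sab(1)] gain1[OF sab(2)] unfolding A_def B_def by linarith+
    let ?E = "explorations M A B"
    let ?X = "exp (- W (s * real ?a) (s * real ?b) / s + ?e * (steps s (s * real ?a) + steps s (s * real ?b)) + (2 * TT + 4) - 4 * TT)"
    have card: "real (card ?E) \<le> exp (4 * TT)"
    proof -
      have "real (card ?E) \<le> real ((A + B + ?k) ^ 4)" using card_explorations of_nat_mono by blast
      also have "\<dots> = (real A + real B + real ?k) ^ 4" by simp
      also have "\<dots> \<le> (1 / s) ^ 4"
        using AB gain1[OF sab(1)] gain1[OF sab(2)] small by (intro power_mono) auto
      also have "\<dots> = exp (4 * TT)" using s exp_of_nat_mult[of 4 TT] by (simp add: exp_minus)
      finally show ?thesis .
    qed
    have summand: "exp (s * real ((e 0 + e 1) * (e 2 + e 3)) * (exp (- (s * real ?b)) / (1 - exp (- (s * real ?b))) + exp (- (s * real ?a)) / (1 - exp (- (s * real ?a)))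
        + (if M = Frobse1 then 0 else exp (- (s * real ?b)) / (1 - exp (- (s * real ?b))) * (exp (- (s * real ?a)) / (1 - exp (- (s * real ?a))))))
      - (gk ?k (s * real ?b) * real (e 0 + e 1) + gk ?k (s * real ?a) * real (e 2 + e 3)))
      / ((1 - exp (- (s * real ?b)))\<^sup>2 * (1 - exp (- (s * real ?a)))\<^sup>2) * Pr s (survive M (ext R e)) \<le> ?X"
      (is "exp (?v - ?w) / ?u * _ \<le> _") if e: "e \<in> ?E" for e
    proof -
      define m n where "m = e 0 + e 1" and "n = e 2 + e 3"
      have mn: "A \<le> m \<or> B \<le> n" "m < A + ?k" "n < B + ?k" using e by (auto simp: explorations_def m_def n_def)
      have mr: "real m \<le> gain s ?a + real ?k" "real n \<le> gain s ?b + real ?k"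
        using mn(2,3) AB(5,6) by linarith+
      let ?R = "ext R e"
      have dims: "width ?R = ?a + m" "height ?R = ?b + n" "proper ?R"
        using width_ext height_ext proper_ext less.prems(1) by (auto simp: m_def n_def)
      have IH: "Pr s (survive M ?R) \<le> exp (- W (s * real (?a + m)) (s * real (?b + n)) / s
          + ?e * (steps s (s * real (?a + m)) + steps s (s * real (?b + n))) + (2 * TT + 4))"
      proof -
        \<comment> \<open>Both sides are still below \<open>TT / s\<close>, so the truncated
          subtraction in the induction measure is positive and really decreases.\<close>
        have "real ?a \<le> TT / s" "real ?b \<le> TT / s" using lt s by (auto simp: field_simps)
        hence "?a \<le> nat \<lceil>TT / s\<rceil>" "?b \<le> nat \<lceil>TT / s\<rceil>" by linarith+
        moreover have "real ?a < TT / s" using lt s by (simp add: field_simps)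
        hence "?a < nat \<lceil>TT / s\<rceil>" by linarith
        moreover have "m + n > 0" using mn(1) AB(1,2) by linarith
        ultimately have "2 * nat \<lceil>TT / s\<rceil> - (width ?R + height ?R) < 2 * nat \<lceil>TT / s\<rceil> - (?a + ?b)"
          unfolding dims by linarith
        from less.hyps[OF this dims(3)] show ?thesis unfolding dims using less.prems(2,3) by simp
      qed
      have st: "steps s (s * real (?a + m)) + steps s (s * real (?b + n)) + 1 \<le> steps s (s * real ?a) + steps s (s * real ?b)"
      proof -
        have le: "steps s (s * real (c + d)) \<le> steps s (s * real c)" if "s * real c > 0" for c d
          using that s by (intro steps_anti) auto
        have dec: "steps s (s * real (c + d)) + 1 \<le> steps s (s * real c)"
          if c: "s * real c > 0" "s * real c < TT" and d: "gain s c \<le> real d" for c d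
        proof (rule steps_decrease[OF s T(2) c(1)])
          have "sqrt s * TT * (1 - exp (- (s * real c))) = s * gain s c"
          proof -
            have "s * (TT / sqrt s) = TT * (s / sqrt s)" by simp
            also have "s / sqrt s = sqrt s" using s by (simp add: real_div_sqrt)
            finally show ?thesis unfolding gain_def by (simp only: mult.assoc[symmetric] mult.commute[of TT])
          qed
          also have "\<dots> \<le> s * real d" using d s by (intro mult_left_mono) auto
          finally show "s * real c + sqrt s * TT * (1 - exp (- (s * real c))) \<le> s * real (c + d)" by (simp add: algebra_simps)
        qed (use c in simp)
        from mn(1) show ?thesis
        proof
          assume "A \<le> m"
          hence "gain s ?a \<le> real m" using AB(3) by linarith
          thus ?thesis using dec[OF ab(1) lt(1)] le[OF ab(2), of n] by force
        next
          assume "B \<le> n"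
          hence "gain s ?b \<le> real n" using AB(4) by linarith
          thus ?thesis using dec[OF ab(2) lt(2)] le[OF ab(1), of m] by force
        qed
      qed
      have Wst: "W (s * real ?a) (s * real ?b) / s - W (s * real (?a + m)) (s * real (?b + n)) / s \<le> g (s * real ?b) * real m + g (s * real ?a) * real n"
      proof -
        have "W (s * real ?a) (s * real ?b) - W (s * real (?a + m)) (s * real (?b + n)) \<le>
          g (s * real ?b) * (s * real (?a + m) - s * real ?a) + g (s * real ?a) * (s * real (?b + n) - s * real ?b)"
          using ab s by (intro W_step) auto
        also have "\<dots> = s * (g (s * real ?b) * real m + g (s * real ?a) * real n)" by (simp add: algebra_simps)
        finally have "W (s * real ?a) (s * real ?b) - W (s * real (?a + m)) (s * real (?b + n)) \<le> s * (g (s * real ?b) * real m + g (s * real ?a) * real n)" .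
        thus ?thesis using s by (simp add: diff_divide_distrib[symmetric] pos_divide_le_eq mult.commute)
      qed
      have verr: "?v - ?w \<le> err - (g (s * real ?b) * real m + g (s * real ?a) * real n)"
        using err(2)[OF gain1(1)[OF sab(1)] gain1(1)[OF sab(2)] mr wh]
        unfolding m_def[symmetric] n_def[symmetric] by (simp add: algebra_simps)
      have uu: "1 / ?u \<le> exp (5 * TT)"
      proof -
        have "(sqrt s / 2)\<^sup>2 * (sqrt s / 2)\<^sup>2 \<le> ?u"
          using u[OF sab(1)] u[OF sab(2)] sq by (intro mult_mono power_mono) auto
        moreover have "(sqrt s / 2)\<^sup>2 * (sqrt s / 2)\<^sup>2 = s\<^sup>2 / 16" using s by (simp add: power_divide power2_eq_square)
        ultimately have "s\<^sup>2 / 16 \<le> ?u" by simp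
        moreover have "1 / Y \<le> 1 / X" if "0 < X" "X \<le> Y" for X Y :: real using that by (intro divide_left_mono) auto
        moreover have "0 < s\<^sup>2 / 16" using s by simp
        ultimately have "1 / ?u \<le> 1 / (s\<^sup>2 / 16)" by blast
        also have "\<dots> = 16 * (1 / s)\<^sup>2" by (simp add: power_divide)
        also have "\<dots> \<le> (1 / s) ^ 3 * (1 / s)\<^sup>2"
        proof (intro mult_right_mono)
          have "exp 3 \<le> 1 / s" using T(1) s by (metis exp_le_cancel_iff exp_ln zero_less_divide_1_iff)
          hence "4 \<le> 1 / s" using exp_ge_add_one_self[of 3] by linarith
          hence "4 ^ 3 \<le> (1 / s) ^ 3" by (intro power_mono) auto
          thus "16 \<le> (1 / s) ^ 3" by simp
        qed (use s in auto)
        also have "\<dots> = (1 / s) ^ 5" by (simp add: power_add[symmetric])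
        also have "\<dots> = exp (5 * TT)" using s exp_of_nat_mult[of 5 TT] by (simp add: exp_minus)
        finally show ?thesis .
      qed
      have "exp (?v - ?w) / ?u * Pr s (survive M ?R) = exp (?v - ?w) * (1 / ?u) * Pr s (survive M ?R)" by simp
      also have "\<dots> \<le> exp (err - (g (s * real ?b) * real m + g (s * real ?a) * real n)) * exp (5 * TT) *
        exp (- W (s * real (?a + m)) (s * real (?b + n)) / s
          + ?e * (steps s (s * real (?a + m)) + steps s (s * real (?b + n))) + (2 * TT + 4))"
        using verr uu IH by (intro mult_mono) auto
      also have "\<dots> = exp (err - (g (s * real ?b) * real m + g (s * real ?a) * real n) + 5 * TT +
        (- W (s * real (?a + m)) (s * real (?b + n)) / s
          + ?e * (steps s (s * real (?a + m)) + steps s (s * real (?b + n))) + (2 * TT + 4)))"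
        by (simp only: exp_add)
      also have "\<dots> \<le> ?X"
      proof -
        have "?e * (steps s (s * real (?a + m)) + steps s (s * real (?b + n)) + 1) \<le> ?e * (steps s (s * real ?a) + steps s (s * real ?b))"
          using st e0 by (intro mult_left_mono) auto
        hence "?e * (steps s (s * real (?a + m)) + steps s (s * real (?b + n))) + ?e \<le> ?e * (steps s (s * real ?a) + steps s (s * real ?b))"
          by (simp only: distrib_left mult_1_right)
        thus ?thesis using Wst by (simp only: exp_le_cancel_iff)
      qed
      finally show ?thesis .
    qed
    have "Pr s (survive M R) \<le> (\<Sum>e\<in>?E. ?X)"
      by (rule order_trans[OF Pr_survive_step[OF less.prems(1) s(1) k_pos AB(1,2)] sum_mono[OF summand]])
    also have "\<dots> = real (card ?E) * ?X" by simp
    also have "\<dots> \<le> exp (4 * TT) * ?X" using card by (intro mult_right_mono) auto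
    also have "\<dots> = exp (- W (s * real ?a) (s * real ?b) / s + ?e * (steps s (s * real ?a) + steps s (s * real ?b)) + (2 * TT + 4))"
      by (simp add: exp_add[symmetric])
    finally show ?thesis .
  qed
qed

text \<open>The recursion starts at a square of side about \<open>s^(-1/2)\<close>; growth up to
  that size is given away. By the lower bound on \<open>G\<close> this loses only
  \<open>O(ln (1 / s) * s^(-1/2))\<close> in the exponent, apart from \<open>2 * d / s\<close>,
  where \<open>d\<close> is the loss caused by a modified \<open>G\<close>.\<close>

lemma growth_bound:
  assumes "\<And>x. 0 < x \<Longrightarrow> x \<le> 1 \<Longrightarrow> G x \<ge> lambda_k (model_k M) - x * (2 - ln x) - d"
    and "sqrt s \<le> 1 / 2"
  shows "P_growth M s \<le> exp (- 2 * lambda_k (model_k M) / s + (8 + 2 * TT + 2 * d / sqrt s + 10 * (9 * TT + err)) / sqrt s + (2 * TT + 4))"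
proof -
  have sq: "sqrt s > 0" "sqrt s * sqrt s = s" using s by auto
  define n where "n = nat \<lceil>1 / sqrt s\<rceil>"
  have n: "real n \<ge> 1 / sqrt s" "real n \<le> 1 / sqrt s + 1" "n \<ge> 1"
  proof -
    have "1 / sqrt s > 0" using sq by simp
    thus "real n \<ge> 1 / sqrt s" "real n \<le> 1 / sqrt s + 1" "n \<ge> 1" unfolding n_def by linarith+
  qed
  define x where "x = s * real n"
  have x: "sqrt s \<le> x" "x \<le> 2 * sqrt s" "x > 0" "x \<le> 1"
  proof -
    have e: "s * (1 / sqrt s) = sqrt s" using sq by (simp add: real_div_sqrt s less_imp_le)
    have "s * (1 / sqrt s) \<le> s * real n" using n s by (intro mult_left_mono) auto
    thus 1: "sqrt s \<le> x" unfolding x_def e .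
    have "s * real n \<le> s * (1 / sqrt s + 1)" using n s by (intro mult_left_mono) auto
    also have "\<dots> = sqrt s + sqrt s * sqrt s" using e sq by (simp add: distrib_left)
    also have "\<dots> \<le> sqrt s + sqrt s * 1" using s sq by (intro add_left_mono mult_left_mono) auto
    finally show 2: "x \<le> 2 * sqrt s" unfolding x_def by simp
    show "x > 0" "x \<le> 1" using 1 2 sq assms(2) by linarith+
  qed
  let ?R = "(0, int n - 1, 0, int n - 1)"
  have R: "proper ?R" "width ?R = n" "height ?R = n" "included (0,0,0,0) ?R" using n(3) by auto
  have "P_growth M s \<le> Pr s (survive M ?R)" unfolding P_growth_def
    using indefinite_growth_survive[OF valid] survive_mono[OF R(4)]
    by (intro Pr_mono dep_events[OF dep_survive]) blast
  also have "\<dots> \<le> exp (- W x x / s + (9 * TT + err) * (steps s x + steps s x) + (2 * TT + 4))"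
    using survive_bound[OF R(1)] n unfolding R x_def by simp
  also have "\<dots> \<le> exp (- 2 * lambda_k (model_k M) / s + (8 + 2 * TT + 2 * d / sqrt s + 10 * (9 * TT + err)) / sqrt s + (2 * TT + 4))"
  proof -
    have "ln x \<ge> ln (sqrt s)" using ln_le_cancel_iff[OF sq(1) x(3)] x(1) by blast
    moreover have "ln (sqrt s) = - TT / 2" using s by (simp add: ln_sqrt ln_div)
    ultimately have "2 - ln x \<le> 2 + TT / 2" by linarith
    hence "x * (2 - ln x) \<le> 2 * sqrt s * (2 + TT / 2)"
    proof -
      have "ln x \<le> 0" using x(3,4) by simp
      thus ?thesis using x(2,3) \<open>2 - ln x \<le> 2 + TT / 2\<close> by (intro mult_mono') linarith+
    qed
    hence "G x \<ge> lambda_k (model_k M) - 2 * sqrt s * (2 + TT / 2) - d" using assms(1)[OF x(3,4)] by linarith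
    moreover have "W x x = 2 * G x" by (simp add: W_def)
    ultimately have "- W x x \<le> - 2 * lambda_k (model_k M) + 4 * sqrt s * (2 + TT / 2) + 2 * d" by simp
    hence "- W x x / s \<le> (- 2 * lambda_k (model_k M) + 4 * sqrt s * (2 + TT / 2) + 2 * d) / s" using s by (intro divide_right_mono) auto
    also have "\<dots> = - 2 * lambda_k (model_k M) / s + (8 + 2 * TT + 2 * d / sqrt s) / sqrt s"
    proof -
      have e: "1 / s = 1 / sqrt s * (1 / sqrt s)" "sqrt s / s = 1 / sqrt s" using sq by (auto simp: field_simps)
      have "(- 2 * lambda_k (model_k M) + 4 * sqrt s * (2 + TT / 2) + 2 * d) / s =
        - 2 * lambda_k (model_k M) / s + (8 + 2 * TT) * (sqrt s / s) + 2 * d * (1 / s)"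
      proof -
        have "4 * q * (2 + t / 2) / s = (8 + 2 * t) * (q / s)" for q t by (simp add: algebra_simps add_divide_distrib)
        thus ?thesis by (simp only: add_divide_distrib) simp
      qed
      also have "\<dots> = - 2 * lambda_k (model_k M) / s + (8 + 2 * TT + 2 * d / sqrt s) / sqrt s"
        unfolding e by (simp add: add_divide_distrib)
      finally show ?thesis .
    qed
    finally have 1: "- W x x / s \<le> - 2 * lambda_k (model_k M) / s + (8 + 2 * TT + 2 * d / sqrt s) / sqrt s" .
    have "(9 * TT + err) * (steps s x + steps s x) \<le> (9 * TT + err) * (5 / sqrt s + 5 / sqrt s)"
      using steps_start[OF s(1) _ x(1)] T err by (intro mult_left_mono add_mono) auto
    moreover have "E * (5 / q + 5 / q) = 10 * E / q" for E q :: real by (simp add: field_simps)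
    ultimately have 2: "(9 * TT + err) * (steps s x + steps s x) \<le> 10 * (9 * TT + err) / sqrt s" by metis
    show ?thesis using 1 2 by (simp add: add_divide_distrib)
  qed
  finally show ?thesis .
qed

end

section \<open>The corner error in the general case and for Frobse\<close>

lemma gk_cost: assumes "k \<ge> 1" shows "cost (gk k) (Gam k)"
  by unfold_locales (use gk_convex[OF assms] gk_anti[OF assms] Gam_deriv[OF assms] in auto)

lemma gk_1: assumes "z > 0" shows "gk 1 z = z - ln (exp z - 1)"
proof -
  have "zeta 1 (ln (exp z - 1)) = ln (1 + exp (ln (exp z - 1)))" by (simp add: zeta_def geo_def exp_minus divide_inverse)
  also have "\<dots> = z" using assms by (simp add: exp_ln)
  finally have "zinv 1 z = ln (exp z - 1)" using zinv_zeta[of 1 "ln (exp z - 1)"] by simp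
  thus ?thesis by (simp add: gk_def)
qed

text \<open>For the Frobse model the error from the corners is proportional to the number of columns and
  rows and can be absorbed into the cost function.\<close>
lemma frobse_cost:
  assumes c: "0 \<le> c" "c \<le> 1"
  shows "cost (\<lambda>z. gk 1 z - c * exp (- z)) (\<lambda>z. Gam 1 z - c * exp (- z))"
proof
  let ?g = "\<lambda>z. gk 1 z - c * exp (- z)"
  let ?D = "\<lambda>z::real. c * exp (- z) - 1 / (exp z - 1)"
  have d: "(?g has_real_derivative ?D z) (at z)" if z: "z > 0" for z
  proof -
    have "((\<lambda>z. z - ln (exp z - 1) - c * exp (- z)) has_real_derivative 1 - 1 / (1 - exp (- z)) - c * (exp (- z) * (- 1))) (at z)"
      by (intro DERIV_diff DERIV_ident nu_deriv DERIV_cmult DERIV_fun_exp derivative_intros z)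
    moreover have "1 - 1 / (1 - exp (- z)) - c * (exp (- z) * (- 1)) = ?D z"
    proof -
      have "1 - 1 / (1 - 1 / X) = - (1 / (X - 1))" if "X > 1" for X :: real using that by (simp add: field_simps)
      from this[of "exp z"] z show ?thesis by (simp add: exp_minus divide_inverse)
    qed
    ultimately have "((\<lambda>z. z - ln (exp z - 1) - c * exp (- z)) has_real_derivative ?D z) (at z)" by simp
    thus ?thesis
      by (rule has_field_derivative_transform_within_open[where S = "{0<..}"]) (use z gk_1 in auto)
  qed
  \<comment> \<open>In this form both summands in the bracket are nonnegative and nonincreasing for
    \<open>c <= 1\<close>, which yields monotonicity and convexity together.\<close>
  have D: "?D z = - (1 / (exp z * (exp z - 1)) + (1 - c) / exp z)" if "z > 0" for z
  proof -
    have "c / X - 1 / (X - 1) = - (1 / (X * (X - 1)) + (1 - c) / X)" if "X > 1" for X :: real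
      using that by (simp add: divide_simps) (simp add: algebra_simps)
    from this[of "exp z"] that show ?thesis by (simp add: exp_minus divide_inverse)
  qed
  show "convex_on {0<..} ?g"
  proof (rule convex_on_realI[where f' = ?D])
    fix x y :: real assume xy: "x \<in> {0<..}" "y \<in> {0<..}" "x \<le> y"
    have e: "exp x > 1" "exp x \<le> exp y" using xy by auto
    have "1 / (exp y * (exp y - 1)) \<le> 1 / (exp x * (exp x - 1))"
      using e by (intro divide_left_mono mult_mono mult_pos_pos) auto
    moreover have "(1 - c) / exp y \<le> (1 - c) / exp x" using e c by (intro divide_left_mono) auto
    ultimately show "?D x \<le> ?D y" using D[of x] D[of y] xy by simp
  qed (use d in auto)
  show "?g y \<le> ?g x" if "0 < x" "x \<le> y" for x y
  proof (rule DERIV_nonpos_imp_nonincreasing[OF that(2)])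
    fix z assume "x \<le> z" "z \<le> y"
    hence z: "z > 0" using that by simp
    have "1 / (exp z * (exp z - 1)) \<ge> 0" "(1 - c) / exp z \<ge> 0" using z c by auto
    hence "?D z \<le> 0" using D[OF z] by linarith
    thus "\<exists>d. (?g has_real_derivative d) (at z) \<and> d \<le> 0" using d[OF z] by blast
  qed
  show "((\<lambda>z. Gam 1 z - c * exp (- z)) has_real_derivative - ?g z) (at z)" if "z > 0" for z
    using Gam_deriv[of 1 z] that by (auto intro!: derivative_eq_intros)
qed

lemma gain_bound: assumes "1 \<le> gain s a" "real m \<le> gain s a + real k"
  shows "real m \<le> (real k + 1) * gain s a"
proof -
  have "real k * 1 \<le> real k * gain s a" using assms(1) by (intro mult_left_mono) auto
  thus ?thesis using assms(2) by (simp add: algebra_simps)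
qed

text \<open>The label factor is at most \<open>1 / ((1 - x) * (1 - y))\<close>, and these are
  exactly the factors by which the two gains shrink. Hence the corner cost per round is bounded
  uniformly in the rectangle.\<close>

lemma upper_bound_general:
  assumes "valid_model M" "0 < s" "s < 1" "ln (1 / s) \<ge> 3" "sqrt s * ln (1 / s) \<le> 1"
    "2 * (ln (1 / s) / sqrt s) + real (model_k M) + 2 \<le> 1 / s"
  shows "upper_bound (gk (model_k M)) (Gam (model_k M)) M s ((real (model_k M) + 1)\<^sup>2 * (ln (1 / s))\<^sup>2)"
proof -
  let ?k = "model_k M" and ?T = "ln (1 / s)"
  have k: "?k \<ge> 1" using assms(1) by (cases M) (auto simp: valid_model_def model_k_def)
  interpret cost "gk ?k" "Gam ?k" by (rule gk_cost[OF k])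
  show ?thesis
  proof
    fix a b m n :: nat
    assume h: "1 \<le> gain s a" "1 \<le> gain s b" "real m \<le> gain s a + real ?k" "real n \<le> gain s b + real ?k" "a \<ge> 1" "b \<ge> 1"
    define x y where "x = exp (- (s * real a))" and "y = exp (- (s * real b))"
    have xy: "0 < x" "x < 1" "0 < y" "y < 1" using assms(2) h(5,6) by (auto simp: x_def y_def)
    let ?v = "y / (1 - y) + x / (1 - x) + (if M = Frobse1 then 0 else y / (1 - y) * (x / (1 - x)))"
    have v: "0 \<le> ?v" "?v \<le> 1 / ((1 - x) * (1 - y))"
    proof -
      have "y / (1 - y) * (x / (1 - x)) \<ge> 0" using xy by (intro mult_nonneg_nonneg) auto
      hence "?v \<le> y / (1 - y) + x / (1 - x) + y / (1 - y) * (x / (1 - x))" by auto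
      also have "\<dots> = (1 - (1 - x) * (1 - y)) / ((1 - x) * (1 - y))" using xy by (simp add: divide_simps) (simp add: algebra_simps)
      also have "\<dots> \<le> 1 / ((1 - x) * (1 - y))" using xy by (intro divide_right_mono) auto
      finally show "?v \<le> 1 / ((1 - x) * (1 - y))" .
      show "0 \<le> ?v" using xy by auto
    qed
    have "real (m * n) \<le> ((real ?k + 1) * gain s a) * ((real ?k + 1) * gain s b)"
      unfolding of_nat_mult using gain_bound[OF h(1,3)] gain_bound[OF h(2,4)] by (intro mult_mono') auto
    hence "s * real (m * n) \<le> s * (((real ?k + 1) * gain s a) * ((real ?k + 1) * gain s b))"
      using assms(2) by (intro mult_left_mono) auto
    also have "\<dots> = (real ?k + 1)\<^sup>2 * ?T\<^sup>2 * ((1 - x) * (1 - y)) * (s / (sqrt s * sqrt s))"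
      by (simp add: gain_def x_def y_def power2_eq_square mult_ac)
    also have "s / (sqrt s * sqrt s) = 1" using assms(2) by simp
    finally have "s * real (m * n) \<le> (real ?k + 1)\<^sup>2 * ?T\<^sup>2 * ((1 - x) * (1 - y))" by simp
    hence "s * real (m * n) * ?v \<le> (real ?k + 1)\<^sup>2 * ?T\<^sup>2 * ((1 - x) * (1 - y)) * (1 / ((1 - x) * (1 - y)))"
      by (rule mult_mono'[OF _ v(2) _ v(1)]) (use assms(2) in auto)
    also have "\<dots> = (real ?k + 1)\<^sup>2 * ?T\<^sup>2" using xy by simp
    finally show "s * real (m * n) * (exp (- (s * real b)) / (1 - exp (- (s * real b))) + exp (- (s * real a)) / (1 - exp (- (s * real a)))
        + (if M = Frobse1 then 0 else exp (- (s * real b)) / (1 - exp (- (s * real b))) * (exp (- (s * real a)) / (1 - exp (- (s * real a))))))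
      \<le> (real ?k + 1)\<^sup>2 * ?T\<^sup>2 + (gk ?k (s * real b) - gk ?k (s * real b)) * real m + (gk ?k (s * real a) - gk ?k (s * real a)) * real n"
      unfolding x_def y_def by simp
  qed (use assms in auto)
qed

text \<open>As no site has two labels, the label factor has no product term, and the corner cost
  splits into a part proportional to the columns and one proportional to the rows. In each, the
  factor \<open>1 - exp (- z)\<close> of the gain cancels the denominator and leaves
  \<open>c * exp (- z)\<close> per line.\<close>

lemma upper_bound_frobse:
  assumes "0 < s" "s < 1" "ln (1 / s) \<ge> 3" "2 * (sqrt s * ln (1 / s)) \<le> 1"
    "2 * (ln (1 / s) / sqrt s) + 3 \<le> 1 / s"
  defines "c \<equiv> 2 * (sqrt s * ln (1 / s))"
  shows "upper_bound (\<lambda>z. gk 1 z - c * exp (- z)) (\<lambda>z. Gam 1 z - c * exp (- z)) Frobse1 s 0"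
proof -
  let ?T = "ln (1 / s)"
  have c: "0 \<le> c" "c \<le> 1" using assms by (auto simp: c_def)
  have k: "model_k Frobse1 = 1" by (simp add: model_k_def)
  interpret cost "\<lambda>z. gk 1 z - c * exp (- z)" "\<lambda>z. Gam 1 z - c * exp (- z)" by (rule frobse_cost[OF c])
  show ?thesis
  proof
    fix a b m n :: nat
    assume h: "1 \<le> gain s a" "1 \<le> gain s b" "real m \<le> gain s a + real (model_k Frobse1)"
      "real n \<le> gain s b + real (model_k Frobse1)" "a \<ge> 1" "b \<ge> 1"
    have one: "s * real n * (exp (- (s * real b)) / (1 - exp (- (s * real b)))) \<le> c * exp (- (s * real b))"
      if "1 \<le> gain s b" "real n \<le> gain s b + 1" "b \<ge> 1" for b n :: nat
    proof -
      define y where "y = exp (- (s * real b))"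
      have y: "0 < y" "y < 1" using assms(1) that by (auto simp: y_def)
      have "s * real n * (y / (1 - y)) \<le> s * (2 * gain s b) * (y / (1 - y))"
        using that y assms(1) by (intro mult_right_mono mult_left_mono) auto
      also have "\<dots> = 2 * (s / sqrt s) * ?T * y * ((1 - y) / (1 - y))" by (simp add: gain_def y_def)
      also have "\<dots> = c * y" using y assms(1) by (simp add: c_def real_div_sqrt)
      finally show ?thesis unfolding y_def .
    qed
    have "s * real (m * n) * (exp (- (s * real b)) / (1 - exp (- (s * real b))) + exp (- (s * real a)) / (1 - exp (- (s * real a)))) =
      (s * real n * (exp (- (s * real b)) / (1 - exp (- (s * real b))))) * real m + (s * real m * (exp (- (s * real a)) / (1 - exp (- (s * real a))))) * real n"
      by (simp add: algebra_simps)
    also have "\<dots> \<le> c * exp (- (s * real b)) * real m + c * exp (- (s * real a)) * real n"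
      using one[of b n] one[of a m] h k by (intro add_mono mult_right_mono) auto
    finally show "s * real (m * n) * (exp (- (s * real b)) / (1 - exp (- (s * real b))) + exp (- (s * real a)) / (1 - exp (- (s * real a)))
        + (if Frobse1 = Frobse1 then 0 else exp (- (s * real b)) / (1 - exp (- (s * real b))) * (exp (- (s * real a)) / (1 - exp (- (s * real a))))))
      \<le> 0 + (gk (model_k Frobse1) (s * real b) - (gk 1 (s * real b) - c * exp (- (s * real b)))) * real m
        + (gk (model_k Frobse1) (s * real a) - (gk 1 (s * real a) - c * exp (- (s * real a)))) * real n"
      by (simp add: k)
  qed (use assms c in \<open>auto simp: valid_model_def model_k_def\<close>)
qed

theorem growth_upper_bound:
  assumes "valid_model M"
  shows "\<exists>c>0. eventually (\<lambda>s. P_growth M s \<le> exp (- 2 * lambda_k (model_k M) / s + c * s powr (- 1 / 2) *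
        (if M = Frobse1 then ln (1 / s) else ln (1 / s) powr (5 / 2)))) (at_right 0)"
proof -
  let ?k = "model_k M"
  have k: "?k \<ge> 1" using assms by (cases M) (auto simp: valid_model_def model_k_def)
  define c where "c = 200 + 10 * (real ?k + 1)\<^sup>2"
  have 1: "eventually (\<lambda>s::real. 0 < s) (at_right 0)" by (simp add: eventually_at_right_less)
  have 2: "eventually (\<lambda>s::real. s < 1 / 4) (at_right 0)" by real_asymp
  have 3: "eventually (\<lambda>s::real. ln (1 / s) \<ge> 3) (at_right 0)" by real_asymp
  have 4: "eventually (\<lambda>s::real. 2 * (sqrt s * ln (1 / s)) \<le> 1) (at_right 0)" by real_asymp
  have "((\<lambda>s. (2 * (ln (1 / s) / sqrt s) + real ?k + 2) * s) \<longlongrightarrow> 0) (at_right 0)" by real_asymp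
  hence 5: "eventually (\<lambda>s. (2 * (ln (1 / s) / sqrt s) + real ?k + 2) * s < 1) (at_right 0)" by (rule order_tendstoD) simp
  have "eventually (\<lambda>s. P_growth M s \<le> exp (- 2 * lambda_k ?k / s + c * s powr (- 1 / 2) *
        (if M = Frobse1 then ln (1 / s) else ln (1 / s) powr (5 / 2)))) (at_right 0)"
    using 1 2 3 4 5
  proof eventually_elim
    case (elim s)
    let ?T = "ln (1 / s)"
    have r: "s powr (- 1 / 2) = 1 / sqrt s" using elim by (simp add: powr_minus powr_half_sqrt field_simps)
    have sq: "0 < sqrt s" "sqrt s \<le> 1 / 2" using elim real_sqrt_le_mono[of s "1/4"] by (auto simp: real_sqrt_divide)
    have small: "2 * (?T / sqrt s) + real ?k + 2 \<le> 1 / s"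
      using elim by (simp add: pos_le_divide_eq less_imp_le)
    have tail: "2 * ?T + 4 \<le> 6 * ?T / sqrt s"
    proof -
      have "2 * ?T + 4 \<le> 6 * ?T" using elim by simp
      also have "6 * ?T = 6 * ?T / 1" by simp
      also have "\<dots> \<le> 6 * ?T / sqrt s" using elim sq by (intro divide_left_mono) auto
      finally show ?thesis .
    qed
    show ?case
    proof (cases "M = Frobse1")
      case True
      define d where "d = 2 * (sqrt s * ?T)"
      have k1: "?k = 1" using True by (simp add: model_k_def)
      interpret upper_bound "\<lambda>z. gk 1 z - d * exp (- z)" "\<lambda>z. Gam 1 z - d * exp (- z)" Frobse1 s 0
        unfolding d_def by (rule upper_bound_frobse) (use elim small k1 in auto)
      have "P_growth M s \<le> exp (- 2 * lambda_k ?k / s + (8 + 2 * ?T + 2 * d / sqrt s + 10 * (9 * ?T + 0)) / sqrt s + (2 * ?T + 4))"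
        unfolding True
      proof (rule growth_bound)
        fix x :: real assume x: "0 < x" "x \<le> 1"
        have "d * exp (- x) \<le> d * 1" using x elim by (intro mult_left_mono) (auto simp: d_def)
        thus "lambda_k (model_k Frobse1) - x * (2 - ln x) - d \<le> Gam 1 x - d * exp (- x)"
          using Gam_ge[of 1 x] x by (simp add: model_k_def)
      qed (use sq in simp)
      also have "\<dots> \<le> exp (- 2 * lambda_k ?k / s + c * s powr (- 1 / 2) * ?T)"
      proof -
        \<comment> \<open>The absorbed corner cost \<open>d\<close> is of order
          \<open>sqrt s * ?T\<close>, so after division by \<open>s\<close> it contributes
          \<open>?T / sqrt s\<close>, the same order as the other terms.\<close>
        have "d / sqrt s = 2 * ?T" using sq by (simp add: d_def)
        hence "8 + 2 * ?T + 2 * d / sqrt s + 10 * (9 * ?T + 0) + 6 * ?T = 8 + 102 * ?T" by simp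
        also have "\<dots> \<le> c * ?T"
        proof -
          have "200 * ?T \<le> c * ?T" using elim by (intro mult_right_mono) (auto simp: c_def)
          thus ?thesis using elim by linarith
        qed
        finally have "(8 + 2 * ?T + 2 * d / sqrt s + 10 * (9 * ?T + 0) + 6 * ?T) / sqrt s \<le> c * ?T / sqrt s"
          using sq by (intro divide_right_mono) auto
        hence "(8 + 2 * ?T + 2 * d / sqrt s + 10 * (9 * ?T + 0)) / sqrt s + 6 * ?T / sqrt s \<le> c * (1 / sqrt s) * ?T"
          by (simp only: add_divide_distrib) simp
        thus ?thesis using tail unfolding r by simp
      qed
      finally show ?thesis using True by simp
    next
      case False
      interpret upper_bound "gk ?k" "Gam ?k" M s "(real ?k + 1)\<^sup>2 * ?T\<^sup>2"
        by (rule upper_bound_general) (use assms elim small in auto)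
      have "P_growth M s \<le> exp (- 2 * lambda_k ?k / s + (8 + 2 * ?T + 2 * 0 / sqrt s + 10 * (9 * ?T + (real ?k + 1)\<^sup>2 * ?T\<^sup>2)) / sqrt s + (2 * ?T + 4))"
        by (rule growth_bound) (use Gam_ge[OF k] sq in auto)
      also have "\<dots> \<le> exp (- 2 * lambda_k ?k / s + c * s powr (- 1 / 2) * ?T powr (5 / 2))"
      proof -
        \<comment> \<open>About \<open>10 / sqrt s\<close> rounds with corner cost of order
          \<open>?T^2\<close> give a squared logarithm, which is then weakened to the power
          \<open>5/2\<close>.\<close>
        have T2: "?T \<le> ?T\<^sup>2" "8 \<le> 8 * ?T\<^sup>2"
          using elim(3) power_increasing[of 1 2 ?T] power_increasing[of 0 2 ?T] by auto
        have "?T\<^sup>2 = ?T powr 2" using elim(3) by (simp add: powr_numeral)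
        also have "\<dots> \<le> ?T powr (5 / 2)" using elim(3) by (intro powr_mono) auto
        finally have T5: "?T\<^sup>2 \<le> ?T powr (5 / 2)" .
        have "8 + 2 * ?T + 2 * 0 / sqrt s + 10 * (9 * ?T + (real ?k + 1)\<^sup>2 * ?T\<^sup>2) + 6 * ?T = 8 + 98 * ?T + 10 * (real ?k + 1)\<^sup>2 * ?T\<^sup>2" by simp
        also have "\<dots> \<le> c * ?T\<^sup>2" using T2 elim(3) unfolding c_def distrib_right by linarith
        also have "\<dots> \<le> c * ?T powr (5 / 2)" using T5 by (intro mult_left_mono) (auto simp: c_def)
        finally have "(8 + 2 * ?T + 2 * 0 / sqrt s + 10 * (9 * ?T + (real ?k + 1)\<^sup>2 * ?T\<^sup>2) + 6 * ?T) / sqrt s \<le> c * ?T powr (5 / 2) / sqrt s"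
          using sq by (intro divide_right_mono) auto
        hence "(8 + 2 * ?T + 2 * 0 / sqrt s + 10 * (9 * ?T + (real ?k + 1)\<^sup>2 * ?T\<^sup>2)) / sqrt s + 6 * ?T / sqrt s \<le> c * (1 / sqrt s) * ?T powr (5 / 2)"
          by (simp only: add_divide_distrib) simp
        thus ?thesis using tail unfolding r by simp
      qed
      finally show ?thesis using False by simp
    qed
  qed
  moreover have "c > 0" by (simp add: c_def add_pos_nonneg)
  ultimately show ?thesis by blast
qed

theorem theorem1:
  assumes "valid_model M"
  shows "\<exists>s0>0. \<exists>c1>0. \<exists>c2>0. \<forall>s::real. 0 < s \<and> s < s0 \<longrightarrow>
     exp (- 2 * lambda_k (model_k M) / s + c1 * s powr (-1/2)) \<le> P_growth M s \<and>
     P_growth M s \<le> exp (- 2 * lambda_k (model_k M) / s + c2 * s powr (-1/2) *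
        (if M = Frobse1 then ln (1 / s) else ln (1 / s) powr (5/2)))"
proof -
  obtain c1 where c1: "c1 > 0" "eventually (\<lambda>s. exp (- 2 * lambda_k (model_k M) / s + c1 * s powr (- 1 / 2)) \<le> P_growth M s) (at_right 0)"
    using growth_lower_bound[OF assms] by blast
  obtain c2 where c2: "c2 > 0" "eventually (\<lambda>s. P_growth M s \<le> exp (- 2 * lambda_k (model_k M) / s + c2 * s powr (- 1 / 2) *
        (if M = Frobse1 then ln (1 / s) else ln (1 / s) powr (5 / 2)))) (at_right 0)"
    using growth_upper_bound[OF assms] by blast
  from eventually_conj[OF c1(2) c2(2)] obtain s0 where "s0 > 0" and s0: "\<And>s. 0 < s \<Longrightarrow> s < s0 \<Longrightarrow>
     exp (- 2 * lambda_k (model_k M) / s + c1 * s powr (- 1 / 2)) \<le> P_growth M s \<and>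
     P_growth M s \<le> exp (- 2 * lambda_k (model_k M) / s + c2 * s powr (- 1 / 2) *
        (if M = Frobse1 then ln (1 / s) else ln (1 / s) powr (5 / 2)))"
    unfolding eventually_at_right_field by blast
  show ?thesis
    using \<open>s0 > 0\<close> c1(1) c2(1) s0 by blast
qed

end
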